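(* Let $\mathcal A$ be as in the context. (a) If $[\cdot,\cdot]$ is a bracket of form degree $-1$ on $\Omega(\mathcal A)$ making $(\Omega(\mathcal A),\wedge,[\cdot,\cdot])$ a Gerstenhaber superalgebra, then $\Omega^1(\mathcal A)$ with bracket $\llbracket\alpha,\beta\rrbracket=[\alpha,\beta]$ and anchor $\rho(\alpha)=[\alpha,\cdot]|_{\mathcal A}$ is a Lie superalgebroid. (b) Conversely, if $(\Omega^1(\mathcal A),\llbracket\cdot,\cdot\rrbracket,\rho)$ is a Lie superalgebroid, then there is a bracket $[\cdot,\cdot]$ on $\Omega(\mathcal A)$ making $(\Omega(\mathcal A),\wedge,[\cdot,\cdot])$ a Gerstenhaber superalgebra with $[f,g]=0$, $[\alpha,f]=\rho(\alpha)(f)$ and $[\alpha,\beta]=\llbracket\alpha,\beta\rrbracket$ for $f,g\in\mathcal A$, $\alpha,\beta\in\Omega^1(\mathcal A)$. In particular, $\Omega(\mathcal A)$ admits a Gerstenhaber superalgebra structure (of this kind) if and only if $\Omega^1(\mathcal A)$ admits a Lie superalgebroid structure.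
   Context: $\mathcal A$ is a $\mathbb Z$-graded, associative, graded-commutative unital real algebra, regarded as supercommutative with parity $p$ = degree mod 2. $\Omega^1(\mathcal A)=\ker(\mathbf m:\mathcal A\otimes\mathcal A\to\mathcal A)$ with $\mathbf d a=a\otimes1-1\otimes a$, generated over $\mathcal A$ by $\mathbf d\mathcal A$; $\Omega(\mathcal A)=\bigoplus_{r\ge0}\Omega^r(\mathcal A)$, $\Omega^0(\mathcal A)=\mathcal A$, is the algebra of superforms generated over $\mathcal A$ by $\Omega^1(\mathcal A)$ with wedge product, bigraded by form degree $\deg$ (in $\mathbb Z$) and parity $p$ (in $\mathbb Z_2$). A Gerstenhaber superalgebra is a $\mathbb Z$-graded superalgebra $(\mathcal B,\wedge)$ with a bracket $[\cdot,\cdot]$ such that for bihomogeneous $\alpha,\beta,\gamma$: $[\alpha,\beta]=-(-1)^{(\deg\alpha-1)(\deg\beta-1)+p(\alpha)p(\beta)}[\beta,\alpha]$; $[\alpha,[\beta,\gamma]]=[[\alpha,\beta],\gamma]+(-1)^{(\deg\alpha-1)(\deg\beta-1)+p(\alpha)p(\beta)}[\beta,[\alpha,\gamma]]$; $[\alpha,\beta\wedge\gamma]=[\alpha,\beta]\wedge\gamma+(-1)^{(\deg\alpha-1)\deg\beta+p(\alpha)p(\beta)}\beta\wedge[\alpha,\gamma]$. Form degree $-1$ means $[\Omega^i,\Omega^j]\subseteq\Omega^{i+j-1}$. A Lie superalgebroid on $\Omega^1(\mathcal A)$ is an even $\mathcal A$-linear anchor $\rho:\Omega^1(\mathcal A)\to\operatorname{Der}(\mathcal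 A)$ (graded derivations) with a bilinear bracket making $\Omega^1(\mathcal A)$ a Lie superalgebra and satisfying $\llbracket\alpha,f\beta\rrbracket=\rho(\alpha)(f)\beta+(-1)^{p(\alpha)p(f)}f\llbracket\alpha,\beta\rrbracket$. *)

theory Defs
  imports "HOL-Analysis.Analysis" "HOL-Library.Function_Algebras"
begin

instantiation "fun" :: (type, real_vector) real_vector
begin
definition scaleR_fun :: "real \<Rightarrow> ('a \<Rightarrow> 'b) \<Rightarrow> 'a \<Rightarrow> 'b" where
  "scaleR_fun c f = (\<lambda>x. c *\<^sub>R f x)"
instance
  by standard (auto simp: scaleR_fun_def fun_eq_iff scaleR_add_right scaleR_add_left)
end

text \<open>A is the whole type 'a (an associative unital real algebra); its Z-grading is
  given by the family of subspaces G n, n :: int.  Parities are encoded as naturals 0/1.\<close>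

definition graded_supercomm_algebra :: "(int \<Rightarrow> 'a::real_algebra_1 set) \<Rightarrow> bool" where
  "graded_supercomm_algebra G \<longleftrightarrow>
     (\<forall>n. subspace (G n)) \<and>
     (\<forall>a. \<exists>!c. finite {n. c n \<noteq> 0} \<and> (\<forall>n. c n \<in> G n) \<and> a = (\<Sum>n\<in>{n. c n \<noteq> 0}. c n)) \<and>
     1 \<in> G 0 \<and>
     (\<forall>m n a b. a \<in> G m \<longrightarrow> b \<in> G n \<longrightarrow> a * b \<in> G (m + n)) \<and>
     (\<forall>m n a b. a \<in> G m \<longrightarrow> b \<in> G n \<longrightarrow>
        a * b = (if even (m * n) then b * a else - (b * a)))"

definition Apar :: "(int \<Rightarrow> 'a::real_algebra_1 set) \<Rightarrow> nat \<Rightarrow> 'a set" where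
  "Apar G p = span (\<Union>n\<in>{n. n mod 2 = int p}. G n)"

definition acomp :: "(int \<Rightarrow> 'a::real_algebra_1 set) \<Rightarrow> nat \<Rightarrow> 'a \<Rightarrow> 'a" where
  "acomp G p a = (THE b. b \<in> Apar G p \<and> a - b \<in> Apar G (1 - p))"

text \<open>Model of the real tensor product: a \<otimes> b is the bilinear form
  (\<phi>,\<psi>) \<mapsto> \<phi> a * \<psi> b on pairs of real-linear functionals; A \<otimes>_R A is the span
  of these (the canonical map V \<otimes> W \<rightarrow> Bil(V^* \<times> W^*) is injective).\<close>

type_synonym 'a tens = "('a \<Rightarrow> real) \<times> ('a \<Rightarrow> real) \<Rightarrow> real"

definition tensor :: "'a::real_vector \<Rightarrow> 'a \<Rightarrow> 'a tens" where
  "tensor a b = (\<lambda>(\<phi>, \<psi>). if linear \<phi> \<and> linear \<psi> then \<phi> a * \<psi> b else 0)"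

definition AtA :: "'a::real_vector tens set" where
  "AtA = span (range (case_prod tensor))"

text \<open>\<Omega>^1(A) = ker (m : A \<otimes> A \<rightarrow> A), m(a \<otimes> b) = a b.\<close>
definition Omega1 :: "'a::real_algebra_1 tens set" where
  "Omega1 = {t. \<exists>xs. t = sum_list (map (case_prod tensor) xs)
                  \<and> sum_list (map (\<lambda>(a, b). a * b) xs) = 0}"

definition dA :: "'a::real_algebra_1 \<Rightarrow> 'a tens" where
  "dA a = tensor a 1 - tensor 1 a"

text \<open>Left A-module structure: f \<cdot> (a \<otimes> b) = (f a) \<otimes> b.\<close>
definition lact :: "'a::real_algebra_1 \<Rightarrow> 'a tens \<Rightarrow> 'a tens" where
  "lact f t = (\<lambda>(\<phi>, \<psi>). if linear \<phi> \<and> linear \<psi> then t (\<lambda>x. \<phi> (f * x), \<psi>) else 0)"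

definition Tpar :: "(int \<Rightarrow> 'a::real_algebra_1 set) \<Rightarrow> nat \<Rightarrow> 'a tens set" where
  "Tpar G p = span {tensor a b | a b p1 p2. a \<in> Apar G p1 \<and> b \<in> Apar G p2 \<and> (p1 + p2) mod 2 = p}"

definition O1par :: "(int \<Rightarrow> 'a::real_algebra_1 set) \<Rightarrow> nat \<Rightarrow> 'a tens set" where
  "O1par G p = Omega1 \<inter> Tpar G p"

definition tcomp :: "(int \<Rightarrow> 'a::real_algebra_1 set) \<Rightarrow> nat \<Rightarrow> 'a tens \<Rightarrow> 'a tens" where
  "tcomp G p t = (THE s. s \<in> Tpar G p \<and> t - s \<in> Tpar G (1 - p))"

text \<open>Presentation: formal real combinations of tagged words (p, f, [(q1,\<alpha>1),...,(qr,\<alpha>r)])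
  standing for f \<wedge> \<alpha>1 \<wedge> ... \<wedge> \<alpha>r with f \<in> A of parity p and \<alpha>i \<in> \<Omega>^1(A) of parity qi,
  modulo the relations of the super exterior algebra over the supercommutative A
  (R-multilinearity, A-balancedness, super-antisymmetry).  Elements of \<Omega>(A) are
  the classes; we work with representatives and the equivalence oeq.\<close>

type_synonym 'a word = "nat \<times> 'a \<times> (nat \<times> 'a tens) list"
type_synonym 'a form = "'a word \<Rightarrow> real"

definition wd :: "'a word \<Rightarrow> 'a form" where
  "wd w = (\<lambda>u. if u = w then 1 else 0)"

definition valid_word :: "(int \<Rightarrow> 'a::real_algebra_1 set) \<Rightarrow> 'a word \<Rightarrow> bool" where
  "valid_word G w \<longleftrightarrow> (case w of (p, f, as) \<Rightarrow>
      p < 2 \<and> f \<in> Apar G p \<and> (\<forall>(q, \<alpha>) \<in> set as. q < 2 \<and> \<alpha> \<in> O1par G q))"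

definition wdeg :: "'a word \<Rightarrow> nat" where
  "wdeg w = length (snd (snd w))"

definition wpar :: "'a word \<Rightarrow> nat" where
  "wpar w = (fst w + sum_list (map fst (snd (snd w)))) mod 2"

definition Relators :: "(int \<Rightarrow> 'a::real_algebra_1 set) \<Rightarrow> 'a form set" where
  "Relators G =
     {wd (p, f + g, as) - wd (p, f, as) - wd (p, g, as) | p f g as.
        valid_word G (p, f, as) \<and> valid_word G (p, g, as)}
   \<union> {wd (p, c *\<^sub>R f, as) - c *\<^sub>R wd (p, f, as) | p c f as. valid_word G (p, f, as)}
   \<union> {wd (p, f, us @ [(q, \<alpha> + \<beta>)] @ vs) - wd (p, f, us @ [(q, \<alpha>)] @ vs)
        - wd (p, f, us @ [(q, \<beta>)] @ vs) | p f us q \<alpha> \<beta> vs.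
        valid_word G (p, f, us @ [(q, \<alpha>)] @ vs) \<and> valid_word G (p, f, us @ [(q, \<beta>)] @ vs)}
   \<union> {wd (p, f, us @ [((q' + q) mod 2, lact g \<alpha>)] @ vs)
        - ((-1) ^ (q' * sum_list (map fst us))) *\<^sub>R wd ((p + q') mod 2, f * g, us @ [(q, \<alpha>)] @ vs)
        | p f us q' g q \<alpha> vs.
        q' < 2 \<and> g \<in> Apar G q' \<and> valid_word G (p, f, us @ [(q, \<alpha>)] @ vs)
        \<and> valid_word G (p, f, us @ [((q' + q) mod 2, lact g \<alpha>)] @ vs)}
   \<union> {wd (p, f, us @ [(q1, \<alpha>1), (q2, \<alpha>2)] @ vs)
        + ((-1) ^ (q1 * q2)) *\<^sub>R wd (p, f, us @ [(q2, \<alpha>2), (q1, \<alpha>1)] @ vs)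
        | p f us q1 \<alpha>1 q2 \<alpha>2 vs. valid_word G (p, f, us @ [(q1, \<alpha>1), (q2, \<alpha>2)] @ vs)}"

definition Om :: "(int \<Rightarrow> 'a::real_algebra_1 set) \<Rightarrow> 'a form set" where
  "Om G = span (wd ` {w. valid_word G w})"

definition oeq :: "(int \<Rightarrow> 'a::real_algebra_1 set) \<Rightarrow> 'a form \<Rightarrow> 'a form \<Rightarrow> bool" where
  "oeq G x y \<longleftrightarrow> x - y \<in> span (Relators G)"

definition Ohom :: "(int \<Rightarrow> 'a::real_algebra_1 set) \<Rightarrow> nat \<Rightarrow> nat \<Rightarrow> 'a form set" where
  "Ohom G r p = {x \<in> Om G. \<exists>y \<in> span (wd ` {w. valid_word G w \<and> wdeg w = r \<and> wpar w = p}).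
                              oeq G x y}"

definition wmul :: "'a::real_algebra_1 word \<Rightarrow> 'a word \<Rightarrow> 'a form" where
  "wmul u w = (case u of (p, f, as) \<Rightarrow> case w of (q, g, bs) \<Rightarrow>
      ((-1) ^ (q * sum_list (map fst as))) *\<^sub>R wd ((p + q) mod 2, f * g, as @ bs))"

definition wedge :: "'a::real_algebra_1 form \<Rightarrow> 'a form \<Rightarrow> 'a form" where
  "wedge x y = (\<Sum>u\<in>{u. x u \<noteq> 0}. \<Sum>w\<in>{w. y w \<noteq> 0}. (x u * y w) *\<^sub>R wmul u w)"

definition embA :: "(int \<Rightarrow> 'a::real_algebra_1 set) \<Rightarrow> 'a \<Rightarrow> 'a form" where
  "embA G f = wd (0, acomp G 0 f, []) + wd (1, acomp G 1 f, [])"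

definition emb1 :: "(int \<Rightarrow> 'a::real_algebra_1 set) \<Rightarrow> 'a tens \<Rightarrow> 'a form" where
  "emb1 G \<alpha> = wd (0, 1, [(0, tcomp G 0 \<alpha>)]) + wd (0, 1, [(1, tcomp G 1 \<alpha>)])"

definition sgni :: "int \<Rightarrow> real" where
  "sgni k = (if even k then 1 else -1)"

definition gerstenhaber :: "(int \<Rightarrow> 'a::real_algebra_1 set) \<Rightarrow> ('a form \<Rightarrow> 'a form \<Rightarrow> 'a form) \<Rightarrow> bool" where
  "gerstenhaber G br \<longleftrightarrow>
     (\<forall>x \<in> Om G. \<forall>y \<in> Om G. br x y \<in> Om G) \<and>
     (\<forall>x x' y y'. x \<in> Om G \<longrightarrow> x' \<in> Om G \<longrightarrow> y \<in> Om G \<longrightarrow> y' \<in> Om G \<longrightarrow>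
        oeq G x x' \<longrightarrow> oeq G y y' \<longrightarrow> oeq G (br x y) (br x' y')) \<and>
     (\<forall>c x x' y. x \<in> Om G \<longrightarrow> x' \<in> Om G \<longrightarrow> y \<in> Om G \<longrightarrow>
        oeq G (br (c *\<^sub>R x + x') y) (c *\<^sub>R br x y + br x' y)) \<and>
     (\<forall>c x y y'. x \<in> Om G \<longrightarrow> y \<in> Om G \<longrightarrow> y' \<in> Om G \<longrightarrow>
        oeq G (br x (c *\<^sub>R y + y')) (c *\<^sub>R br x y + br x y')) \<and>
     (\<forall>r s p q x y. p < 2 \<longrightarrow> q < 2 \<longrightarrow> x \<in> Ohom G r p \<longrightarrow> y \<in> Ohom G s q \<longrightarrow>
        (if r + s = 0 then oeq G (br x y) 0
         else br x y \<in> Ohom G (r + s - 1) ((p + q) mod 2))) \<and>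
     (\<forall>r s p q x y. p < 2 \<longrightarrow> q < 2 \<longrightarrow> x \<in> Ohom G r p \<longrightarrow> y \<in> Ohom G s q \<longrightarrow>
        oeq G (br x y)
          (- (sgni ((int r - 1) * (int s - 1) + int (p * q)) *\<^sub>R br y x))) \<and>
     (\<forall>r s t p q u x y z. p < 2 \<longrightarrow> q < 2 \<longrightarrow> u < 2 \<longrightarrow>
        x \<in> Ohom G r p \<longrightarrow> y \<in> Ohom G s q \<longrightarrow> z \<in> Ohom G t u \<longrightarrow>
        oeq G (br x (br y z))
          (br (br x y) z + sgni ((int r - 1) * (int s - 1) + int (p * q)) *\<^sub>R br y (br x z))) \<and>
     (\<forall>r s t p q u x y z. p < 2 \<longrightarrow> q < 2 \<longrightarrow> u < 2 \<longrightarrow>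
        x \<in> Ohom G r p \<longrightarrow> y \<in> Ohom G s q \<longrightarrow> z \<in> Ohom G t u \<longrightarrow>
        oeq G (br x (wedge y z))
          (wedge (br x y) z + sgni ((int r - 1) * int s + int (p * q)) *\<^sub>R wedge y (br x z)))"

definition superderiv :: "(int \<Rightarrow> 'a::real_algebra_1 set) \<Rightarrow> nat \<Rightarrow> ('a \<Rightarrow> 'a) \<Rightarrow> bool" where
  "superderiv G p D \<longleftrightarrow> linear D \<and>
     (\<forall>q a. q < 2 \<longrightarrow> a \<in> Apar G q \<longrightarrow> D a \<in> Apar G ((p + q) mod 2)) \<and>
     (\<forall>q a b. q < 2 \<longrightarrow> a \<in> Apar G q \<longrightarrow> D (a * b) = D a * b + ((-1) ^ (p * q)) *\<^sub>R (a * D b))"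

definition DerA :: "(int \<Rightarrow> 'a::real_algebra_1 set) \<Rightarrow> ('a \<Rightarrow> 'a) set" where
  "DerA G = {D. \<exists>D0 D1. superderiv G 0 D0 \<and> superderiv G 1 D1 \<and> D = (\<lambda>a. D0 a + D1 a)}"

definition lie_superalgebroid :: "(int \<Rightarrow> 'a::real_algebra_1 set) \<Rightarrow> ('a tens \<Rightarrow> 'a tens \<Rightarrow> 'a tens)
     \<Rightarrow> ('a tens \<Rightarrow> 'a \<Rightarrow> 'a) \<Rightarrow> bool" where
  "lie_superalgebroid G brk \<rho> \<longleftrightarrow>
     \<comment> \<open>anchor: even, A-linear map \<Omega>^1(A) \<rightarrow> Der(A)\<close>
     (\<forall>\<alpha> \<in> Omega1. \<rho> \<alpha> \<in> DerA G) \<and>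
     (\<forall>c \<alpha> \<beta>. \<alpha> \<in> Omega1 \<longrightarrow> \<beta> \<in> Omega1 \<longrightarrow> \<rho> (c *\<^sub>R \<alpha> + \<beta>) = (\<lambda>a. c *\<^sub>R \<rho> \<alpha> a + \<rho> \<beta> a)) \<and>
     (\<forall>p \<alpha>. p < 2 \<longrightarrow> \<alpha> \<in> O1par G p \<longrightarrow> superderiv G p (\<rho> \<alpha>)) \<and>
     (\<forall>f \<alpha>. \<alpha> \<in> Omega1 \<longrightarrow> \<rho> (lact f \<alpha>) = (\<lambda>a. f * \<rho> \<alpha> a)) \<and>
     \<comment> \<open>Lie superalgebra structure on \<Omega>^1(A)\<close>
     (\<forall>\<alpha> \<in> Omega1. \<forall>\<beta> \<in> Omega1. brk \<alpha> \<beta> \<in> Omega1) \<and>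
     (\<forall>c \<alpha> \<alpha>' \<beta>. \<alpha> \<in> Omega1 \<longrightarrow> \<alpha>' \<in> Omega1 \<longrightarrow> \<beta> \<in> Omega1 \<longrightarrow>
        brk (c *\<^sub>R \<alpha> + \<alpha>') \<beta> = c *\<^sub>R brk \<alpha> \<beta> + brk \<alpha>' \<beta>) \<and>
     (\<forall>c \<alpha> \<beta> \<beta>'. \<alpha> \<in> Omega1 \<longrightarrow> \<beta> \<in> Omega1 \<longrightarrow> \<beta>' \<in> Omega1 \<longrightarrow>
        brk \<alpha> (c *\<^sub>R \<beta> + \<beta>') = c *\<^sub>R brk \<alpha> \<beta> + brk \<alpha> \<beta>') \<and>
     (\<forall>p q \<alpha> \<beta>. p < 2 \<longrightarrow> q < 2 \<longrightarrow> \<alpha> \<in> O1par G p \<longrightarrow> \<beta> \<in> O1par G q \<longrightarrow>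
        brk \<alpha> \<beta> \<in> O1par G ((p + q) mod 2)) \<and>
     (\<forall>p q \<alpha> \<beta>. p < 2 \<longrightarrow> q < 2 \<longrightarrow> \<alpha> \<in> O1par G p \<longrightarrow> \<beta> \<in> O1par G q \<longrightarrow>
        brk \<alpha> \<beta> = - (((-1) ^ (p * q)) *\<^sub>R brk \<beta> \<alpha>)) \<and>
     (\<forall>p q u \<alpha> \<beta> \<gamma>. p < 2 \<longrightarrow> q < 2 \<longrightarrow> u < 2 \<longrightarrow>
        \<alpha> \<in> O1par G p \<longrightarrow> \<beta> \<in> O1par G q \<longrightarrow> \<gamma> \<in> O1par G u \<longrightarrow>
        brk \<alpha> (brk \<beta> \<gamma>) = brk (brk \<alpha> \<beta>) \<gamma> + ((-1) ^ (p * q)) *\<^sub>R brk \<beta> (brk \<alpha> \<gamma>)) \<and>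
     \<comment> \<open>Leibniz rule\<close>
     (\<forall>p q \<alpha> f \<beta>. p < 2 \<longrightarrow> q < 2 \<longrightarrow> \<alpha> \<in> O1par G p \<longrightarrow> f \<in> Apar G q \<longrightarrow> \<beta> \<in> Omega1 \<longrightarrow>
        brk \<alpha> (lact f \<beta>) = lact (\<rho> \<alpha> f) \<beta> + ((-1) ^ (p * q)) *\<^sub>R lact f (brk \<alpha> \<beta>))"

end

theory Submission
  imports Defs
begin

text \<open>Functions and one-forms generate \<open>\<Omega>(A)\<close>, and the relations between these generators only express
  linearity over \<open>A\<close> and graded commutation. A family of operators indexed by generators and obeying
  these laws therefore extends to an action of \<open>\<Omega>(A)\<close>, and values on generators obeying a Leibniz rule
  extend to a derivation; two derivations that agree on generators are equal.

  Given a Lie superalgebroid, put \<open>[f, g] = 0\<close>, \<open>[\<alpha>, f] = \<rho>(\<alpha>)(f)\<close> and let \<open>[\<alpha>, \<beta>]\<close> be the given bracket.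
  For each generator \<open>x\<close> this extends to a derivation \<open>[x, _]\<close>, and then for each form \<open>X\<close> the values
  \<open>[X, y] = \<plusminus>[y, X]\<close> extend to a derivation \<open>[X, _]\<close>. The left Leibniz rule, antisymmetry and the Jacobi
  identity compare derivations and so reduce to generators. There the Jacobi identity says that the
  anchor preserves brackets, which follows from the identity in \<open>\<Omega>\<^sup>1(A)\<close> because \<open>\<Omega>\<^sup>1(A)\<close> is a faithful
  \<open>A\<close>-module unless \<open>A\<close> consists of scalars, in which case all derivations vanish.

  Conversely, \<open>\<Omega>(A)\<close> is \<open>A \<oplus> \<Omega>\<^sup>1(A)\<close> in degrees at most one, and the Gerstenhaber identities in these
  degrees are those of a Lie superalgebroid.\<close>

text \<open>Tensors and forms are functions, but only their vector space structure is to be used.\<close>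

declare plus_fun_apply [simp del] zero_fun_apply [simp del] minus_apply [simp del]
  uminus_apply [simp del] One_nat_def [simp del]

lemmas fun_apply = plus_fun_apply zero_fun_apply minus_apply uminus_apply scaleR_fun_def

lemma span_induct2 [consumes 2, case_names subspace_left subspace_right base]:
  assumes "x \<in> span B" "y \<in> span C"
    and "\<And>y. y \<in> C \<Longrightarrow> subspace {x. P x y}"
    and "\<And>x. x \<in> span B \<Longrightarrow> subspace {y. P x y}"
    and "\<And>x y. x \<in> B \<Longrightarrow> y \<in> C \<Longrightarrow> P x y"
  shows "P x y"
proof -
  have "P x y" if "y \<in> C" for y
    using span_induct[OF assms(1), of "\<lambda>x. P x y"] assms(3,5) that by blast
  then show ?thesis
    using span_induct[OF assms(2), of "P x"] assms(1,4) by blast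
qed

lemma subspace_linear_eq:
  assumes "linear f" "linear g"
  shows "subspace {x. f x = g x}"
  using assms by (simp add: subspace_def linear_add linear_scale linear_0)

lemma subspace_linear_mem:
  assumes "linear f" "subspace V"
  shows "subspace {x. f x \<in> V}"
  using linear_subspace_vimage[OF assms] by (simp add: vimage_def)

lemma span_UN_subspaces:
  fixes V :: "'i \<Rightarrow> 'v::real_vector set"
  assumes "x \<in> span (\<Union>i\<in>I. V i)" and V: "\<And>i. subspace (V i)"
  obtains c where "finite {i. c i \<noteq> 0}" "{i. c i \<noteq> 0} \<subseteq> I" "\<And>i. c i \<in> V i"
    "x = (\<Sum>i\<in>{i. c i \<noteq> 0}. c i)"
proof -
  have "\<exists>F c. finite F \<and> F \<subseteq> I \<and> (\<forall>i. c i \<in> V i) \<and> (\<forall>i. i \<notin> F \<longrightarrow> c i = 0) \<and> x = sum c F"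
    using assms(1)
  proof (induction rule: span_induct_alt)
    case base
    show ?case
      by (rule exI[of _ "{}"], rule exI[of _ "\<lambda>_. 0"]) (simp add: subspace_0 V)
  next
    case (step r u y)
    then obtain i F c where i: "i \<in> I" "u \<in> V i" and F: "finite F" "F \<subseteq> I" and
      c: "\<And>i. c i \<in> V i" "\<And>i. i \<notin> F \<Longrightarrow> c i = 0" "y = sum c F"
      by blast
    have "y = c i + sum c (F - {i})"
      using F(1) c sum.insert_remove[of F c i] by (cases "i \<in> F") (simp_all add: insert_absorb)
    moreover have "sum (c(i := r *\<^sub>R u + c i)) (F - {i}) = sum c (F - {i})"
      by (intro sum.cong) auto
    ultimately have "r *\<^sub>R u + y = sum (c(i := r *\<^sub>R u + c i)) (insert i F)"
      using F by (simp add: sum.insert_remove add.assoc)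
    then show ?case
      using i F c by (intro exI[of _ "insert i F"] exI[of _ "c(i := r *\<^sub>R u + c i)"])
        (auto simp: subspace_add subspace_scale V)
  qed
  then obtain F c where F: "finite F" "F \<subseteq> I" and
    c: "\<And>i. c i \<in> V i" "\<And>i. i \<notin> F \<Longrightarrow> c i = 0" "x = sum c F"
    by blast
  have supp: "{i. c i \<noteq> 0} \<subseteq> F"
    using c(2) by blast
  moreover have "sum c F = (\<Sum>i\<in>{i. c i \<noteq> 0}. c i)"
    using F(1) supp by (intro sum.mono_neutral_right) auto
  ultimately show ?thesis
    using that[of c] F c finite_subset by fastforce
qed

lemma linear_projection_exists:
  assumes "subspace V"
  obtains \<pi> where "linear \<pi>" "\<And>x. \<pi> x \<in> V" "\<And>x. x \<in> V \<Longrightarrow> \<pi> x = x"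
  using linear_exists_right_inverse_on[OF linear_ident assms] by fastforce

lemma linear_functional_separates_span:
  assumes "x \<notin> span B"
  obtains \<phi> :: "'v::real_vector \<Rightarrow> real"
  where "linear \<phi>" "\<phi> x \<noteq> 0" "\<And>b. b \<in> span B \<Longrightarrow> \<phi> b = 0"
proof -
  obtain \<pi> where \<pi>: "linear \<pi>" "\<And>y. \<pi> y \<in> span B" "\<And>b. b \<in> span B \<Longrightarrow> \<pi> b = b"
    using linear_projection_exists[OF subspace_span] by blast
  have "independent {x - \<pi> x}"
    using assms \<pi>(2)[of x] by (auto simp: dependent_single)
  then obtain \<psi> :: "'v \<Rightarrow> real" where "linear \<psi>" "\<psi> (x - \<pi> x) = 1"
    using linear_independent_extend[of "{x - \<pi> x}" "\<lambda>_. 1"] by auto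
  then show ?thesis
    using \<pi> by (intro that[of "\<lambda>y. \<psi> (y - \<pi> y)"])
      (auto simp: linear_0
        intro!: linear_compose[unfolded o_def, OF linear_compose_sub[OF linear_ident]])
qed

lemma less_two_iff: "n < 2 \<longleftrightarrow> n = 0 \<or> n = 1" for n :: nat
  by auto

lemma sgni_add: "sgni (a + b) = sgni a * sgni b"
  and sgni_diff: "sgni (a - b) = sgni a * sgni b"
  and sgni_minus [simp]: "sgni (- a) = sgni a"
  and sgni_0 [simp]: "sgni 0 = 1"
  and sgni_1 [simp]: "sgni 1 = -1"
  by (auto simp: sgni_def)

lemma sgni_mult_self [simp]: "sgni a * sgni a = 1" "sgni a * (sgni a * x) = x"
  by (auto simp: sgni_def)

lemma sgni_double [simp]: "sgni 2 = 1" "sgni (2 * a) = 1" "sgni (a * 2) = 1"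
  by (simp_all add: sgni_def)

lemma minus_one_power_eq_sgni: "(-1) ^ n = sgni (int n)"
  by (auto simp: sgni_def)

lemma sgni_cong: "even (a - b) \<Longrightarrow> sgni a = sgni b"
  by (auto simp: sgni_def)

definition tag :: "int \<Rightarrow> nat" where
  "tag p = nat (p mod 2)"

lemma tag_less_two [simp]: "tag p < 2"
  and tag_0 [simp]: "tag 0 = 0"
  and tag_1 [simp]: "tag 1 = 1"
  and tag_of_nat: "d < 2 \<Longrightarrow> tag (int d) = d"
  and int_tag: "int (tag p) = p mod 2"
  and tag_cong: "even (p - q) \<Longrightarrow> tag p = tag q"
  and tag_add: "(tag p + tag q) mod 2 = tag (p + q)"
  by (auto simp: tag_def mod2_eq_if less_two_iff)

lemma minus_one_power_tag: "(-1) ^ (tag p * tag q) = sgni (p * q)"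
  by (auto simp: tag_def sgni_def mod2_eq_if)

subsection \<open>Vector spaces with a parity\<close>

locale parity_decomposition =
  fixes V :: "nat \<Rightarrow> 'v::real_vector set" and U :: "'v set"
  assumes subspace_parity: "subspace (V p)"
    and parities_disjoint: "x \<in> V 0 \<Longrightarrow> x \<in> V 1 \<Longrightarrow> x = 0"
    and decomposition_exists: "x \<in> U \<Longrightarrow> \<exists>y\<in>V 0 \<inter> U. \<exists>z\<in>V 1 \<inter> U. x = y + z"
begin

definition component :: "nat \<Rightarrow> 'v \<Rightarrow> 'v" where
  "component p x = (THE y. y \<in> V p \<and> x - y \<in> V (1 - p))"

lemma component_eqI:
  assumes "p < 2" "y \<in> V p" "x - y \<in> V (1 - p)"
  shows "component p x = y"
  unfolding component_def
proof (rule the_equality)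
  fix z assume z: "z \<in> V p \<and> x - z \<in> V (1 - p)"
  have "y - z \<in> V p" "(x - z) - (x - y) \<in> V (1 - p)"
    using z assms subspace_diff[OF subspace_parity] by blast+
  then have "y - z \<in> V 0" "y - z \<in> V 1"
    using assms(1) by (auto simp: less_two_iff)
  then show "z = y"
    using parities_disjoint[of "y - z"] by simp
qed (use assms in auto)

lemma component_sum:
  assumes "y \<in> V 0" "z \<in> V 1"
  shows "component 0 (y + z) = y" "component 1 (y + z) = z"
  using assms by (auto intro!: component_eqI)

lemma component_homogeneous:
  assumes "p < 2" "q < 2" "x \<in> V p"
  shows "component q x = (if q = p then x else 0)"
  using assms component_sum[of x 0] component_sum[of 0 x] subspace_0[OF subspace_parity]
  by (auto simp: less_two_iff)

lemma component_decomposition: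
  assumes "x \<in> U"
  shows "component 0 x \<in> V 0 \<inter> U" "component 1 x \<in> V 1 \<inter> U"
    "component 0 x + component 1 x = x"
proof -
  obtain y z where "y \<in> V 0 \<inter> U" "z \<in> V 1 \<inter> U" "x = y + z"
    using decomposition_exists[OF assms] by blast
  then show "component 0 x \<in> V 0 \<inter> U" "component 1 x \<in> V 1 \<inter> U"
    "component 0 x + component 1 x = x"
    using component_sum[of y z] by auto
qed

lemma component_mem: "p < 2 \<Longrightarrow> x \<in> U \<Longrightarrow> component p x \<in> V p"
  using component_decomposition by (auto simp: less_two_iff)

lemma component_lincomb:
  assumes "p < 2" "x \<in> U" "y \<in> U"
  shows "component p (c *\<^sub>R x + y) = c *\<^sub>R component p x + component p y"
proof -
  note x = component_decomposition[OF assms(2)] and y = component_decomposition[OF assms(3)]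
  have "c *\<^sub>R component q x + component q y \<in> V q" if "q < 2" for q
    using component_mem[OF that] assms by (simp add: subspace_add subspace_scale subspace_parity)
  from component_sum[OF this[of 0] this[of 1]]
  have "component q ((c *\<^sub>R component 0 x + component 0 y) + (c *\<^sub>R component 1 x + component 1 y))
      = c *\<^sub>R component q x + component q y" if "q < 2" for q
    using that by (auto simp: less_two_iff)
  moreover have "(c *\<^sub>R component 0 x + component 0 y) + (c *\<^sub>R component 1 x + component 1 y)
      = c *\<^sub>R (component 0 x + component 1 x) + (component 0 y + component 1 y)"
    by (simp add: algebra_simps)
  ultimately show ?thesis
    using assms(1) x(3) y(3) by simp
qed

lemma parity_induct [consumes 1, case_names add homogeneous]:
  assumes "x \<in> U"
    and "\<And>y z. y \<in> U \<Longrightarrow> z \<in> U \<Longrightarrow> P y \<Longrightarrow> P z \<Longrightarrow> P (y + z)"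
    and "\<And>p y. p < 2 \<Longrightarrow> y \<in> V p \<Longrightarrow> y \<in> U \<Longrightarrow> P y"
  shows "P x"
proof -
  have "P (component 0 x)" "P (component 1 x)"
    using component_decomposition[OF assms(1)] assms(3)[of 0] assms(3)[of 1] by auto
  from assms(2)[OF _ _ this] show ?thesis
    using component_decomposition[OF assms(1)] by simp
qed

end

subsection \<open>Tensors and one-forms\<close>

lemma tensor_add_left: "tensor (a + b) c = tensor a c + tensor b c"
  and tensor_add_right: "tensor c (a + b) = tensor c a + tensor c b"
  and tensor_scaleR_left: "tensor (r *\<^sub>R a) c = r *\<^sub>R tensor a c"
  by (auto simp: tensor_def fun_eq_iff fun_apply linear_add linear_scale algebra_simps)

lemma linear_functional_mult_left: "linear \<phi> \<Longrightarrow> linear (\<lambda>x. \<phi> (f * x))"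
  for f :: "'a::real_algebra_1" and \<phi> :: "'a \<Rightarrow> real"
  by (simp add: linear_iff algebra_simps)

lemma lact_tensor [simp]: "lact f (tensor a b) = tensor (f * a) b"
  by (auto simp: lact_def tensor_def fun_eq_iff linear_functional_mult_left)

lemma linear_lact: "linear (lact f)"
  by (auto simp: linear_iff lact_def fun_eq_iff fun_apply)

lemmas lact_linear [simp] = linear_add[OF linear_lact] linear_diff[OF linear_lact]
  linear_scale[OF linear_lact] linear_neg[OF linear_lact] linear_0[OF linear_lact]

lemma lact_mult: "lact (f * g) t = lact f (lact g t)"
  by (auto simp: lact_def fun_eq_iff linear_functional_mult_left mult.assoc)

lemma lact_AtA:
  assumes "t \<in> AtA"
  shows lact_add_left: "lact (f + g) t = lact f t + lact g t"
    and lact_scaleR_left: "lact (c *\<^sub>R f) t = c *\<^sub>R lact f t"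
    and lact_one: "lact 1 t = t"
  using assms unfolding AtA_def atomize_conj
  by (induction rule: span_induct_alt)
    (auto simp: tensor_add_left tensor_scaleR_left algebra_simps)

lemma lact_diff_left: "t \<in> AtA \<Longrightarrow> lact (f - g) t = lact f t - lact g t"
  using lact_add_left[of t "f - g" g] by simp

definition tensor_sum :: "('a::real_algebra_1 \<times> 'a) list \<Rightarrow> 'a tens" where
  "tensor_sum xs = sum_list (map (case_prod tensor) xs)"

definition product_sum :: "('a::real_algebra_1 \<times> 'a) list \<Rightarrow> 'a" where
  "product_sum xs = sum_list (map (\<lambda>(a, b). a * b) xs)"

lemma tensor_sum_simps [simp]:
  "tensor_sum [] = 0" "tensor_sum ((a, b) # xs) = tensor a b + tensor_sum xs"
  "tensor_sum (xs @ ys) = tensor_sum xs + tensor_sum ys"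
  by (simp_all add: tensor_sum_def)

lemma product_sum_simps [simp]:
  "product_sum [] = 0" "product_sum ((a, b) # xs) = a * b + product_sum xs"
  "product_sum (xs @ ys) = product_sum xs + product_sum ys"
  by (simp_all add: product_sum_def)

lemma tensor_sum_map_mult: "tensor_sum (map (map_prod ((*) f) id) xs) = lact f (tensor_sum xs)"
  and product_sum_map_mult: "product_sum (map (map_prod ((*) f) id) xs) = f * product_sum xs"
  by (induction xs) (auto simp: algebra_simps)

lemma Omega1_iff: "t \<in> Omega1 \<longleftrightarrow> (\<exists>xs. t = tensor_sum xs \<and> product_sum xs = 0)"
  by (simp add: Omega1_def tensor_sum_def product_sum_def)

lemma tensor_sum_AtA: "tensor_sum xs \<in> AtA"
proof (induction xs)
  case (Cons x xs)
  have "case_prod tensor x \<in> AtA"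
    unfolding AtA_def by (rule span_base) simp
  then show ?case
    using Cons by (cases x) (simp add: AtA_def span_add)
qed (simp add: AtA_def span_zero)

lemma Omega1_AtA: "t \<in> Omega1 \<Longrightarrow> t \<in> AtA"
  using tensor_sum_AtA by (auto simp: Omega1_iff)

lemma lact_Omega1: "t \<in> Omega1 \<Longrightarrow> lact f t \<in> Omega1"
  unfolding Omega1_iff by (metis tensor_sum_map_mult product_sum_map_mult mult_zero_right)

lemma subspace_Omega1: "subspace Omega1"
proof (rule subspaceI)
  show "0 \<in> Omega1"
    unfolding Omega1_iff by (intro exI[of _ "[]"]) simp
  show "s + t \<in> Omega1" if "s \<in> Omega1" "t \<in> Omega1" for s t :: "'a tens"
  proof -
    from that obtain xs ys where
      "s = tensor_sum xs" "product_sum xs = 0" "t = tensor_sum ys" "product_sum ys = 0"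
      unfolding Omega1_iff by blast
    then show ?thesis
      unfolding Omega1_iff by (intro exI[of _ "xs @ ys"]) simp
  qed
  show "c *\<^sub>R t \<in> Omega1" if "t \<in> Omega1" for c and t :: "'a tens"
    using lact_Omega1[OF that, of "c *\<^sub>R 1"] Omega1_AtA[OF that]
    by (simp add: lact_scaleR_left lact_one)
qed

lemmas Omega1_add = subspace_add[OF subspace_Omega1]
  and Omega1_scaleR = subspace_scale[OF subspace_Omega1]
  and Omega1_0 [simp] = subspace_0[OF subspace_Omega1]

lemma dA_Omega1: "dA a \<in> Omega1"
  unfolding Omega1_iff dA_def using tensor_scaleR_left[of "-1" 1 a]
  by (intro exI[of _ "[(a, 1), (-1, a)]"]) simp

lemma lact_eq_0_Omega1:
  fixes x b :: "'a::real_algebra_1"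
  assumes annihilates: "\<And>\<alpha>. \<alpha> \<in> Omega1 \<Longrightarrow> lact x \<alpha> = 0" and b: "b \<notin> span {1}"
  shows "x = 0"
proof (rule ccontr)
  assume "x \<noteq> 0"
  then obtain \<phi> :: "'a \<Rightarrow> real" where \<phi>: "linear \<phi>" "\<phi> x \<noteq> 0"
    using linear_functional_separates_span[of x "{}"] by auto
  obtain \<psi> :: "'a \<Rightarrow> real" where \<psi>: "linear \<psi>" "\<psi> b \<noteq> 0" "\<psi> 1 = 0"
    using linear_functional_separates_span[OF b] by (metis insertI1 span_base)
  have "(tensor (x * b) 1 - tensor x b) (\<phi>, \<psi>) = lact x (dA b) (\<phi>, \<psi>)"
    by (simp add: dA_def)
  also have "\<dots> = 0"
    using annihilates[OF dA_Omega1] by (simp add: fun_apply)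
  finally show False
    using \<phi> \<psi> by (simp add: tensor_def fun_apply)
qed

subsection \<open>Parity of functions and of one-forms\<close>

locale supercommutative_algebra =
  fixes G :: "int \<Rightarrow> 'a::real_algebra_1 set"
  assumes graded: "graded_supercomm_algebra G"
begin

lemma subspace_G: "subspace (G n)"
  and grading_unique:
    "\<exists>!c. finite {n. c n \<noteq> 0} \<and> (\<forall>n. c n \<in> G n) \<and> a = (\<Sum>n\<in>{n. c n \<noteq> 0}. c n)"
  and one_G: "1 \<in> G 0"
  and G_mult: "a \<in> G m \<Longrightarrow> b \<in> G n \<Longrightarrow> a * b \<in> G (m + n)"
  using graded unfolding graded_supercomm_algebra_def by blast+

lemma G_commute:
  assumes "a \<in> G m" "b \<in> G n"
  shows "a * b = sgni (m * n) *\<^sub>R (b * a)"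
proof -
  have "a * b = (if even (m * n) then b * a else - (b * a))"
    using graded assms unfolding graded_supercomm_algebra_def by blast
  then show ?thesis
    by (simp add: sgni_def)
qed

text \<open>Parities are taken in the integers from here on, so that the parity of a product is a sum.\<close>

definition hfun :: "int \<Rightarrow> 'a set" where
  "hfun p = Apar G (tag p)"

definition htens :: "int \<Rightarrow> 'a tens set" where
  "htens p = Tpar G (tag p)"

definition hform1 :: "int \<Rightarrow> 'a tens set" where
  "hform1 p = O1par G (tag p)"

lemma hfun_cong: "even (p - q) \<Longrightarrow> hfun p = hfun q"
  and htens_cong: "even (p - q) \<Longrightarrow> htens p = htens q"
  and hform1_cong: "even (p - q) \<Longrightarrow> hform1 p = hform1 q"
  using tag_cong[of p q] by (simp_all add: hfun_def htens_def hform1_def)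

lemma hfun_of_nat: "p < 2 \<Longrightarrow> hfun (int p) = Apar G p"
  and htens_of_nat: "p < 2 \<Longrightarrow> htens (int p) = Tpar G p"
  and hform1_of_nat: "p < 2 \<Longrightarrow> hform1 (int p) = O1par G p"
  by (simp_all add: hfun_def htens_def hform1_def tag_of_nat)

lemma hform1_iff: "\<alpha> \<in> hform1 p \<longleftrightarrow> \<alpha> \<in> Omega1 \<and> \<alpha> \<in> htens p"
  by (simp add: hform1_def htens_def O1par_def)

lemma hform1_Omega1: "\<alpha> \<in> hform1 p \<Longrightarrow> \<alpha> \<in> Omega1"
  by (simp add: hform1_iff)

lemma hfun_eq_span: "hfun p = span (\<Union>n\<in>{n. even (n - p)}. G n)"
proof -
  have "{n. n mod 2 = int (tag p)} = {n. even (n - p)}"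
    by (auto simp: int_tag mod2_eq_if)
  then show ?thesis
    by (simp add: hfun_def Apar_def)
qed

lemma subspace_hfun: "subspace (hfun p)"
  and subspace_htens: "subspace (htens p)"
  and subspace_hform1: "subspace (hform1 p)"
  by (simp_all add: hfun_def htens_def hform1_def Apar_def Tpar_def O1par_def subspace_inter
    subspace_Omega1)

lemmas hfun_add = subspace_add[OF subspace_hfun] and hfun_scaleR = subspace_scale[OF subspace_hfun]
  and hfun_0 [simp] = subspace_0[OF subspace_hfun]
lemmas hform1_scaleR = subspace_scale[OF subspace_hform1]
  and hform1_0 [simp] = subspace_0[OF subspace_hform1]

lemma one_hfun [simp]: "1 \<in> hfun 0"
  unfolding hfun_eq_span by (rule span_base) (use one_G in auto)

lemma one_Apar [simp]: "1 \<in> Apar G 0"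
  using one_hfun by (simp add: hfun_def)

lemma hfun_mult:
  assumes "f \<in> hfun p" "g \<in> hfun q"
  shows "f * g \<in> hfun (p + q)"
  using assms[unfolded hfun_eq_span]
proof (induction rule: span_induct2)
  case (base f g)
  then obtain m n where "f \<in> G m" "even (m - p)" "g \<in> G n" "even (n - q)"
    by blast
  then have "f * g \<in> G (m + n)" "even (m + n - (p + q))"
    using G_mult by auto
  then show ?case
    unfolding hfun_eq_span by (blast intro: span_base)
qed (auto intro!: subspace_linear_mem subspace_hfun linearI simp: algebra_simps)

lemma hfun_commute:
  assumes "f \<in> hfun p" "g \<in> hfun q"
  shows "f * g = sgni (p * q) *\<^sub>R (g * f)"
  using assms[unfolded hfun_eq_span]
proof (induction rule: span_induct2)
  case (base f g)
  then obtain m n where "f \<in> G m" "g \<in> G n" and parity: "even (m - p)" "even (n - q)"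
    by blast
  then have "f * g = sgni (m * n) *\<^sub>R (g * f)"
    by (intro G_commute)
  also have "sgni (m * n) = sgni (p * q)"
    using parity by (auto simp: sgni_def)
  finally show ?case .
qed (intro subspace_linear_eq linearI; simp add: algebra_simps)+

lemma parity_decomposition_Apar: "parity_decomposition (Apar G) UNIV"
proof
  show "subspace (Apar G p)" for p
    by (simp add: Apar_def)
  show "a = 0" if even: "a \<in> Apar G 0" and odd: "a \<in> Apar G 1" for a
  proof -
    obtain c where c: "finite {n. c n \<noteq> 0}" "{n. c n \<noteq> 0} \<subseteq> {n. n mod 2 = 0}" "\<And>n. c n \<in> G n"
      "a = (\<Sum>n\<in>{n. c n \<noteq> 0}. c n)"
      using span_UN_subspaces[OF even[unfolded Apar_def] subspace_G] by auto
    obtain d where d: "finite {n. d n \<noteq> 0}" "{n. d n \<noteq> 0} \<subseteq> {n. n mod 2 = 1}" "\<And>n. d n \<in> G n"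
      "a = (\<Sum>n\<in>{n. d n \<noteq> 0}. d n)"
      using span_UN_subspaces[OF odd[unfolded Apar_def] subspace_G] by auto
    have "c = d"
      using grading_unique[of a] c d by blast
    then have "{n. c n \<noteq> 0} = {}"
      using c(2) d(2) by fastforce
    then show ?thesis
      using c(4) by simp
  qed
  show "\<exists>b\<in>Apar G 0 \<inter> UNIV. \<exists>c\<in>Apar G 1 \<inter> UNIV. a = b + c" for a
  proof -
    obtain c where c: "finite {n. c n \<noteq> 0}" "\<And>n. c n \<in> G n" "a = (\<Sum>n\<in>{n. c n \<noteq> 0}. c n)"
      using grading_unique[of a] by blast
    let ?N = "\<lambda>p. {n. c n \<noteq> 0 \<and> n mod 2 = int p}"
    have part: "sum c (?N p) \<in> Apar G p" for p
      unfolding Apar_def by (rule span_sum, rule span_base) (use c(2) in auto)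
    have "a = sum c (?N 0 \<union> ?N 1)"
      unfolding c(3) by (rule arg_cong[of _ _ "sum c"]) auto
    also have "\<dots> = sum c (?N 0) + sum c (?N 1)"
      by (rule sum.union_disjoint) (use c(1) in auto)
    finally show ?thesis
      using part[of 0] part[of 1] by blast
  qed
qed

sublocale fun_parity: parity_decomposition "Apar G" UNIV
  rewrites "parity_decomposition.component (Apar G) = acomp G"
  using parity_decomposition_Apar
  by (auto simp: fun_eq_iff acomp_def parity_decomposition.component_def)

lemma acomp_hfun: "p < 2 \<Longrightarrow> acomp G p f \<in> hfun (int p)"
  by (simp add: fun_parity.component_mem hfun_of_nat)

lemma acomp_of_hfun: "f \<in> hfun p \<Longrightarrow> q < 2 \<Longrightarrow> acomp G q f = (if q = tag p then f else 0)"
  by (simp add: fun_parity.component_homogeneous[of "tag p"] hfun_def)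

lemma acomp_add: "acomp G 0 f + acomp G 1 f = f"
  using fun_parity.component_decomposition by simp

lemma linear_acomp: "p < 2 \<Longrightarrow> linear (acomp G p)"
  using fun_parity.component_lincomb[of p _ _ 1] fun_parity.component_lincomb[of p _ 0]
    acomp_of_hfun[of 0 0 p]
  by (intro linearI) simp_all

lemma fun_induct [case_names add homogeneous]:
  assumes "\<And>f g. P f \<Longrightarrow> P g \<Longrightarrow> P (f + g)" "\<And>p f. f \<in> hfun p \<Longrightarrow> P f"
  shows "P f"
  by (rule fun_parity.parity_induct[OF UNIV_I]) (use assms hfun_of_nat in blast)+

lemma Apar_subset_hfun: "Apar G p \<subseteq> hfun (int p)"
proof (cases "p < 2")
  case False
  then have "{n. n mod 2 = int p} = {}"
    by (auto simp: mod2_eq_if)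
  then show ?thesis
    by (simp add: Apar_def)
qed (simp add: hfun_of_nat)

lemma htens_eq_span: "htens p = span {tensor a b | a b q r. a \<in> hfun q \<and> b \<in> hfun r \<and>
    even (q + r - p)}"
  (is "_ = span ?X")
proof -
  have "{tensor a b | a b q r. a \<in> Apar G q \<and> b \<in> Apar G r \<and> (q + r) mod 2 = tag p} = ?X"
    (is "?Y = _")
  proof
    show "?Y \<subseteq> ?X"
    proof clarify
      fix a b q r assume "a \<in> Apar G q" "b \<in> Apar G r" "(q + r) mod 2 = tag p"
      moreover from this(3) have "even (int q + int r - p)"
        by (auto simp: tag_def mod2_eq_if split: if_splits)
      ultimately show "\<exists>a' b' q r. tensor a b = tensor a' b' \<and> a' \<in> hfun q \<and> b' \<in> hfun r \<and>
          even (q + r - p)"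
        using Apar_subset_hfun by blast
    qed
    show "?X \<subseteq> ?Y"
    proof clarify
      fix a b q r assume "a \<in> hfun q" "b \<in> hfun r" "even (q + r - p)"
      moreover from this(3) have "(tag q + tag r) mod 2 = tag p"
        by (auto simp: tag_def mod2_eq_if)
      ultimately show "\<exists>a' b' q r. tensor a b = tensor a' b' \<and> a' \<in> Apar G q \<and> b' \<in> Apar G r \<and>
          (q + r) mod 2 = tag p"
        unfolding hfun_def by blast
    qed
  qed
  then show ?thesis
    by (simp add: htens_def Tpar_def)
qed

lemma tensor_htens: "a \<in> hfun p \<Longrightarrow> b \<in> hfun q \<Longrightarrow> tensor a b \<in> htens (p + q)"
  unfolding htens_eq_span by (rule span_base) force

definition parity_involution :: "'a \<Rightarrow> 'a" where
  "parity_involution a = acomp G 0 a - acomp G 1 a"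

lemma linear_parity_involution: "linear parity_involution"
  unfolding parity_involution_def by (intro linear_compose_sub linear_acomp) auto

lemma parity_involution_hfun:
  assumes "a \<in> hfun p"
  shows "parity_involution a = sgni p *\<^sub>R a"
  using assms by (cases "even p")
    (auto simp: parity_involution_def acomp_of_hfun tag_def sgni_def mod2_eq_if)

text \<open>The parity involution acts as \<open>(-1)\<^sup>p\<close> on tensors of parity \<open>p\<close>, so that even and odd tensors meet
  in zero only.\<close>

lemma htens_parity_involution:
  assumes "t \<in> htens p" "linear \<phi>" "linear \<psi>"
  shows "t (\<phi> \<circ> parity_involution, \<psi> \<circ> parity_involution) = sgni p * t (\<phi>, \<psi>)"
  using assms(1) unfolding htens_eq_span
proof (induction rule: span_induct_alt)
  case (step c t s)
  then obtain a b q r where t: "t = tensor a b" "a \<in> hfun q" "b \<in> hfun r" "even (q + r - p)"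
    by blast
  have "linear (\<phi> \<circ> parity_involution)" "linear (\<psi> \<circ> parity_involution)"
    using assms linear_parity_involution linear_compose by blast+
  moreover have "sgni q * sgni r = sgni p"
    using sgni_cong[OF t(4)] by (simp add: sgni_add)
  ultimately have "t (\<phi> \<circ> parity_involution, \<psi> \<circ> parity_involution) = sgni p * t (\<phi>, \<psi>)"
    using t assms by (simp add: tensor_def parity_involution_hfun linear_scale)
  then show ?case
    using step by (simp add: fun_apply algebra_simps del: o_apply)
qed (simp add: fun_apply)

lemma htens_nonlinear:
  assumes "t \<in> htens p" "\<not> (linear \<phi> \<and> linear \<psi>)"
  shows "t (\<phi>, \<psi>) = 0"
  using assms(1) unfolding htens_eq_span
  by (induction rule: span_induct_alt) (use assms(2) in \<open>auto simp: fun_apply tensor_def\<close>)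

lemma htens_disjoint:
  assumes "t \<in> htens 0" "t \<in> htens 1"
  shows "t = 0"
proof (rule ext, clarify)
  fix \<phi> \<psi> :: "'a \<Rightarrow> real"
  show "t (\<phi>, \<psi>) = 0 (\<phi>, \<psi>)"
  proof (cases "linear \<phi> \<and> linear \<psi>")
    case True
    then show ?thesis
      using htens_parity_involution[OF assms(1), of \<phi> \<psi>] htens_parity_involution[OF assms(2), of \<phi> \<psi>]
      by (simp add: fun_apply)
  qed (simp add: htens_nonlinear[OF assms(1)] fun_apply)
qed

definition homogeneous_terms :: "int \<Rightarrow> ('a \<times> 'a) list \<Rightarrow> bool" where
  "homogeneous_terms p xs \<longleftrightarrow>
    (\<forall>(a, b)\<in>set xs. \<exists>q r. a \<in> hfun q \<and> b \<in> hfun r \<and> even (q + r - p))"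

lemma homogeneous_terms_sums:
  assumes "homogeneous_terms p xs"
  shows "tensor_sum xs \<in> htens p \<and> product_sum xs \<in> hfun p"
  using assms
proof (induction xs)
  case Nil
  show ?case
    by (simp add: subspace_0 subspace_htens)
next
  case (Cons x xs)
  obtain a b where x: "x = (a, b)"
    by force
  obtain q r where ab: "a \<in> hfun q" "b \<in> hfun r" and qr: "even (q + r - p)"
    using Cons.prems by (auto simp: x homogeneous_terms_def)
  have "tensor a b \<in> htens p" "a * b \<in> hfun p"
    using tensor_htens[OF ab] hfun_mult[OF ab] htens_cong[OF qr] hfun_cong[OF qr] by simp_all
  then show ?case
    using Cons by (auto simp: x homogeneous_terms_def subspace_add subspace_htens hfun_add)
qed

lemma tensor_sum_parity_split:
  obtains ys zs where "homogeneous_terms 0 ys" "homogeneous_terms 1 zs"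
    "tensor_sum xs = tensor_sum ys + tensor_sum zs"
    "product_sum xs = product_sum ys + product_sum zs"
proof -
  have "\<exists>ys zs. homogeneous_terms 0 ys \<and> homogeneous_terms 1 zs \<and>
    tensor_sum xs = tensor_sum ys + tensor_sum zs \<and> product_sum xs = product_sum ys + product_sum zs"
  proof (induction xs)
    case Nil
    show ?case
      by (rule exI[of _ "[]"])+ (simp add: homogeneous_terms_def)
  next
    case (Cons x xs)
    then obtain ys zs where IH: "homogeneous_terms 0 ys" "homogeneous_terms 1 zs"
      "tensor_sum xs = tensor_sum ys + tensor_sum zs"
      "product_sum xs = product_sum ys + product_sum zs"
      by blast
    obtain a b where x: "x = (a, b)"
      by force
    let ?ys = "(acomp G 0 a, acomp G 0 b) # (acomp G 1 a, acomp G 1 b) # ys"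
    let ?zs = "(acomp G 0 a, acomp G 1 b) # (acomp G 1 a, acomp G 0 b) # zs"
    have comp: "acomp G 0 c \<in> hfun 0" "acomp G 1 c \<in> hfun 1" for c
      using acomp_hfun[of 0 c] acomp_hfun[of 1 c] by simp_all
    have "homogeneous_terms 0 ?ys"
      using IH(1) comp[of a] comp[of b] unfolding homogeneous_terms_def by force
    moreover have "homogeneous_terms 1 ?zs"
      using IH(2) comp[of a] comp[of b] unfolding homogeneous_terms_def by force
    moreover have "tensor a b = tensor (acomp G 0 a + acomp G 1 a) (acomp G 0 b + acomp G 1 b)"
      "a * b = (acomp G 0 a + acomp G 1 a) * (acomp G 0 b + acomp G 1 b)"
      by (simp_all add: acomp_add)
    then have "tensor_sum (x # xs) = tensor_sum ?ys + tensor_sum ?zs"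
      "product_sum (x # xs) = product_sum ?ys + product_sum ?zs"
      using IH(3,4) by (simp_all add: x tensor_add_left tensor_add_right distrib_left distrib_right)
    ultimately show ?case
      by blast
  qed
  then show ?thesis
    using that by blast
qed

lemma parity_decomposition_Tpar: "parity_decomposition (Tpar G) Omega1"
proof
  show "subspace (Tpar G p)" for p
    by (simp add: Tpar_def)
  show "t = 0" if "t \<in> Tpar G 0" "t \<in> Tpar G 1" for t
    using htens_disjoint[of t] htens_of_nat[of 0] htens_of_nat[of 1] that by simp
  fix t :: "'a tens" assume "t \<in> Omega1"
  then obtain xs where xs: "t = tensor_sum xs" "product_sum xs = 0"
    unfolding Omega1_iff by blast
  obtain ys zs where terms: "homogeneous_terms 0 ys" "homogeneous_terms 1 zs"
    and sums: "tensor_sum xs = tensor_sum ys + tensor_sum zs"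
      "product_sum xs = product_sum ys + product_sum zs"
    by (rule tensor_sum_parity_split)
  note ys = homogeneous_terms_sums[OF terms(1)] and zs = homogeneous_terms_sums[OF terms(2)]
  have opposite: "product_sum ys = - product_sum zs"
    using sums(2) xs(2) by (simp add: eq_neg_iff_add_eq_0)
  then have "product_sum ys \<in> hfun 1"
    using zs subspace_neg[OF subspace_hfun] by simp
  then have "product_sum ys = 0"
    using ys fun_parity.parities_disjoint hfun_of_nat[of 0] hfun_of_nat[of 1] by simp
  moreover from this have "product_sum zs = 0"
    using opposite by simp
  ultimately have "tensor_sum ys \<in> Omega1" "tensor_sum zs \<in> Omega1"
    unfolding Omega1_iff by blast+
  moreover have "tensor_sum ys \<in> Tpar G 0" "tensor_sum zs \<in> Tpar G 1"
    using ys zs htens_of_nat[of 0] htens_of_nat[of 1] by simp_all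
  ultimately show "\<exists>s0\<in>Tpar G 0 \<inter> Omega1. \<exists>s1\<in>Tpar G 1 \<inter> Omega1. t = s0 + s1"
    using sums(1) xs(1) by blast
qed

sublocale form_parity: parity_decomposition "Tpar G" Omega1
  rewrites "parity_decomposition.component (Tpar G) = tcomp G"
  using parity_decomposition_Tpar
  by (auto simp: fun_eq_iff tcomp_def parity_decomposition.component_def)

lemma tcomp_hform1: "p < 2 \<Longrightarrow> \<alpha> \<in> Omega1 \<Longrightarrow> tcomp G p \<alpha> \<in> hform1 (int p)"
  using form_parity.component_decomposition[of \<alpha>] by (auto simp: less_two_iff hform1_def O1par_def)

lemma tcomp_of_hform1: "\<alpha> \<in> hform1 p \<Longrightarrow> q < 2 \<Longrightarrow> tcomp G q \<alpha> = (if q = tag p then \<alpha> else 0)"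
  by (simp add: form_parity.component_homogeneous[of "tag p"] hform1_def O1par_def)

lemma tcomp_add: "\<alpha> \<in> Omega1 \<Longrightarrow> tcomp G 0 \<alpha> + tcomp G 1 \<alpha> = \<alpha>"
  by (rule form_parity.component_decomposition)

lemma form1_induct [consumes 1, case_names add homogeneous]:
  assumes "\<alpha> \<in> Omega1"
    and "\<And>\<alpha> \<beta>. \<alpha> \<in> Omega1 \<Longrightarrow> \<beta> \<in> Omega1 \<Longrightarrow> P \<alpha> \<Longrightarrow> P \<beta> \<Longrightarrow> P (\<alpha> + \<beta>)"
    and "\<And>p \<alpha>. \<alpha> \<in> hform1 p \<Longrightarrow> P \<alpha>"
  shows "P \<alpha>"
  using assms(1)
proof (rule form_parity.parity_induct)
  fix p \<alpha> assume "p < 2" "\<alpha> \<in> Tpar G p" "\<alpha> \<in> Omega1"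
  then have "\<alpha> \<in> hform1 (int p)"
    by (simp add: hform1_of_nat O1par_def)
  then show "P \<alpha>"
    by (rule assms(3))
qed (rule assms(2))

lemma lact_hform1:
  assumes "f \<in> hfun p" "\<alpha> \<in> hform1 q"
  shows "lact f \<alpha> \<in> hform1 (p + q)"
proof -
  have "lact f t \<in> htens (p + q)" if "t \<in> htens q" for t
    using that unfolding htens_eq_span[of q]
  proof (induction rule: span_induct_alt)
    case (step c t s)
    then obtain a b r r' where t: "t = tensor a b" "a \<in> hfun r" "b \<in> hfun r'" "even (r + r' - q)"
      by blast
    have "tensor (f * a) b \<in> htens (p + r + r')"
      by (intro tensor_htens hfun_mult assms(1) t)
    also have "htens (p + r + r') = htens (p + q)"
      using t(4) by (intro htens_cong) (simp add: algebra_simps)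
    finally show ?case
      using step by (simp add: t(1) subspace_add subspace_scale subspace_htens)
  qed (simp add: subspace_0 subspace_htens)
  then show ?thesis
    using assms(2) by (simp add: hform1_iff lact_Omega1)
qed

end

subsection \<open>Formal combinations of words\<close>

lemma inj_wd: "inj wd"
  by (rule injI) (auto simp: wd_def fun_eq_iff split: if_splits)

lemma independent_wd: "independent (range (wd :: 'a word \<Rightarrow> 'a form))"
proof
  assume "dependent (range (wd :: 'a word \<Rightarrow> 'a form))"
  then obtain S and u :: "'a form \<Rightarrow> real" and w :: "'a word" where
    S: "finite S" "S \<subseteq> range wd" "wd w \<in> S" "u (wd w) \<noteq> 0" "(\<Sum>v\<in>S. u v *\<^sub>R v) = 0"
    unfolding dependent_explicit by blast
  have "(\<Sum>v\<in>S. u v *\<^sub>R v) w = (\<Sum>v\<in>S. u v * v w)"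
    using S(1) by (induction S) (auto simp: fun_apply)
  also have "\<dots> = (\<Sum>v\<in>S. if v = wd w then u (wd w) else 0)"
    by (rule sum.cong) (use S(2) in \<open>auto simp: wd_def split: if_splits\<close>)
  also have "\<dots> = u (wd w)"
    using S by simp
  finally show False
    using S by (simp add: fun_apply)
qed

definition linext :: "('a word \<Rightarrow> 'v::real_vector) \<Rightarrow> 'a form \<Rightarrow> 'v" where
  "linext F = construct (range wd) (F \<circ> inv wd)"

lemma linear_linext: "linear (linext F)"
  unfolding linext_def by (rule linear_construct[OF independent_wd])

lemma linext_wd [simp]: "linext F (wd w) = F w"
  by (simp add: linext_def construct_basis[OF independent_wd] inv_f_f[OF inj_wd])

lemmas linext_simps [simp] = linear_add[OF linear_linext] linear_diff[OF linear_linext]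
  linear_scale[OF linear_linext] linear_neg[OF linear_linext] linear_0[OF linear_linext]

lemma linext_add_fun: "linext (\<lambda>u. F u + G u) x = linext F x + linext G x"
  and linext_scaleR_fun: "linext (\<lambda>u. c *\<^sub>R F u) x = c *\<^sub>R linext F x"
  by (simp_all add: linext_def o_def construct_add construct_scale independent_wd)

lemma span_wd_support:
  assumes "x \<in> span (wd ` W)"
  shows "finite {u. x u \<noteq> 0}" "{u. x u \<noteq> 0} \<subseteq> W"
proof -
  have "finite {u. x u \<noteq> 0} \<and> {u. x u \<noteq> 0} \<subseteq> W"
    using assms
  proof (induction rule: span_induct_alt)
    case (step c b x)
    then obtain w where "w \<in> W" "b = wd w"
      by blast
    then have "{u. (c *\<^sub>R b + x) u \<noteq> 0} \<subseteq> insert w {u. x u \<noteq> 0}"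
      by (auto simp: fun_apply wd_def)
    then show ?case
      using step \<open>w \<in> W\<close> by (auto intro: finite_subset)
  qed (simp add: fun_apply)
  then show "finite {u. x u \<noteq> 0}" "{u. x u \<noteq> 0} \<subseteq> W"
    by auto
qed

lemma form_eq_sum_wd:
  assumes "finite {u. x u \<noteq> 0}"
  shows "x = (\<Sum>u\<in>{u. x u \<noteq> 0}. x u *\<^sub>R wd u)"
proof
  fix w
  have "(\<Sum>u\<in>S. x u *\<^sub>R wd u) w = (\<Sum>u\<in>S. if u = w then x w else 0)" if "finite S" for S
    using that by (induction S) (auto simp: fun_apply wd_def)
  then show "x w = (\<Sum>u\<in>{u. x u \<noteq> 0}. x u *\<^sub>R wd u) w"
    using assms by simp
qed

lemma linext_eq_sum:
  assumes "finite {u. x u \<noteq> 0}"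
  shows "linext F x = (\<Sum>u\<in>{u. x u \<noteq> 0}. x u *\<^sub>R F u)"
  by (subst form_eq_sum_wd[OF assms]) (simp add: linear_sum[OF linear_linext])

definition form_mult :: "'a::real_algebra_1 form \<Rightarrow> 'a form \<Rightarrow> 'a form" where
  "form_mult x y = linext (\<lambda>u. linext (wmul u) y) x"

lemma form_mult_wd [simp]: "form_mult (wd u) (wd w) = wmul u w"
  and form_mult_wd_left: "form_mult (wd u) y = linext (wmul u) y"
  and form_mult_wd_right: "form_mult x (wd w) = linext (\<lambda>u. wmul u w) x"
  by (simp_all add: form_mult_def)

lemma linear_form_mult_left: "linear (\<lambda>x. form_mult x y)"
  unfolding form_mult_def by (rule linear_linext)

lemma linear_form_mult_right: "linear (form_mult x)"
  unfolding form_mult_def by (rule linearI) (simp_all add: linext_add_fun linext_scaleR_fun)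

lemma wedge_eq_form_mult:
  assumes "x \<in> Om G" "y \<in> Om G"
  shows "wedge x y = form_mult x y"
  using span_wd_support(1)[OF assms(1)[unfolded Om_def]]
    span_wd_support(1)[OF assms(2)[unfolded Om_def]]
  by (simp add: wedge_def form_mult_def linext_eq_sum scaleR_sum_right)

subsection \<open>The relations as a two-sided ideal\<close>

abbreviation tag_sum :: "(nat \<times> 'a tens) list \<Rightarrow> nat" where
  "tag_sum as \<equiv> sum_list (map fst as)"

definition valid_factors :: "(int \<Rightarrow> 'a::real_algebra_1 set) \<Rightarrow> (nat \<times> 'a tens) list \<Rightarrow> bool" where
  "valid_factors G as \<longleftrightarrow> (\<forall>(q, \<alpha>)\<in>set as. q < 2 \<and> \<alpha> \<in> O1par G q)"

lemma valid_factors_simps [simp]: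
  "valid_factors G []"
  "valid_factors G ((q, \<alpha>) # as) \<longleftrightarrow> q < 2 \<and> \<alpha> \<in> O1par G q \<and> valid_factors G as"
  "valid_factors G (as @ bs) \<longleftrightarrow> valid_factors G as \<and> valid_factors G bs"
  by (auto simp: valid_factors_def)

lemma valid_word_simp [simp]:
  "valid_word G (p, f, as) \<longleftrightarrow> p < 2 \<and> f \<in> Apar G p \<and> valid_factors G as"
  by (auto simp: valid_word_def valid_factors_def)

lemma wmul_simp: "wmul (p, f, as) (q, g, bs)
    = ((-1) ^ (q * tag_sum as)) *\<^sub>R wd ((p + q) mod 2, f * g, as @ bs)"
  by (simp add: wmul_def)

lemma wmul_assoc: "linext (wmul u) (wmul v w) = linext (\<lambda>z. wmul z w) (wmul u v)"
proof -
  obtain p f as q g bs r h cs where "u = (p, f, as)" "v = (q, g, bs)" "w = (r, h, cs)"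
    by (cases u, cases v, cases w)
  moreover have "(p + (q + r) mod 2) mod 2 = ((p + q) mod 2 + r) mod 2"
    by (simp add: mod_simps add.assoc)
  moreover have "(-1 :: real) ^ (r * tag_sum bs) * (-1) ^ ((q + r) mod 2 * tag_sum as)
    = (-1) ^ (q * tag_sum as) * (-1) ^ (r * (tag_sum as + tag_sum bs))"
    by (auto simp: minus_one_power_iff)
  ultimately show ?thesis
    by (simp add: wmul_simp mult.assoc)
qed

lemma Relators_cases [consumes 1, case_names add_function scale_function add_factor move_scalar swap]:
  assumes "x \<in> Relators G"
  obtains
    p f g as where "x = wd (p, f + g, as) - wd (p, f, as) - wd (p, g, as)"
      "valid_word G (p, f, as)" "valid_word G (p, g, as)"
  | p c f as where "x = wd (p, c *\<^sub>R f, as) - c *\<^sub>R wd (p, f, as)" "valid_word G (p, f, as)"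
  | p f us q \<alpha> \<beta> vs where
      "x = wd (p, f, us @ [(q, \<alpha> + \<beta>)] @ vs) - wd (p, f, us @ [(q, \<alpha>)] @ vs)
        - wd (p, f, us @ [(q, \<beta>)] @ vs)"
      "valid_word G (p, f, us @ [(q, \<alpha>)] @ vs)" "valid_word G (p, f, us @ [(q, \<beta>)] @ vs)"
  | p f us q' g q \<alpha> vs where
      "x = wd (p, f, us @ [((q' + q) mod 2, lact g \<alpha>)] @ vs)
        - ((-1) ^ (q' * tag_sum us)) *\<^sub>R wd ((p + q') mod 2, f * g, us @ [(q, \<alpha>)] @ vs)"
      "q' < 2" "g \<in> Apar G q'" "valid_word G (p, f, us @ [(q, \<alpha>)] @ vs)"
      "valid_word G (p, f, us @ [((q' + q) mod 2, lact g \<alpha>)] @ vs)"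
  | p f us q1 \<alpha>1 q2 \<alpha>2 vs where
      "x = wd (p, f, us @ [(q1, \<alpha>1), (q2, \<alpha>2)] @ vs)
        + ((-1) ^ (q1 * q2)) *\<^sub>R wd (p, f, us @ [(q2, \<alpha>2), (q1, \<alpha>1)] @ vs)"
      "valid_word G (p, f, us @ [(q1, \<alpha>1), (q2, \<alpha>2)] @ vs)"
  using assms unfolding Relators_def Un_iff mem_Collect_eq
  by (elim disjE exE conjE) blast+

definition relations :: "(int \<Rightarrow> 'a::real_algebra_1 set) \<Rightarrow> 'a form set" where
  "relations G = span (Relators G)"

lemma subspace_relations: "subspace (relations G)"
  by (simp add: relations_def)

lemmas relations_scaleR = subspace_scale[OF subspace_relations]

lemma oeq_iff_relations: "oeq G x y \<longleftrightarrow> x - y \<in> relations G"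
  by (simp add: oeq_def relations_def)

lemma relation_add_function:
  assumes "valid_word G (p, f, as)" "valid_word G (p, g, as)"
  shows "wd (p, f + g, as) - wd (p, f, as) - wd (p, g, as) \<in> relations G"
  unfolding relations_def Relators_def
  by (rule span_base, rule UnI1, rule UnI1, rule UnI1, rule UnI1) (use assms in blast)

lemma relation_scale_function:
  assumes "valid_word G (p, f, as)"
  shows "wd (p, c *\<^sub>R f, as) - c *\<^sub>R wd (p, f, as) \<in> relations G"
  unfolding relations_def Relators_def
  by (rule span_base, rule UnI1, rule UnI1, rule UnI1, rule UnI2) (use assms in blast)

lemma relation_add_factor:
  assumes "valid_word G (p, f, us @ [(q, \<alpha>)] @ vs)" "valid_word G (p, f, us @ [(q, \<beta>)] @ vs)"
  shows "wd (p, f, us @ [(q, \<alpha> + \<beta>)] @ vs) - wd (p, f, us @ [(q, \<alpha>)] @ vs)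
    - wd (p, f, us @ [(q, \<beta>)] @ vs) \<in> relations G"
  unfolding relations_def Relators_def
  by (rule span_base, rule UnI1, rule UnI1, rule UnI2) (use assms in blast)

lemma relation_move_scalar:
  assumes "q' < 2" "g \<in> Apar G q'" "valid_word G (p, f, us @ [(q, \<alpha>)] @ vs)"
    "valid_word G (p, f, us @ [((q' + q) mod 2, lact g \<alpha>)] @ vs)"
  shows "wd (p, f, us @ [((q' + q) mod 2, lact g \<alpha>)] @ vs)
    - ((-1) ^ (q' * tag_sum us)) *\<^sub>R wd ((p + q') mod 2, f * g, us @ [(q, \<alpha>)] @ vs) \<in> relations G"
  unfolding relations_def Relators_def
  by (rule span_base, rule UnI1, rule UnI2) (use assms in blast)

lemma relation_swap:
  assumes "valid_word G (p, f, us @ [(q1, \<alpha>1), (q2, \<alpha>2)] @ vs)"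
  shows "wd (p, f, us @ [(q1, \<alpha>1), (q2, \<alpha>2)] @ vs)
    + ((-1) ^ (q1 * q2)) *\<^sub>R wd (p, f, us @ [(q2, \<alpha>2), (q1, \<alpha>1)] @ vs) \<in> relations G"
  unfolding relations_def Relators_def
  by (rule span_base, rule UnI2) (use assms in blast)

lemma subspace_Om: "subspace (Om G)"
  by (simp add: Om_def)

lemmas Om_add = subspace_add[OF subspace_Om] and Om_scaleR = subspace_scale[OF subspace_Om]
  and Om_0 = subspace_0[OF subspace_Om] and Om_neg = subspace_neg[OF subspace_Om]
  and Om_diff = subspace_diff[OF subspace_Om]

lemma wd_Om: "valid_word G w \<Longrightarrow> wd w \<in> Om G"
  unfolding Om_def by (rule span_base) simp

context supercommutative_algebra
begin

lemma Apar_add: "f \<in> Apar G p \<Longrightarrow> g \<in> Apar G p \<Longrightarrow> f + g \<in> Apar G p"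
  and Apar_scaleR: "f \<in> Apar G p \<Longrightarrow> c *\<^sub>R f \<in> Apar G p"
  by (simp_all add: subspace_add subspace_scale fun_parity.subspace_parity)

lemma Apar_mult: "p < 2 \<Longrightarrow> q < 2 \<Longrightarrow> f \<in> Apar G p \<Longrightarrow> g \<in> Apar G q \<Longrightarrow> f * g \<in> Apar G ((p + q) mod 2)"
  using hfun_mult[of f "int p" g "int q"] hfun_of_nat[of "(p + q) mod 2"]
    hfun_cong[of "int ((p + q) mod 2)" "int p + int q"]
  by (simp add: hfun_of_nat of_nat_mod)

lemma Apar_commute:
  "p < 2 \<Longrightarrow> q < 2 \<Longrightarrow> f \<in> Apar G p \<Longrightarrow> g \<in> Apar G q \<Longrightarrow> f * g = ((-1) ^ (p * q)) *\<^sub>R (g * f)"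
  using hfun_commute[of f "int p" g "int q"] minus_one_power_tag[of "int p" "int q"]
  by (simp add: hfun_of_nat tag_of_nat)

lemma O1par_add: "\<alpha> \<in> O1par G p \<Longrightarrow> \<beta> \<in> O1par G p \<Longrightarrow> \<alpha> + \<beta> \<in> O1par G p"
  by (simp add: O1par_def subspace_add form_parity.subspace_parity subspace_Omega1)

lemma wmul_Om:
  assumes "valid_word G u" "valid_word G w"
  shows "wmul u w \<in> Om G"
  using assms by (cases u, cases w) (auto simp: wmul_simp Apar_mult intro!: Om_scaleR wd_Om)

text \<open>Degrees, like parities, are integers, so that the part of degree \<open>-1\<close> is zero.\<close>

definition hom_words :: "int \<Rightarrow> int \<Rightarrow> 'a word set" where
  "hom_words r p = {w. valid_word G w \<and> int (wdeg w) = r \<and> even (int (wpar w) - p)}"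

lemma hom_words_iff: "(d, f, as) \<in> hom_words r p \<longleftrightarrow>
    valid_word G (d, f, as) \<and> int (length as) = r \<and> even (int d + int (tag_sum as) - p)"
  by (auto simp: hom_words_def wdeg_def wpar_def of_nat_mod)

lemma span_hom_words_Om: "span (wd ` hom_words r p) \<subseteq> Om G"
  unfolding Om_def by (rule span_mono) (auto simp: hom_words_def)

lemma Relators_homogeneous:
  assumes "x \<in> Relators G"
  obtains r p where "x \<in> span (wd ` hom_words r p)"
proof -
  have wd_span: "w \<in> hom_words r p \<Longrightarrow> wd w \<in> span (wd ` hom_words r p)" for w r p
    by (rule span_base) simp
  show ?thesis
    using assms
  proof (cases rule: Relators_cases)
    case (add_function p f g as)
    then show ?thesis
      by (intro that[of "int (length as)" "int p + int (tag_sum as)"])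
        (auto simp: hom_words_iff Apar_add intro!: span_diff wd_span)
  next
    case (scale_function p c f as)
    then show ?thesis
      by (intro that[of "int (length as)" "int p + int (tag_sum as)"])
        (auto simp: hom_words_iff Apar_scaleR intro!: span_diff span_scale wd_span)
  next
    case (add_factor p f us q \<alpha> \<beta> vs)
    then show ?thesis
      by (intro that[of "int (length us + 1 + length vs)"
        "int p + int (tag_sum us + q + tag_sum vs)"])
        (auto simp: hom_words_iff O1par_add intro!: span_diff wd_span)
  next
    case (move_scalar p f us q' g q \<alpha> vs)
    then show ?thesis
      by (intro that[of "int (length us + 1 + length vs)"
        "int (p + q') + int (tag_sum us + q + tag_sum vs)"])
        (auto simp: hom_words_iff Apar_mult of_nat_mod intro!: span_diff span_scale wd_span)
  next
    case (swap p f us q \<alpha> q' \<beta> vs)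
    then show ?thesis
      by (intro that[of "int (length us + 2 + length vs)"
        "int p + int (tag_sum us + q + q' + tag_sum vs)"])
        (auto simp: hom_words_iff intro!: span_add span_scale wd_span)
  qed
qed

lemma relations_subset_Om: "relations G \<subseteq> Om G"
  unfolding relations_def using span_hom_words_Om
  by (intro span_minimal subspace_Om) (auto elim!: Relators_homogeneous)

lemma wmul_left_move_scalar:
  assumes g: "q' < 2" "g \<in> Apar G q'"
    and words: "valid_word G (p, f, us @ [(q, \<alpha>)] @ vs)"
      "valid_word G (p, f, us @ [((q' + q) mod 2, lact g \<alpha>)] @ vs)"
    and u: "r < 2" "h \<in> Apar G r" "valid_factors G bs"
  shows "wmul (r, h, bs) (p, f, us @ [((q' + q) mod 2, lact g \<alpha>)] @ vs)
    - ((-1) ^ (q' * tag_sum us)) *\<^sub>R wmul (r, h, bs) ((p + q') mod 2, f * g, us @ [(q, \<alpha>)] @ vs)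
    \<in> relations G"
proof -
  define a where "a = wd ((r + p) mod 2, h * f, (bs @ us) @ [((q' + q) mod 2, lact g \<alpha>)] @ vs)"
  define b where "b = wd (((r + p) mod 2 + q') mod 2, h * f * g, (bs @ us) @ [(q, \<alpha>)] @ vs)"
  define k where "k = (-1 :: real) ^ (q' * tag_sum (bs @ us))"
  have "a - k *\<^sub>R b \<in> relations G"
    unfolding a_def b_def k_def using words g u by (intro relation_move_scalar) (auto simp: Apar_mult)
  then have "(-1) ^ (p * tag_sum bs) *\<^sub>R (a - k *\<^sub>R b) \<in> relations G"
    by (rule relations_scaleR)
  moreover have "(r + (p + q') mod 2) mod 2 = ((r + p) mod 2 + q') mod 2"
    by presburger
  moreover have "(-1) ^ (q' * tag_sum us) * (-1) ^ ((p + q') mod 2 * tag_sum bs)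
      = (-1) ^ (p * tag_sum bs) * k"
    by (auto simp: k_def minus_one_power_iff)
  ultimately show ?thesis
    by (simp add: wmul_simp a_def b_def scaleR_diff_right mult.assoc)
qed

lemma wmul_left_Relators:
  assumes u: "valid_word G u" and x: "x \<in> Relators G"
  shows "linext (wmul u) x \<in> relations G"
proof -
  obtain r h bs where u_eq: "u = (r, h, bs)"
    by (cases u)
  have r: "r < 2" and h: "h \<in> Apar G r" and bs: "valid_factors G bs"
    using u by (simp_all add: u_eq)
  define \<epsilon> where "\<epsilon> p = (-1 :: real) ^ (p * tag_sum bs)" for p
  have wmul: "wmul u (p, f, as) = \<epsilon> p *\<^sub>R wd ((r + p) mod 2, h * f, bs @ as)" for p f as
    by (simp add: u_eq wmul_simp \<epsilon>_def)
  from x show ?thesis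
  proof (cases rule: Relators_cases)
    case (add_function p f g as)
    let ?w = "\<lambda>f. wd ((r + p) mod 2, f, bs @ as)"
    have "?w (h * f + h * g) - ?w (h * f) - ?w (h * g) \<in> relations G"
      using add_function r h bs by (intro relation_add_function) (auto simp: Apar_mult)
    from relations_scaleR[OF this, of "\<epsilon> p"] show ?thesis
      by (simp add: add_function(1) wmul algebra_simps)
  next
    case (scale_function p c f as)
    let ?w = "\<lambda>f. wd ((r + p) mod 2, f, bs @ as)"
    have "?w (c *\<^sub>R (h * f)) - c *\<^sub>R ?w (h * f) \<in> relations G"
      using scale_function r h bs by (intro relation_scale_function) (auto simp: Apar_mult)
    from relations_scaleR[OF this, of "\<epsilon> p"] show ?thesis
      by (simp add: scale_function(1) wmul algebra_simps)
  next
    case (add_factor p f us q \<alpha> \<beta> vs)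
    let ?w = "\<lambda>\<alpha>. wd ((r + p) mod 2, h * f, (bs @ us) @ [(q, \<alpha>)] @ vs)"
    have "?w (\<alpha> + \<beta>) - ?w \<alpha> - ?w \<beta> \<in> relations G"
      using add_factor r h bs by (intro relation_add_factor) (auto simp: Apar_mult)
    from relations_scaleR[OF this, of "\<epsilon> p"] show ?thesis
      by (simp add: add_factor(1) wmul algebra_simps)
  next
    case (move_scalar p f us q' g q \<alpha> vs)
    then show ?thesis
      using wmul_left_move_scalar[of q' g p f us q \<alpha> vs r h bs] r h bs by (simp add: u_eq)
  next
    case (swap p f us q1 \<alpha>1 q2 \<alpha>2 vs)
    let ?w = "\<lambda>xs. wd ((r + p) mod 2, h * f, (bs @ us) @ xs @ vs)"
    have "?w [(q1, \<alpha>1), (q2, \<alpha>2)] + (-1) ^ (q1 * q2) *\<^sub>R ?w [(q2, \<alpha>2), (q1, \<alpha>1)] \<in> relations G"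
      using swap r h bs by (intro relation_swap) (auto simp: Apar_mult)
    from relations_scaleR[OF this, of "\<epsilon> p"] show ?thesis
      by (simp add: swap(1) wmul algebra_simps)
  qed
qed

lemma wmul_right_move_scalar:
  assumes g: "q' < 2" "g \<in> Apar G q'"
    and words: "valid_word G (p, f, us @ [(q, \<alpha>)] @ vs)"
      "valid_word G (p, f, us @ [((q' + q) mod 2, lact g \<alpha>)] @ vs)"
    and u: "r < 2" "h \<in> Apar G r" "valid_factors G bs"
  shows "wmul (p, f, us @ [((q' + q) mod 2, lact g \<alpha>)] @ vs) (r, h, bs)
    - ((-1) ^ (q' * tag_sum us)) *\<^sub>R wmul ((p + q') mod 2, f * g, us @ [(q, \<alpha>)] @ vs) (r, h, bs)
    \<in> relations G"
proof -
  define a where "a = wd ((p + r) mod 2, f * h, us @ [((q' + q) mod 2, lact g \<alpha>)] @ (vs @ bs))"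
  define b where "b f = wd (((p + r) mod 2 + q') mod 2, f, us @ [(q, \<alpha>)] @ (vs @ bs))" for f
  define k \<epsilon> where "k = (-1 :: real) ^ (q' * tag_sum us)" and "\<epsilon> = (-1 :: real) ^ (q' * r)"
  define e where "e = (-1 :: real) ^ (r * tag_sum (us @ [((q' + q) mod 2, lact g \<alpha>)] @ vs))"
  have "a - k *\<^sub>R b (f * h * g) \<in> relations G"
    unfolding a_def b_def k_def using words g u by (intro relation_move_scalar) (auto simp: Apar_mult)
  from relations_scaleR[OF this, of e]
  have "e *\<^sub>R (a - k *\<^sub>R b (f * h * g)) \<in> relations G" .
  moreover have "b (\<epsilon> *\<^sub>R (f * h * g)) - \<epsilon> *\<^sub>R b (f * h * g) \<in> relations G"
    unfolding b_def using words g u by (intro relation_scale_function) (auto simp: Apar_mult)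
  from relations_scaleR[OF this, of "e * k * \<epsilon>"]
  have "(e * k * \<epsilon>) *\<^sub>R (b (\<epsilon> *\<^sub>R (f * h * g)) - \<epsilon> *\<^sub>R b (f * h * g)) \<in> relations G" .
  ultimately have "e *\<^sub>R (a - k *\<^sub>R b (f * h * g))
      - (e * k * \<epsilon>) *\<^sub>R (b (\<epsilon> *\<^sub>R (f * h * g)) - \<epsilon> *\<^sub>R b (f * h * g)) \<in> relations G"
    by (rule subspace_diff[OF subspace_relations])
  moreover have "\<epsilon> * \<epsilon> = 1"
    by (simp add: \<epsilon>_def minus_one_power_iff)
  ultimately have "e *\<^sub>R a - (e * k * \<epsilon>) *\<^sub>R b (\<epsilon> *\<^sub>R (f * h * g)) \<in> relations G"
    by (simp add: scaleR_diff_right mult.assoc)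
  moreover have "f * g * h = \<epsilon> *\<^sub>R (f * h * g)"
    using Apar_commute[of q' r g h] g u by (simp add: \<epsilon>_def mult.assoc)
  moreover have "((p + q') mod 2 + r) mod 2 = ((p + r) mod 2 + q') mod 2"
    by presburger
  moreover have "(-1) ^ (r * tag_sum (us @ [(q, \<alpha>)] @ vs)) = e * \<epsilon>"
    by (auto simp: e_def \<epsilon>_def minus_one_power_iff)
  ultimately show ?thesis
    by (simp add: wmul_simp flip: k_def) (simp add: a_def b_def e_def mult.assoc mult.left_commute)
qed

lemma wmul_right_Relators:
  assumes u: "valid_word G u" and x: "x \<in> Relators G"
  shows "linext (\<lambda>w. wmul w u) x \<in> relations G"
proof -
  obtain r h bs where u_eq: "u = (r, h, bs)"
    by (cases u)
  have r: "r < 2" and h: "h \<in> Apar G r" and bs: "valid_factors G bs"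
    using u by (simp_all add: u_eq)
  define \<epsilon> where "\<epsilon> as = (-1 :: real) ^ (r * tag_sum as)" for as :: "(nat \<times> 'a tens) list"
  have wmul: "wmul (p, f, as) u = \<epsilon> as *\<^sub>R wd ((p + r) mod 2, f * h, as @ bs)" for p f as
    by (simp add: u_eq wmul_simp \<epsilon>_def)
  from x show ?thesis
  proof (cases rule: Relators_cases)
    case (add_function p f g as)
    let ?w = "\<lambda>f. wd ((p + r) mod 2, f, as @ bs)"
    have "?w (f * h + g * h) - ?w (f * h) - ?w (g * h) \<in> relations G"
      using add_function r h bs by (intro relation_add_function) (auto simp: Apar_mult)
    from relations_scaleR[OF this, of "\<epsilon> as"] show ?thesis
      by (simp add: add_function(1) wmul algebra_simps)
  next
    case (scale_function p c f as)
    let ?w = "\<lambda>f. wd ((p + r) mod 2, f, as @ bs)"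
    have "?w (c *\<^sub>R (f * h)) - c *\<^sub>R ?w (f * h) \<in> relations G"
      using scale_function r h bs by (intro relation_scale_function) (auto simp: Apar_mult)
    from relations_scaleR[OF this, of "\<epsilon> as"] show ?thesis
      by (simp add: scale_function(1) wmul algebra_simps)
  next
    case (add_factor p f us q \<alpha> \<beta> vs)
    let ?w = "\<lambda>\<alpha>. wd ((p + r) mod 2, f * h, us @ [(q, \<alpha>)] @ (vs @ bs))"
    have "?w (\<alpha> + \<beta>) - ?w \<alpha> - ?w \<beta> \<in> relations G"
      using add_factor r h bs by (intro relation_add_factor) (auto simp: Apar_mult)
    from relations_scaleR[OF this, of "\<epsilon> (us @ [(q, \<alpha>)] @ vs)"] show ?thesis
      by (simp add: add_factor(1) wmul scaleR_diff_right \<epsilon>_def)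
  next
    case (move_scalar p f us q' g q \<alpha> vs)
    then show ?thesis
      using wmul_right_move_scalar[of q' g p f us q \<alpha> vs r h bs] r h bs by (simp add: u_eq)
  next
    case (swap p f us q1 \<alpha>1 q2 \<alpha>2 vs)
    let ?w = "\<lambda>xs. wd ((p + r) mod 2, f * h, us @ xs @ (vs @ bs))"
    have "?w [(q1, \<alpha>1), (q2, \<alpha>2)] + (-1) ^ (q1 * q2) *\<^sub>R ?w [(q2, \<alpha>2), (q1, \<alpha>1)] \<in> relations G"
      using swap r h bs by (intro relation_swap) (auto simp: Apar_mult)
    from relations_scaleR[OF this, of "\<epsilon> (us @ [(q1, \<alpha>1), (q2, \<alpha>2)] @ vs)"] show ?thesis
      by (simp add: swap(1) wmul scaleR_add_right \<epsilon>_def add.left_commute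
        mult.commute[of "(-1) ^ (q1 * q2)"])
  qed
qed

lemma form_mult_Om:
  assumes "x \<in> Om G" "y \<in> Om G"
  shows "form_mult x y \<in> Om G"
  using assms[unfolded Om_def]
  by (induction rule: span_induct2)
    (auto intro!: wmul_Om subspace_linear_mem linear_form_mult_left linear_form_mult_right
      subspace_Om)

lemma wedge_Om: "x \<in> Om G \<Longrightarrow> y \<in> Om G \<Longrightarrow> wedge x y \<in> Om G"
  by (simp add: wedge_eq_form_mult form_mult_Om)

lemma relations_right_ideal:
  assumes "x \<in> relations G" "y \<in> Om G"
  shows "form_mult x y \<in> relations G"
  using assms(1)[unfolded relations_def] assms(2)[unfolded Om_def]
proof (induction rule: span_induct2)
  case (base x y)
  then show ?case
    using wmul_right_Relators by (auto simp: form_mult_wd_right simp del: valid_word_simp)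
qed (intro subspace_linear_mem linear_form_mult_left linear_form_mult_right subspace_relations)+

lemma relations_left_ideal:
  assumes "x \<in> Om G" "y \<in> relations G"
  shows "form_mult x y \<in> relations G"
  using assms(1)[unfolded Om_def] assms(2)[unfolded relations_def]
proof (induction rule: span_induct2)
  case (base x y)
  then show ?case
    using wmul_left_Relators by (auto simp: form_mult_wd_left simp del: valid_word_simp)
qed (intro subspace_linear_mem linear_form_mult_left linear_form_mult_right subspace_relations)+

lemma form_mult_assoc:
  assumes "x \<in> Om G" "y \<in> Om G" "z \<in> Om G"
  shows "form_mult (form_mult x y) z = form_mult x (form_mult y z)"
  using assms(1,2)[unfolded Om_def]
proof (induction rule: span_induct2)
  case (base x y)
  then obtain u v where uv: "x = wd u" "y = wd v"
    by blast
  have "linear (\<lambda>z. form_mult (form_mult x y) z)" "linear (\<lambda>z. form_mult x (form_mult y z))"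
    using linear_compose[OF linear_form_mult_right linear_form_mult_right]
    by (simp_all add: o_def linear_form_mult_right)
  moreover have "form_mult (form_mult x y) (wd w) = form_mult x (form_mult y (wd w))" for w
    by (simp add: uv form_mult_wd_left form_mult_wd_right wmul_assoc)
  ultimately show ?case
    using linear_eq_on[OF _ _ assms(3)[unfolded Om_def]] by blast
next
  case (subspace_left y)
  show ?case
    using linear_compose[OF linear_form_mult_left linear_form_mult_left]
    by (intro subspace_linear_eq) (simp_all add: o_def linear_form_mult_left)
next
  case (subspace_right x)
  show ?case
    using linear_compose[OF linear_form_mult_right linear_form_mult_left]
      linear_compose[OF linear_form_mult_left linear_form_mult_right]
    by (intro subspace_linear_eq) (simp_all add: o_def)
qed

lemma form_mult_one:
  assumes "x \<in> Om G"
  shows "form_mult x (wd (0, 1, [])) = x" "form_mult (wd (0, 1, [])) x = x"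
proof -
  have "form_mult (wd w) (wd (0, 1, [])) = wd w" "form_mult (wd (0, 1, [])) (wd w) = wd w"
    if "valid_word G w" for w
    using that by (cases w, simp add: wmul_simp)+
  then show "form_mult x (wd (0, 1, [])) = x" "form_mult (wd (0, 1, [])) x = x"
    using assms unfolding Om_def
    by (auto intro: linear_eq_on[OF _ linear_ident] linear_form_mult_left linear_form_mult_right)
qed

end

subsection \<open>Quotient algebras as algebras of linear endomorphisms\<close>

typedef (overloaded) 'v endo = "{f :: 'v::real_vector \<Rightarrow> 'v. linear f}"
  morphisms apply_endo Endo
  by (rule exI[of _ "\<lambda>x. x"]) (simp add: linear_iff)

lemma endo_eqI: "(\<And>x. apply_endo a x = apply_endo b x) \<Longrightarrow> a = b"
  by (metis apply_endo_inject ext)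

lemma linear_apply_endo: "linear (apply_endo a)"
  using apply_endo by blast

lemma apply_Endo: "linear f \<Longrightarrow> apply_endo (Endo f) = f"
  by (simp add: Endo_inverse)

lemmas apply_endo_linear [simp] = linear_add[OF linear_apply_endo] linear_diff[OF linear_apply_endo]
  linear_scale[OF linear_apply_endo] linear_neg[OF linear_apply_endo] linear_0[OF linear_apply_endo]

instantiation endo :: (real_vector) real_algebra
begin

definition plus_endo :: "'a endo \<Rightarrow> 'a endo \<Rightarrow> 'a endo" where
  "a + b = Endo (\<lambda>x. apply_endo a x + apply_endo b x)"

definition minus_endo :: "'a endo \<Rightarrow> 'a endo \<Rightarrow> 'a endo" where
  "a - b = Endo (\<lambda>x. apply_endo a x - apply_endo b x)"

definition uminus_endo :: "'a endo \<Rightarrow> 'a endo" where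
  "- a = Endo (\<lambda>x. - apply_endo a x)"

definition zero_endo :: "'a endo" where
  "0 = Endo (\<lambda>x. 0)"

definition times_endo :: "'a endo \<Rightarrow> 'a endo \<Rightarrow> 'a endo" where
  "a * b = Endo (\<lambda>x. apply_endo a (apply_endo b x))"

definition scaleR_endo :: "real \<Rightarrow> 'a endo \<Rightarrow> 'a endo" where
  "c *\<^sub>R a = Endo (\<lambda>x. c *\<^sub>R apply_endo a x)"

lemma apply_endo_simps [simp]:
  "apply_endo (a + b) x = apply_endo a x + apply_endo b x"
  "apply_endo (a - b) x = apply_endo a x - apply_endo b x"
  "apply_endo (- a) x = - apply_endo a x"
  "apply_endo 0 x = 0"
  "apply_endo (a * b) x = apply_endo a (apply_endo b x)"
  "apply_endo (c *\<^sub>R a) x = c *\<^sub>R apply_endo a x"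
  unfolding plus_endo_def minus_endo_def uminus_endo_def zero_endo_def times_endo_def scaleR_endo_def
  by (subst apply_Endo, simp add: linear_iff algebra_simps, simp)+

instance
  by standard (auto intro!: endo_eqI simp: algebra_simps)

end

lemma quotient_projection_exists:
  fixes V I :: "'v::real_vector set"
  assumes "subspace V" "subspace I" "I \<subseteq> V"
  obtains N where "linear N" "\<And>x. N x \<in> V" "\<And>x. x \<in> I \<Longrightarrow> N x = 0" "\<And>x. x \<in> V \<Longrightarrow> N x - x \<in> I"
proof -
  obtain \<pi> where \<pi>: "linear \<pi>" "\<And>x. \<pi> x \<in> V" "\<And>x. x \<in> V \<Longrightarrow> \<pi> x = x"
    using linear_projection_exists[OF assms(1)] by blast
  obtain \<kappa> where \<kappa>: "linear \<kappa>" "\<And>x. \<kappa> x \<in> I" "\<And>x. x \<in> I \<Longrightarrow> \<kappa> x = x"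
    using linear_projection_exists[OF assms(2)] by blast
  show ?thesis
  proof
    show "linear (\<lambda>x. \<pi> x - \<kappa> (\<pi> x))"
      using linear_compose[OF \<pi>(1) \<kappa>(1)] by (intro linear_compose_sub \<pi>) (simp add: o_def)
    show "\<pi> x - \<kappa> (\<pi> x) \<in> V" for x
      using \<pi>(2) \<kappa>(2) assms by (intro subspace_diff) auto
    show "\<pi> x - \<kappa> (\<pi> x) = 0" if "x \<in> I" for x
      using that \<pi>(3) \<kappa>(3) assms(3) by auto
    show "\<pi> x - \<kappa> (\<pi> x) - x \<in> I" if "x \<in> V" for x
      using that \<pi>(3) \<kappa>(2) subspace_neg[OF assms(2)] by simp
  qed
qed

lemma quotient_algebra_representation:
  fixes m :: "'v::real_vector \<Rightarrow> 'v \<Rightarrow> 'v"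
  assumes V: "subspace V" and I: "subspace I" "I \<subseteq> V"
    and linear_left: "\<And>y. linear (\<lambda>x. m x y)" and linear_right: "\<And>x. linear (m x)"
    and closed: "\<And>x y. x \<in> V \<Longrightarrow> y \<in> V \<Longrightarrow> m x y \<in> V"
    and assoc: "\<And>x y z. x \<in> V \<Longrightarrow> y \<in> V \<Longrightarrow> z \<in> V \<Longrightarrow> m (m x y) z = m x (m y z)"
    and unit: "e \<in> V" "\<And>x. x \<in> V \<Longrightarrow> m x e = x"
    and right_ideal: "\<And>x y. x \<in> I \<Longrightarrow> y \<in> V \<Longrightarrow> m x y \<in> I"
    and left_ideal: "\<And>x y. x \<in> V \<Longrightarrow> y \<in> I \<Longrightarrow> m x y \<in> I"
  obtains \<Phi> :: "'v \<Rightarrow> 'v endo" where "linear \<Phi>"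
    "\<And>x y. x \<in> V \<Longrightarrow> y \<in> V \<Longrightarrow> \<Phi> (m x y) = \<Phi> x * \<Phi> y"
    "\<And>x. x \<in> V \<Longrightarrow> \<Phi> x = 0 \<longleftrightarrow> x \<in> I"
proof -
  obtain N where N: "linear N" "\<And>x. N x \<in> V" "\<And>x. x \<in> I \<Longrightarrow> N x = 0" "\<And>x. x \<in> V \<Longrightarrow> N x - x \<in> I"
    using quotient_projection_exists[OF V I] by metis
  have N_cong: "N x = N y" if "x - y \<in> I" for x y
    using N(3)[OF that] by (simp add: linear_diff[OF N(1)])
  have N_mult_N: "N (m x (N y)) = N (m x y)" if "x \<in> V" "y \<in> V" for x y
    using left_ideal[OF that(1) N(4)[OF that(2)]]
    by (intro N_cong) (simp add: linear_diff[OF linear_right])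
  define \<Phi> where "\<Phi> x = Endo (\<lambda>y. N (m (N x) (N y)))" for x
  have apply_\<Phi>: "apply_endo (\<Phi> x) y = N (m (N x) (N y))" for x y
    using linear_compose[OF N(1) linear_compose[OF linear_right N(1)]]
    by (simp add: \<Phi>_def apply_Endo o_def)
  have apply_\<Phi>_V: "apply_endo (\<Phi> x) y = N (m x (N y))" if "x \<in> V" for x y
    using right_ideal[OF N(4)[OF that] N(2)] unfolding apply_\<Phi>
    by (intro N_cong) (simp add: linear_diff[OF linear_left])
  show ?thesis
  proof
    show "linear \<Phi>"
      by (intro linearI endo_eqI) (simp_all add: apply_\<Phi> linear_add[OF N(1)] linear_scale[OF N(1)]
        linear_add[OF linear_left] linear_scale[OF linear_left])
    show "\<Phi> (m x y) = \<Phi> x * \<Phi> y" if "x \<in> V" "y \<in> V" for x y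
      using that N(2) closed by (intro endo_eqI) (simp add: apply_\<Phi>_V N_mult_N assoc)
    show "\<Phi> x = 0 \<longleftrightarrow> x \<in> I" if x: "x \<in> V" for x
    proof
      assume "\<Phi> x = 0"
      then have "N x = 0"
        using apply_\<Phi>_V[OF x, of e] N_mult_N[OF x unit(1)] unit(2)[OF x] by simp
      then show "x \<in> I"
        using N(4)[OF x] subspace_neg[OF I(1)] by fastforce
    next
      assume "x \<in> I"
      then have "N (m x (N y)) = 0" for y
        using N(2,3) right_ideal by blast
      then show "\<Phi> x = 0"
        by (intro endo_eqI) (simp add: apply_\<Phi>_V[OF x])
    qed
  qed
qed

subsection \<open>The algebra of superforms and its generators\<close>

text \<open>The quotient of the formal combinations of words by the relations is realized by left
  multiplications on a complement of the relations.\<close>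

type_synonym 'a superform = "'a form endo"

context supercommutative_algebra
begin

definition class_of :: "'a form \<Rightarrow> 'a superform" where
  "class_of = (SOME \<Phi>. linear \<Phi> \<and> (\<forall>x\<in>Om G. \<forall>y\<in>Om G. \<Phi> (form_mult x y) = \<Phi> x * \<Phi> y) \<and>
    (\<forall>x\<in>Om G. \<Phi> x = 0 \<longleftrightarrow> x \<in> relations G))"

lemma class_of:
  shows linear_class_of: "linear class_of"
    and class_of_form_mult: "x \<in> Om G \<Longrightarrow> y \<in> Om G \<Longrightarrow> class_of (form_mult x y) = class_of x * class_of y"
    and class_of_eq_0_iff: "x \<in> Om G \<Longrightarrow> class_of x = 0 \<longleftrightarrow> x \<in> relations G"
proof -
  obtain \<Phi> :: "'a form \<Rightarrow> 'a superform" where "linear \<Phi>"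
    "\<And>x y. x \<in> Om G \<Longrightarrow> y \<in> Om G \<Longrightarrow> \<Phi> (form_mult x y) = \<Phi> x * \<Phi> y"
    "\<And>x. x \<in> Om G \<Longrightarrow> \<Phi> x = 0 \<longleftrightarrow> x \<in> relations G"
    by (rule quotient_algebra_representation[OF subspace_Om subspace_relations relations_subset_Om
          linear_form_mult_left linear_form_mult_right form_mult_Om form_mult_assoc wd_Om
          form_mult_one(1)
          relations_right_ideal relations_left_ideal]) auto
  then have "\<exists>\<Phi> :: 'a form \<Rightarrow> 'a superform. linear \<Phi> \<and>
    (\<forall>x\<in>Om G. \<forall>y\<in>Om G. \<Phi> (form_mult x y) = \<Phi> x * \<Phi> y) \<and> (\<forall>x\<in>Om G. \<Phi> x = 0 \<longleftrightarrow> x \<in> relations G)"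
    by blast
  from someI_ex[OF this, folded class_of_def]
  show "linear class_of"
    and "x \<in> Om G \<Longrightarrow> y \<in> Om G \<Longrightarrow> class_of (form_mult x y) = class_of x * class_of y"
    and "x \<in> Om G \<Longrightarrow> class_of x = 0 \<longleftrightarrow> x \<in> relations G"
    by blast+
qed

lemmas class_of_linear [simp] = linear_add[OF linear_class_of] linear_diff[OF linear_class_of]
  linear_scale[OF linear_class_of] linear_neg[OF linear_class_of] linear_0[OF linear_class_of]

lemma class_of_relation: "x \<in> relations G \<Longrightarrow> class_of x = 0"
  using class_of_eq_0_iff relations_subset_Om by blast

lemma class_of_wedge: "x \<in> Om G \<Longrightarrow> y \<in> Om G \<Longrightarrow> class_of (wedge x y) = class_of x * class_of y"
  by (simp add: wedge_eq_form_mult class_of_form_mult)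

lemma class_of_wmul:
  "valid_word G u \<Longrightarrow> valid_word G w \<Longrightarrow> class_of (wmul u w) = class_of (wd u) * class_of (wd w)"
  using class_of_form_mult[of "wd u" "wd w"] by (simp add: wd_Om del: valid_word_simp)

lemma oeq_iff_class_of: "x \<in> Om G \<Longrightarrow> y \<in> Om G \<Longrightarrow> oeq G x y \<longleftrightarrow> class_of x = class_of y"
  using class_of_eq_0_iff[of "x - y"] Om_diff by (auto simp: oeq_iff_relations)

definition hform :: "int \<Rightarrow> int \<Rightarrow> 'a superform set" where
  "hform r p = class_of ` span (wd ` hom_words r p)"

definition forms :: "'a superform set" where
  "forms = class_of ` Om G"

definition unit_form :: "'a superform" where
  "unit_form = class_of (wd (0, 1, []))"

lemma hform_eq_span: "hform r p = span ((\<lambda>w. class_of (wd w)) ` hom_words r p)"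
  by (simp add: hform_def span_linear_image[OF linear_class_of, symmetric] image_image)

lemma forms_eq_span: "forms = span ((\<lambda>w. class_of (wd w)) ` Collect (valid_word G))"
  by (simp add: forms_def Om_def span_linear_image[OF linear_class_of, symmetric] image_image)

lemma subspace_hform: "subspace (hform r p)"
  by (simp add: hform_eq_span)

lemma subspace_forms: "subspace forms"
  by (simp add: forms_eq_span)

lemmas hform_add = subspace_add[OF subspace_hform]
  and hform_scaleR = subspace_scale[OF subspace_hform]
  and hform_0 [simp] = subspace_0[OF subspace_hform] and hform_diff = subspace_diff[OF subspace_hform]
  and hform_neg = subspace_neg[OF subspace_hform]
lemmas forms_add = subspace_add[OF subspace_forms]
  and forms_scaleR = subspace_scale[OF subspace_forms]
  and forms_0 [simp] = subspace_0[OF subspace_forms]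

lemma hform_forms: "X \<in> hform r p \<Longrightarrow> X \<in> forms"
  using span_hom_words_Om by (auto simp: hform_def forms_def)

lemma hform_cong: "even (p - q) \<Longrightarrow> hform r p = hform r q"
  unfolding hform_def hom_words_def by (rule arg_cong[of _ _ "\<lambda>W. class_of ` span (wd ` W)"]) auto

lemma hform_neg_degree: "r < 0 \<Longrightarrow> hform r p = {0}"
  unfolding hform_eq_span hom_words_def by auto

lemma class_of_forms: "x \<in> Om G \<Longrightarrow> class_of x \<in> forms"
  by (simp add: forms_def)

lemma class_of_wd_hform: "w \<in> hom_words r p \<Longrightarrow> class_of (wd w) \<in> hform r p"
  unfolding hform_eq_span by (rule span_base) blast

lemma forms_mult: "X \<in> forms \<Longrightarrow> Y \<in> forms \<Longrightarrow> X * Y \<in> forms"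
  unfolding forms_def using wedge_Om by (auto simp flip: class_of_wedge)

lemma unit_form_mult [simp]: "X \<in> forms \<Longrightarrow> unit_form * X = X" "X \<in> forms \<Longrightarrow> X * unit_form = X"
  by (auto simp: forms_def unit_form_def form_mult_one wd_Om simp flip: class_of_form_mult)

lemma forms_induct [consumes 1, case_names subspace homogeneous]:
  assumes "X \<in> forms" "subspace {X. P X}" "\<And>r p X. X \<in> hform r p \<Longrightarrow> P X"
  shows "P X"
proof (rule span_induct[of X _ P, OF assms(1)[unfolded forms_eq_span]])
  fix X assume "X \<in> (\<lambda>w. class_of (wd w)) ` Collect (valid_word G)"
  then obtain d f as where "X = class_of (wd (d, f, as))" "valid_word G (d, f, as)"
    by auto
  then have "X \<in> hform (int (length as)) (int d + int (tag_sum as))"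
    by (auto intro!: class_of_wd_hform simp: hom_words_iff)
  then show "P X"
    by (rule assms(3))
qed (use assms(2) in simp)

definition representative :: "'a superform \<Rightarrow> 'a form" where
  "representative = (SOME g. linear g \<and> (\<forall>X. g X \<in> Om G) \<and> (\<forall>X\<in>forms. class_of (g X) = X))"

lemma representative:
  shows linear_representative: "linear representative"
    and representative_Om: "representative X \<in> Om G"
    and class_of_representative: "X \<in> forms \<Longrightarrow> class_of (representative X) = X"
proof -
  have "\<exists>g. linear g \<and> (\<forall>X. g X \<in> Om G) \<and> (\<forall>X\<in>forms. class_of (g X) = X)"
    using linear_exists_right_inverse_on[OF linear_class_of subspace_Om]
    by (fastforce simp: forms_def)
  from someI_ex[OF this, folded representative_def]
  show "linear representative" "representative X \<in> Om G" "X \<in> forms \<Longrightarrow> class_of (representative X) = X"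
    by auto
qed

lemma representative_class_of: "x \<in> Om G \<Longrightarrow> representative (class_of x) - x \<in> relations G"
  using oeq_iff_class_of[of "representative (class_of x)" x]
  by (simp add: oeq_iff_relations representative_Om class_of_representative class_of_forms)

lemma Ohom_iff:
  assumes "p < 2"
  shows "x \<in> Ohom G r p \<longleftrightarrow> x \<in> Om G \<and> class_of x \<in> hform (int r) (int p)"
proof -
  have "wpar w = p \<longleftrightarrow> even (int (wpar w) - int p)" for w :: "'a word"
    using assms by (auto simp: wpar_def mod2_eq_if less_two_iff)
  then have "{w. valid_word G w \<and> wdeg w = r \<and> wpar w = p} = hom_words (int r) (int p)"
    unfolding hom_words_def by auto
  moreover have "(\<exists>y\<in>span (wd ` hom_words (int r) (int p)). oeq G x y)
      \<longleftrightarrow> class_of x \<in> hform (int r) (int p)"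
    if "x \<in> Om G"
    using oeq_iff_class_of[OF that] subsetD[OF span_hom_words_Om] by (auto simp: hform_def image_iff)
  ultimately show ?thesis
    by (auto simp: Ohom_def)
qed

text \<open>The generators are the elements of \<open>A \<oplus> \<Omega>\<^sup>1(A)\<close>, functions having degree 0 and one-forms
  degree 1.\<close>

definition hgen :: "int \<Rightarrow> int \<Rightarrow> ('a \<times> 'a tens) set" where
  "hgen r p = (if r = 0 then hfun p \<times> {0} else if r = 1 then {0} \<times> hform1 p else {0})"

definition gen_act :: "'a \<Rightarrow> 'a \<times> 'a tens \<Rightarrow> 'a \<times> 'a tens" where
  "gen_act f x = (f * fst x, lact f (snd x))"

definition incl :: "'a \<times> 'a tens \<Rightarrow> 'a superform" where
  "incl x = class_of (embA G (fst x) + emb1 G (snd x))"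

lemma hgen_0_iff [simp]: "(f, \<alpha>) \<in> hgen 0 p \<longleftrightarrow> f \<in> hfun p \<and> \<alpha> = 0"
  and hgen_1_iff [simp]: "(f, \<alpha>) \<in> hgen 1 p \<longleftrightarrow> f = 0 \<and> \<alpha> \<in> hform1 p"
  by (auto simp: hgen_def)

lemma hgen_cases [consumes 1, case_names degree_0 degree_1 zero]:
  assumes "x \<in> hgen r p"
  obtains f where "r = 0" "f \<in> hfun p" "x = (f, 0)"
  | \<alpha> where "r = 1" "\<alpha> \<in> hform1 p" "x = (0, \<alpha>)"
  | "r \<noteq> 0" "r \<noteq> 1" "x = 0"
  using assms by (auto simp: hgen_def split: if_splits)

lemma subspace_hgen: "subspace (hgen r p)"
  by (auto simp: hgen_def intro!: subspace_Times subspace_hfun subspace_hform1)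

lemmas hgen_add = subspace_add[OF subspace_hgen] and hgen_scaleR = subspace_scale[OF subspace_hgen]
  and hgen_0 [simp] = subspace_0[OF subspace_hgen] and hgen_neg = subspace_neg[OF subspace_hgen]

lemma hgen_cong: "even (p - q) \<Longrightarrow> hgen r p = hgen r q"
  using hfun_cong[of p q] hform1_cong[of p q] by (simp add: hgen_def)

lemma fst_hgen: "x \<in> hgen r p \<Longrightarrow> fst x \<in> hfun p"
  and snd_hgen: "x \<in> hgen r p \<Longrightarrow> snd x \<in> hform1 p"
  by (auto elim: hgen_cases)

lemma snd_hgen_Omega1: "x \<in> hgen r p \<Longrightarrow> snd x \<in> Omega1"
  using snd_hgen hform1_Omega1 by blast

lemma gen_act_simps [simp]: "gen_act f (g, 0) = (f * g, 0)" "gen_act f (0, \<alpha>) = (0, lact f \<alpha>)"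
  "gen_act f 0 = 0"
  by (simp_all add: gen_act_def zero_prod_def)

lemma gen_act_hgen: "f \<in> hfun p \<Longrightarrow> x \<in> hgen r q \<Longrightarrow> gen_act f x \<in> hgen r (p + q)"
  by (cases rule: hgen_cases) (auto simp: hfun_mult lact_hform1)

subsection \<open>Relations between generators\<close>

lemma class_of_add_function:
  assumes "valid_word G (p, f, as)" "valid_word G (p, g, as)"
  shows "class_of (wd (p, f + g, as)) = class_of (wd (p, f, as)) + class_of (wd (p, g, as))"
  using class_of_relation[OF relation_add_function[OF assms]] by (simp add: algebra_simps)

lemma class_of_scale_function:
  assumes "valid_word G (p, f, as)"
  shows "class_of (wd (p, c *\<^sub>R f, as)) = c *\<^sub>R class_of (wd (p, f, as))"
  using class_of_relation[OF relation_scale_function[OF assms]] by simp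

lemma class_of_add_factor:
  assumes "valid_word G (p, f, us @ [(q, \<alpha>)] @ vs)" "valid_word G (p, f, us @ [(q, \<beta>)] @ vs)"
  shows "class_of (wd (p, f, us @ [(q, \<alpha> + \<beta>)] @ vs))
    = class_of (wd (p, f, us @ [(q, \<alpha>)] @ vs)) + class_of (wd (p, f, us @ [(q, \<beta>)] @ vs))"
  using class_of_relation[OF relation_add_factor[OF assms]] by (simp add: algebra_simps)

lemma class_of_scale_factor:
  assumes "valid_word G (p, f, us @ [(q, \<alpha>)] @ vs)"
  shows "class_of (wd (p, f, us @ [(q, c *\<^sub>R \<alpha>)] @ vs))
      = c *\<^sub>R class_of (wd (p, f, us @ [(q, \<alpha>)] @ vs))"
proof -
  have "\<alpha> \<in> Omega1"
    using assms by (simp add: O1par_def)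
  then have scalar: "lact (c *\<^sub>R 1) \<alpha> = c *\<^sub>R \<alpha>"
    by (simp add: lact_scaleR_left lact_one Omega1_AtA)
  have "c *\<^sub>R \<alpha> \<in> O1par G q"
    using assms by (simp add: O1par_def subspace_scale form_parity.subspace_parity Omega1_scaleR)
  then have "class_of (wd (p, f, us @ [(q, c *\<^sub>R \<alpha>)] @ vs))
      = class_of (wd (p, c *\<^sub>R f, us @ [(q, \<alpha>)] @ vs))"
    using class_of_relation[OF relation_move_scalar[of 0 "c *\<^sub>R 1" G p f us q \<alpha> vs]] assms
    by (simp add: scalar Apar_scaleR)
  then show ?thesis
    using class_of_scale_function[OF assms] by simp
qed

lemma incl_eq:
  "incl (f, \<alpha>) = class_of (wd (0, acomp G 0 f, [])) + class_of (wd (1, acomp G 1 f, []))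
    + class_of (wd (0, 1, [(0, tcomp G 0 \<alpha>)])) + class_of (wd (0, 1, [(1, tcomp G 1 \<alpha>)]))"
  by (simp add: incl_def embA_def emb1_def add.assoc)

lemma incl_lincomb:
  assumes "snd x \<in> Omega1" "snd y \<in> Omega1"
  shows "incl (c *\<^sub>R x + y) = c *\<^sub>R incl x + incl y"
proof -
  have function_part: "class_of (wd (p, acomp G p (c *\<^sub>R f + g), []))
      = c *\<^sub>R class_of (wd (p, acomp G p f, [])) + class_of (wd (p, acomp G p g, []))"
        if "p < 2" for p f g
    using that class_of_add_function[of p "c *\<^sub>R acomp G p f" "[]" "acomp G p g"]
      class_of_scale_function[of p "acomp G p f" "[]" c]
    by (simp add: fun_parity.component_lincomb fun_parity.component_mem Apar_scaleR)
  have form_part: "class_of (wd (0, 1, [(q, tcomp G q (c *\<^sub>R \<alpha> + \<beta>))]))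
      = c *\<^sub>R class_of (wd (0, 1, [(q, tcomp G q \<alpha>)])) + class_of (wd (0, 1, [(q, tcomp G q \<beta>)]))"
    if "q < 2" "\<alpha> \<in> Omega1" "\<beta> \<in> Omega1" for q \<alpha> \<beta>
  proof -
    have "tcomp G q \<alpha> \<in> O1par G q" "tcomp G q \<beta> \<in> O1par G q" "c *\<^sub>R tcomp G q \<alpha> \<in> O1par G q"
      using tcomp_hform1[OF that(1)] that(2,3) hform1_scaleR
      by (simp_all add: that(1) flip: hform1_of_nat)
    then show ?thesis
      using that class_of_add_factor[of 0 1 "[]" q "c *\<^sub>R tcomp G q \<alpha>" "[]" "tcomp G q \<beta>"]
        class_of_scale_factor[of 0 1 "[]" q "tcomp G q \<alpha>" "[]" c]
      by (simp add: form_parity.component_lincomb)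
  qed
  obtain f \<alpha> g \<beta> where "x = (f, \<alpha>)" "y = (g, \<beta>)"
    by (cases x, cases y)
  then show ?thesis
    using assms by (simp add: incl_eq function_part form_part) (simp add: algebra_simps)
qed

lemma incl_0 [simp]: "incl 0 = 0"
  using incl_lincomb[of 0 0 "-1"] by simp

lemma incl_add: "snd x \<in> Omega1 \<Longrightarrow> snd y \<in> Omega1 \<Longrightarrow> incl (x + y) = incl x + incl y"
  using incl_lincomb[of x y 1] by simp

lemma incl_scaleR: "snd x \<in> Omega1 \<Longrightarrow> incl (c *\<^sub>R x) = c *\<^sub>R incl x"
  using incl_lincomb[of x 0 c] by simp

lemma incl_minus: "snd x \<in> Omega1 \<Longrightarrow> incl (- x) = - incl x"
  using incl_scaleR[of x "-1"] by simp

lemma class_of_wd_0: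
  "p < 2 \<Longrightarrow> class_of (wd (p, 0, [])) = 0" "q < 2 \<Longrightarrow> class_of (wd (0, 1, [(q, 0)])) = 0"
  using class_of_scale_function[of p 0 "[]" 0] class_of_scale_factor[of 0 1 "[]" q 0 "[]" 0]
    hform1_0[of "int q"] fun_parity.subspace_parity[of p, THEN subspace_0]
  by (simp_all add: hform1_of_nat)

lemma incl_function: "f \<in> hfun p \<Longrightarrow> incl (f, 0) = class_of (wd (tag p, f, []))"
  using tag_less_two[of p] unfolding less_two_iff
  by (auto simp: incl_eq class_of_wd_0 acomp_of_hfun tcomp_of_hform1[of 0 0])

lemma incl_form: "\<alpha> \<in> hform1 q \<Longrightarrow> incl (0, \<alpha>) = class_of (wd (0, 1, [(tag q, \<alpha>)]))"
  using tag_less_two[of q] unfolding less_two_iff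
  by (auto simp: incl_eq class_of_wd_0 tcomp_of_hform1 acomp_of_hfun[of 0 0])

lemma incl_one: "incl (1, 0) = unit_form"
  using incl_function[OF one_hfun] by (simp add: unit_form_def)

lemma incl_function_mult:
  assumes "f \<in> hfun p" "valid_factors G as"
  shows "incl (f, 0) * class_of (wd (0, 1, as)) = class_of (wd (tag p, f, as))"
  using assms class_of_wmul[of "(tag p, f, [])" "(0, 1, as)"]
  by (simp add: wmul_simp incl_function hfun_def)

lemma incl_form_mult:
  assumes "\<alpha> \<in> hform1 q" "valid_word G (p, f, as)"
  shows "incl (0, \<alpha>) * class_of (wd (p, f, as))
      = ((-1) ^ (p * tag q)) *\<^sub>R class_of (wd (p, f, (tag q, \<alpha>) # as))"
  using assms class_of_wmul[of "(0, 1, [(tag q, \<alpha>)])" "(p, f, as)"]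
  by (simp add: wmul_simp incl_form hform1_def)

lemma incl_gen_act:
  assumes f: "f \<in> hfun p" and "x \<in> hgen r q"
  shows "incl (gen_act f x) = incl (f, 0) * incl x"
  using assms(2)
proof (cases rule: hgen_cases)
  case (degree_0 g)
  then show ?thesis
    using class_of_wmul[of "(tag p, f, [])" "(tag q, g, [])"] f
      incl_function[OF hfun_mult[OF f degree_0(2)]]
    by (simp add: wmul_simp incl_function tag_add) (simp add: hfun_def)
next
  case (degree_1 \<alpha>)
  have "incl (0, lact f \<alpha>) = class_of (wd (tag p, f, [(tag q, \<alpha>)]))"
    using class_of_relation[OF relation_move_scalar[of "tag p" f G 0 1 "[]" "tag q" \<alpha> "[]"]]
      f degree_1 lact_hform1[OF f degree_1(2)] incl_form[OF lact_hform1[OF f degree_1(2)]]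
    by (simp add: tag_add) (simp add: hfun_def hform1_def)
  also have "\<dots> = incl (f, 0) * incl (0, \<alpha>)"
    using incl_function_mult[OF f, of "[(tag q, \<alpha>)]"] degree_1 by (simp add: incl_form hform1_def)
  finally show ?thesis
    by (simp add: degree_1)
qed simp

lemma incl_commute_functions:
  assumes "f \<in> hfun p" "g \<in> hfun q"
  shows "incl (f, 0) * incl (g, 0) = sgni (p * q) *\<^sub>R (incl (g, 0) * incl (f, 0))"
  using incl_gen_act[of f p "(g, 0)" 0 q] incl_gen_act[of g q "(f, 0)" 0 p] assms
    hfun_commute[OF assms] incl_scaleR[of "(g * f, 0)"]
  by simp

lemma incl_commute_form_function:
  assumes "\<alpha> \<in> hform1 p" "f \<in> hfun q"
  shows "incl (0, \<alpha>) * incl (f, 0) = sgni (p * q) *\<^sub>R (incl (f, 0) * incl (0, \<alpha>))"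
  using incl_form_mult[of \<alpha> p "tag q" f "[]"] incl_function_mult[of f q "[(tag p, \<alpha>)]"] assms
  by (simp add: incl_function incl_form minus_one_power_tag mult.commute[of p])
    (simp add: hfun_def hform1_def)

lemma incl_commute_forms:
  assumes "\<alpha> \<in> hform1 p" "\<beta> \<in> hform1 q"
  shows "incl (0, \<alpha>) * incl (0, \<beta>) = - (sgni (p * q) *\<^sub>R (incl (0, \<beta>) * incl (0, \<alpha>)))"
  using incl_form_mult[of \<alpha> p 0 1 "[(tag q, \<beta>)]"] incl_form_mult[of \<beta> q 0 1 "[(tag p, \<alpha>)]"] assms
    class_of_relation[OF relation_swap[of G 0 1 "[]" "tag p" \<alpha> "tag q" \<beta> "[]"]]
  by (simp add: incl_form minus_one_power_tag eq_neg_iff_add_eq_0) (simp add: hform1_def)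

lemma incl_commute:
  assumes "x \<in> hgen r p" "y \<in> hgen s q"
  shows "incl x * incl y = sgni (r * s + p * q) *\<^sub>R (incl y * incl x)"
  using assms(1)
proof (cases rule: hgen_cases)
  case x: (degree_0 f)
  from assms(2) show ?thesis
  proof (cases rule: hgen_cases)
    case (degree_0 g)
    then show ?thesis
      using incl_commute_functions[OF x(2) degree_0(2)] by (simp add: x)
  next
    case (degree_1 \<beta>)
    then show ?thesis
      using incl_commute_form_function[OF degree_1(2) x(2)] by (simp add: x mult.commute[of p])
  qed simp
next
  case x: (degree_1 \<alpha>)
  from assms(2) show ?thesis
  proof (cases rule: hgen_cases)
    case (degree_0 g)
    then show ?thesis
      using incl_commute_form_function[OF x(2) degree_0(2)] by (simp add: x)
  next
    case (degree_1 \<beta>)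
    then show ?thesis
      using incl_commute_forms[OF x(2) degree_1(2)] by (simp add: x sgni_add)
  qed simp
qed simp

lemma incl_hform:
  assumes "x \<in> hgen r p"
  shows "incl x \<in> hform r p"
  using assms
proof (cases rule: hgen_cases)
  case (degree_0 f)
  then show ?thesis
    using class_of_wd_hform[of "(tag p, f, [])" 0 p] incl_function[of f p]
    by (simp add: hom_words_iff hfun_def int_tag)
next
  case (degree_1 \<alpha>)
  then show ?thesis
    using class_of_wd_hform[of "(0, 1, [(tag p, \<alpha>)])" 1 p] incl_form[of \<alpha> p]
    by (simp add: hom_words_iff hform1_def int_tag)
qed simp

lemma incl_forms: "snd x \<in> Omega1 \<Longrightarrow> incl x \<in> forms"
  unfolding incl_def embA_def emb1_def
  by (intro class_of_forms Om_add wd_Om)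
    (use tcomp_hform1[of 0 "snd x"]
      tcomp_hform1[of 1 "snd x"] in \<open>auto simp: fun_parity.component_mem hform1_def\<close>)

lemma hform_induct [consumes 1, case_names subspace generator mult]:
  assumes "X \<in> hform r p" and "\<And>r p. subspace {X. P r p X}"
    and generator: "\<And>r p x. x \<in> hgen r p \<Longrightarrow> P r p (incl x)"
    and mult: "\<And>r p s q x X. x \<in> hgen r p \<Longrightarrow> X \<in> hform s q \<Longrightarrow> P s q X \<Longrightarrow> P (r + s) (p + q) (incl x * X)"
  shows "P r p X"
proof (rule span_induct[of X _ "P r p", OF assms(1)[unfolded hform_eq_span] assms(2)])
  have factors: "P (int (length as)) p (class_of (wd (0, 1, as)))"
    if "valid_factors G as" "even (int (tag_sum as) - p)" for as p
    using that
  proof (induction as arbitrary: p)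
    case Nil
    then have "(1, 0) \<in> hgen 0 p"
      using hfun_cong[of p 0] by simp
    from generator[OF this] show ?case
      by (simp add: incl_one unit_form_def)
  next
    case (Cons a as)
    obtain q \<alpha> where a: "a = (q, \<alpha>)" "q < 2" and \<alpha>: "\<alpha> \<in> hform1 (int q)"
      using Cons.prems(1) by (cases a) (auto simp: hform1_of_nat)
    have as: "valid_factors G as" "even (int (tag_sum as) - (p - int q))"
      using Cons.prems by (auto simp: a)
    then have "class_of (wd (0, 1, as)) \<in> hform (int (length as)) (p - int q)"
      by (intro class_of_wd_hform) (simp add: hom_words_iff)
    from mult[of "(0, \<alpha>)" 1 "int q", OF _ this Cons.IH[OF as]] show ?case
      using incl_form_mult[OF \<alpha>, of 0 1 as] as(1) \<alpha> by (simp add: a tag_of_nat add.commute)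
  qed
  fix Y assume "Y \<in> (\<lambda>w. class_of (wd w)) ` hom_words r p"
  then obtain d f as where Y: "Y = class_of (wd (d, f, as))" and w: "(d, f, as) \<in> hom_words r p"
    by auto
  then have d: "d < 2" and f: "f \<in> hfun (int d)"
    and as: "valid_factors G as" "even (int (tag_sum as) - (p - int d))"
    and r: "r = int (length as)"
    by (auto simp: hom_words_iff hfun_of_nat)
  have "class_of (wd (0, 1, as)) \<in> hform r (p - int d)"
    using as by (intro class_of_wd_hform) (simp add: hom_words_iff r)
  from mult[of "(f, 0)" 0 "int d", OF _ this] show "P r p Y"
    using factors[OF as] incl_function_mult[OF f as(1)] f d by (simp add: Y r tag_of_nat)
qed

lemma forms_generator_induct [consumes 1, case_names subspace generator mult]:
  assumes "X \<in> forms" and subspace: "subspace {X. P X}"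
    and generator: "\<And>r p x. x \<in> hgen r p \<Longrightarrow> P (incl x)"
    and mult: "\<And>r p x X. x \<in> hgen r p \<Longrightarrow> X \<in> forms \<Longrightarrow> P X \<Longrightarrow> P (incl x * X)"
  shows "P X"
  using assms(1)
proof (induction rule: forms_induct)
  case (homogeneous r p X)
  then show ?case
    by (induction rule: hform_induct) (auto intro: subspace generator mult hform_forms)
qed (rule subspace)

lemma hform_mult:
  assumes "X \<in> hform r p" "Y \<in> hform s q"
  shows "X * Y \<in> hform (r + s) (p + q)"
  using assms[unfolded hform_eq_span]
proof (induction rule: span_induct2)
  case (base X Y)
  then obtain d f as d' g bs where X: "X = class_of (wd (d, f, as))" "(d, f, as) \<in> hom_words r p"
    and Y: "Y = class_of (wd (d', g, bs))" "(d', g, bs) \<in> hom_words s q"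
    by auto
  then have "((d + d') mod 2, f * g, as @ bs) \<in> hom_words (r + s) (p + q)"
    by (auto simp: hom_words_iff Apar_mult of_nat_mod)
  moreover have "X * Y = class_of (wmul (d, f, as) (d', g, bs))"
    using X Y by (subst class_of_wmul) (auto simp: hom_words_iff)
  ultimately show ?case
    by (simp add: wmul_simp hform_scaleR class_of_wd_hform)
qed (auto intro!: subspace_linear_mem subspace_hform linearI simp: distrib_left distrib_right)

lemma incl_hform_commute:
  assumes x: "x \<in> hgen r p" and "X \<in> hform s q"
  shows "incl x * X = sgni (r * s + p * q) *\<^sub>R (X * incl x)"
  using assms(2)
proof (induction rule: hform_induct)
  case (subspace s q)
  show ?case
    by (intro subspace_linear_eq linearI) (simp_all add: algebra_simps)
next
  case (generator s q y)
  then show ?case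
    by (rule incl_commute[OF x])
next
  case (mult s q s' q' y Y)
  have "incl x * (incl y * Y) = sgni (r * s + p * q) *\<^sub>R (incl y * (incl x * Y))"
    using incl_commute[OF x mult(1)] by (simp flip: mult.assoc)
  then show ?case
    using mult(3) by (simp add: algebra_simps sgni_add)
qed

lemma hform_commute:
  assumes "X \<in> hform r p" and Y: "Y \<in> hform s q"
  shows "X * Y = sgni (r * s + p * q) *\<^sub>R (Y * X)"
  using assms(1)
proof (induction rule: hform_induct)
  case (subspace r p)
  show ?case
    by (intro subspace_linear_eq linearI) (simp_all add: algebra_simps)
next
  case (generator r p x)
  then show ?case
    using Y by (rule incl_hform_commute)
next
  case (mult r p r' p' x X)
  have "incl x * X * Y = sgni (r' * s + p' * q) *\<^sub>R (incl x * Y * X)"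
    using mult(3) by (simp add: mult.assoc)
  also have "incl x * Y = sgni (r * s + p * q) *\<^sub>R (Y * incl x)"
    using mult(1) Y by (rule incl_hform_commute)
  finally show ?case
    by (simp add: algebra_simps sgni_add)
qed

end

subsection \<open>Actions prescribed on generators\<close>

locale generator_action = supercommutative_algebra G for G :: "int \<Rightarrow> 'a::real_algebra_1 set" +
  fixes P :: "int \<Rightarrow> int \<Rightarrow> 'a \<times> 'a tens \<Rightarrow> 'v::real_vector \<Rightarrow> 'v"
  assumes P_linear: "\<And>r p x. x \<in> hgen r p \<Longrightarrow> linear (P r p x)"
    and P_lincomb: "\<And>r p c x y v. x \<in> hgen r p \<Longrightarrow> y \<in> hgen r p \<Longrightarrow>
      P r p (c *\<^sub>R x + y) v = c *\<^sub>R P r p x v + P r p y v"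
    and P_cong: "\<And>r p q x v. even (p - q) \<Longrightarrow> x \<in> hgen r p \<Longrightarrow> P r p x v = P r q x v"
    and P_gen_act: "\<And>p f r q x v. f \<in> hfun p \<Longrightarrow> x \<in> hgen r q \<Longrightarrow>
      P r (p + q) (gen_act f x) v = P 0 p (f, 0) (P r q x v)"
    and P_commute: "\<And>r p x s q y v. x \<in> hgen r p \<Longrightarrow> y \<in> hgen s q \<Longrightarrow>
      P r p x (P s q y v) = sgni (r * s + p * q) *\<^sub>R P s q y (P r p x v)"
begin

definition factors_action :: "(nat \<times> 'a tens) list \<Rightarrow> 'v \<Rightarrow> 'v" where
  "factors_action as = foldr (\<lambda>(q, \<alpha>). P 1 (int q) (0, \<alpha>)) as"

definition word_action :: "'v \<Rightarrow> 'a word \<Rightarrow> 'v" where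
  "word_action v w = (case w of (p, f, as) \<Rightarrow> P 0 (int p) (f, 0) (factors_action as v))"

definition action :: "'a superform \<Rightarrow> 'v \<Rightarrow> 'v" where
  "action X v = linext (word_action v) (representative X)"

lemma factors_action_simps [simp]:
  "factors_action [] v = v"
  "factors_action ((q, \<alpha>) # as) v = P 1 (int q) (0, \<alpha>) (factors_action as v)"
  "factors_action (as @ bs) v = factors_action as (factors_action bs v)"
  by (simp_all add: factors_action_def)

lemma word_action_simp [simp]: "word_action v (p, f, as) = P 0 (int p) (f, 0) (factors_action as v)"
  by (simp add: word_action_def)

lemma linear_factors_action: "valid_factors G as \<Longrightarrow> linear (factors_action as)"
proof (induction as)
  case Nil
  show ?case
    by (simp add: linear_iff)
next
  case (Cons a as)
  obtain q \<alpha> where a: "a = (q, \<alpha>)"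
    by force
  have "linear (P 1 (int q) (0, \<alpha>) \<circ> factors_action as)"
    using Cons by (intro linear_compose P_linear) (auto simp: a hform1_of_nat)
  then show ?case
    by (simp add: a linear_iff)
qed

lemma function_factors_commute:
  assumes f: "f \<in> hfun p" and "valid_factors G as"
  shows "factors_action as (P 0 p (f, 0) v)
      = sgni (p * int (tag_sum as)) *\<^sub>R P 0 p (f, 0) (factors_action as v)"
  using assms(2)
proof (induction as)
  case (Cons a as)
  obtain q \<alpha> where a: "a = (q, \<alpha>)" and \<alpha>: "(0, \<alpha>) \<in> hgen 1 (int q)"
    using Cons.prems by (cases a) (auto simp: hform1_of_nat)
  have f': "(f, 0) \<in> hgen 0 p"
    using f by simp
  have "factors_action (a # as) (P 0 p (f, 0) v)
    = sgni (p * int (tag_sum as)) *\<^sub>R P 1 (int q) (0, \<alpha>) (P 0 p (f, 0) (factors_action as v))"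
    using Cons by (simp add: a linear_scale[OF P_linear[OF \<alpha>]])
  also have "P 1 (int q) (0, \<alpha>) (P 0 p (f, 0) (factors_action as v))
    = sgni (p * int q) *\<^sub>R P 0 p (f, 0) (P 1 (int q) (0, \<alpha>) (factors_action as v))"
    using P_commute[OF \<alpha> f'] by (simp add: mult.commute)
  finally show ?case
    by (simp add: a distrib_left sgni_add mult.commute)
qed simp

lemma word_action_Relators:
  assumes "x \<in> Relators G"
  shows "linext (word_action v) x = 0"
  using assms
proof (cases rule: Relators_cases)
  case (add_function p f g as)
  then show ?thesis
    using P_lincomb[of "(f, 0)" 0 "int p" "(g, 0)" 1] by (simp add: hfun_of_nat)
next
  case (scale_function p c f as)
  have "(0, 0) \<in> hgen 0 (int p)"
    by simp
  then show ?thesis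
    using scale_function P_lincomb[of "(f, 0)" 0 "int p" 0 c] P_lincomb[of 0 0 "int p" 0 "-1"]
    by (simp add: hfun_of_nat)
next
  case (add_factor p f us q \<alpha> \<beta> vs)
  then have "linear (P 0 (int p) (f, 0) \<circ> factors_action us)"
    by (intro linear_compose P_linear linear_factors_action) (auto simp: hfun_of_nat)
  from linear_add[OF this] show ?thesis
    using add_factor P_lincomb[of "(0, \<alpha>)" 1 "int q" "(0, \<beta>)" 1] by (simp add: hform1_of_nat)
next
  case (move_scalar p f us q' g q \<alpha> vs)
  let ?v = "P 1 (int q) (0, \<alpha>) (factors_action vs v)"
  have f: "f \<in> hfun (int p)" and g: "g \<in> hfun (int q')" and \<alpha>: "(0, \<alpha>) \<in> hgen 1 (int q)"
    and us: "valid_factors G us"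
    using move_scalar by (simp_all add: hfun_of_nat hform1_of_nat)
  have "P 1 (int ((q' + q) mod 2)) (0, lact g \<alpha>) w = P 0 (int q') (g, 0) (P 1 (int q) (0, \<alpha>) w)" for w
    using P_cong[of "int q' + int q" "int ((q' + q) mod 2)"] P_gen_act[OF g \<alpha>] gen_act_hgen[OF g \<alpha>]
    by (simp add: of_nat_mod)
  moreover have "P 0 (int ((p + q') mod 2)) (f * g, 0) w = P 0 (int p) (f, 0) (P 0 (int q') (g, 0) w)"
    for w
    using P_cong[of "int p + int q'" "int ((p + q') mod 2)"] P_gen_act[OF f, of "(g, 0)" 0 "int q'"] g
      hfun_mult[OF f g] by (simp add: of_nat_mod)
  ultimately show ?thesis
    using f linear_scale[OF P_linear[of "(f, 0)" 0 "int p"]]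
    by (simp add: move_scalar(1) function_factors_commute[OF g us] minus_one_power_eq_sgni)
next
  case (swap p f us q1 \<alpha>1 q2 \<alpha>2 vs)
  let ?v = "\<lambda>q1 \<alpha>1 q2 \<alpha>2. P 1 (int q1) (0, \<alpha>1) (P 1 (int q2) (0, \<alpha>2) (factors_action vs v))"
  have "linear (P 0 (int p) (f, 0) \<circ> factors_action us)"
    using swap by (intro linear_compose P_linear linear_factors_action) (auto simp: hfun_of_nat)
  from linear_scale[OF this, of "- sgni (int q1 * int q2)" "?v q2 \<alpha>2 q1 \<alpha>1"] show ?thesis
    using swap P_commute[of "(0, \<alpha>1)" 1 "int q1" "(0, \<alpha>2)" 1 "int q2" "factors_action vs v"]
    by (simp add: hform1_of_nat minus_one_power_eq_sgni sgni_add)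
qed

lemma word_action_relations: "x \<in> relations G \<Longrightarrow> linext (word_action v) x = 0"
  using linear_eq_on[OF linear_linext linear_zero] word_action_Relators
  unfolding relations_def by blast

lemma word_action_wmul:
  assumes "valid_word G u" "valid_word G w"
  shows "linext (word_action v) (wmul u w) = word_action (word_action v w) u"
proof -
  obtain p f as q g bs where uw: "u = (p, f, as)" "w = (q, g, bs)"
    by (cases u, cases w)
  have f: "f \<in> hfun (int p)" and g: "g \<in> hfun (int q)" and as: "valid_factors G as"
    using assms by (simp_all add: uw hfun_of_nat)
  have "P 0 (int ((p + q) mod 2)) (f * g, 0) v = P 0 (int p) (f, 0) (P 0 (int q) (g, 0) v)" for v
    using P_cong[of "int p + int q" "int ((p + q) mod 2)"] P_gen_act[OF f, of "(g, 0)" 0 "int q"] g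
      hfun_mult[OF f g] by (simp add: of_nat_mod)
  then show ?thesis
    using f linear_scale[OF P_linear[of "(f, 0)" 0 "int p"]]
    by (simp add: uw wmul_simp function_factors_commute[OF g as] minus_one_power_eq_sgni)
qed

lemma linear_word_action: "valid_word G w \<Longrightarrow> linear (\<lambda>v. word_action v w)"
  using linear_compose[OF linear_factors_action P_linear] by (cases w) (auto simp: o_def hfun_of_nat)

lemma linear_word_action_right:
  assumes "x \<in> Om G"
  shows "linear (\<lambda>v. linext (word_action v) x)"
  using assms unfolding Om_def
proof (induction rule: span_induct_alt)
  case (step c b x)
  then obtain w where "b = wd w" "valid_word G w"
    by blast
  then show ?case
    using step.IH linear_word_action[of w]
    by (simp add: linear_compose_add linear_compose_scale_right)
qed (simp add: linear_zero)

lemma action_class_of: "x \<in> Om G \<Longrightarrow> action (class_of x) v = linext (word_action v) x"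
  using word_action_relations[OF representative_class_of] by (simp add: action_def)

lemma linear_action_left: "linear (\<lambda>X. action X v)"
  using linear_compose[OF linear_representative linear_linext] by (simp add: action_def o_def)

lemma action_mult:
  assumes "X \<in> forms" "Y \<in> forms"
  shows "action (X * Y) v = action X (action Y v)"
proof -
  obtain x y where x: "x \<in> Om G" "X = class_of x" and y: "y \<in> Om G" "Y = class_of y"
    using assms by (auto simp: forms_def)
  have "linext (word_action v) (form_mult x y) = linext (word_action (linext (word_action v) y)) x"
    using x(1)[unfolded Om_def] y(1)[unfolded Om_def]
  proof (induction rule: span_induct2)
    case (base x y)
    then show ?case
      using word_action_wmul by (auto simp del: valid_word_simp)
  next
    case (subspace_left y)
    show ?case
      using linear_compose[OF linear_form_mult_left linear_linext]
      by (intro subspace_linear_eq) (simp_all add: o_def linear_linext)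
  next
    case (subspace_right x)
    have "linear (\<lambda>v. linext (word_action v) x)"
      using subspace_right by (intro linear_word_action_right) (simp add: Om_def)
    from linear_compose[OF linear_linext this] show ?case
      using linear_compose[OF linear_form_mult_right linear_linext]
      by (intro subspace_linear_eq) (simp_all add: o_def)
  qed
  then show ?thesis
    using x y by (simp add: action_class_of form_mult_Om flip: class_of_form_mult)
qed

lemma action_incl:
  assumes "x \<in> hgen r p"
  shows "action (incl x) v = P r p x v"
  using assms
proof (cases rule: hgen_cases)
  case (degree_0 f)
  then have "incl x = class_of (wd (tag p, f, []))" "valid_word G (tag p, f, [])"
    by (simp_all add: incl_function) (simp add: hfun_def)
  then show ?thesis
    using P_cong[of p "int (tag p)" "(f, 0)" 0] degree_0 by (simp add: action_class_of wd_Om int_tag)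
next
  case (degree_1 \<alpha>)
  then have "incl x = class_of (wd (0, 1, [(tag p, \<alpha>)]))" "valid_word G (0, 1, [(tag p, \<alpha>)])"
    by (simp_all add: incl_form) (simp add: hform1_def)
  moreover have "P 0 0 (1, 0) (P 1 p (0, \<alpha>) v) = P 1 p (0, \<alpha>) v"
    using P_gen_act[OF one_hfun, of "(0, \<alpha>)" 1 p] degree_1 hform1_Omega1
    by (simp add: lact_one Omega1_AtA)
  ultimately show ?thesis
    using P_cong[of p "int (tag p)" "(0, \<alpha>)" 1] degree_1 by (simp add: action_class_of wd_Om int_tag)
next
  case zero
  then show ?thesis
    using linear_0[OF linear_action_left] P_lincomb[of 0 r p 0 "-1" v] by simp
qed

end

subsection \<open>Derivations of superforms\<close>

context supercommutative_algebra
begin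

definition derivation :: "int \<Rightarrow> int \<Rightarrow> ('a superform \<Rightarrow> 'a superform) \<Rightarrow> bool" where
  "derivation k d D \<longleftrightarrow> linear D \<and> (\<forall>r p X. X \<in> hform r p \<longrightarrow> D X \<in> hform (r + k) (p + d)) \<and>
    (\<forall>r p X Y. X \<in> hform r p \<longrightarrow> Y \<in> forms \<longrightarrow> D (X * Y) = D X * Y + sgni (k * r + d * p) *\<^sub>R (X * D Y))"

lemma derivationI:
  assumes "linear D" "\<And>r p X. X \<in> hform r p \<Longrightarrow> D X \<in> hform (r + k) (p + d)"
    and "\<And>r p X Y. X \<in> hform r p \<Longrightarrow> Y \<in> forms \<Longrightarrow>
        D (X * Y) = D X * Y + sgni (k * r + d * p) *\<^sub>R (X * D Y)"
  shows "derivation k d D"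
  using assms by (simp add: derivation_def)

lemma derivationD:
  assumes "derivation k d D"
  shows derivation_linear: "linear D"
    and derivation_hform: "X \<in> hform r p \<Longrightarrow> D X \<in> hform (r + k) (p + d)"
    and derivation_mult: "X \<in> hform r p \<Longrightarrow> Y \<in> forms \<Longrightarrow>
        D (X * Y) = D X * Y + sgni (k * r + d * p) *\<^sub>R (X * D Y)"
  using assms by (auto simp: derivation_def)

lemma derivation_forms:
  assumes "derivation k d D" "X \<in> forms"
  shows "D X \<in> forms"
  using assms(2)
proof (induction rule: forms_induct)
  case subspace
  show ?case
    by (rule subspace_linear_mem[OF derivation_linear[OF assms(1)] subspace_forms])
qed (rule hform_forms[OF derivation_hform[OF assms(1)]])

lemma derivation_cong:
  assumes "derivation k d D" "k = k'" "even (d - d')"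
  shows "derivation k' d' D"
proof -
  have "hform (r + k) (p + d) = hform (r + k) (p + d')" "sgni (k * r + d * p) = sgni (k * r + d' * p)"
    for r p
    using assms(3) by (auto intro!: hform_cong sgni_cong simp flip: left_diff_distrib)
  then show ?thesis
    using assms by (simp add: derivation_def)
qed

lemma derivation_eqI:
  assumes D: "derivation k d D" and E: "derivation k d E"
    and generators: "\<And>r p x. x \<in> hgen r p \<Longrightarrow> D (incl x) = E (incl x)" and "X \<in> forms"
  shows "D X = E X"
  using assms(4)
proof (induction rule: forms_generator_induct)
  case subspace
  show ?case
    by (intro subspace_linear_eq derivation_linear[OF D] derivation_linear[OF E])
next
  case (mult r p x X)
  then show ?case
    by (simp add: derivation_mult[OF D incl_hform] derivation_mult[OF E incl_hform] generators)
qed (rule generators)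

lemma derivation_lincomb:
  assumes D: "derivation k d D" and E: "derivation k d E"
  shows "derivation k d (\<lambda>X. c *\<^sub>R D X + E X)"
  by (intro derivationI linear_compose_add linear_compose_scale_right derivation_linear[OF D]
      derivation_linear[OF E] hform_add hform_scaleR derivation_hform[OF D] derivation_hform[OF E])
    (simp_all add: derivation_mult[OF D] derivation_mult[OF E] algebra_simps)

lemma derivation_left_mult:
  assumes D: "derivation k d D" and Z: "Z \<in> hform s q"
  shows "derivation (k + s) (d + q) (\<lambda>X. Z * D X)"
proof (rule derivationI)
  show "linear (\<lambda>X. Z * D X)"
    using derivation_linear[OF D]
    by (intro linearI) (simp_all add: linear_add linear_scale distrib_left)
  fix r p X assume X: "X \<in> hform r p"
  show "Z * D X \<in> hform (r + (k + s)) (p + (d + q))"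
    using hform_mult[OF Z derivation_hform[OF D X]] by (simp add: add_ac)
  fix Y assume "Y \<in> forms"
  then have "Z * D (X * Y) = Z * D X * Y + sgni (k * r + d * p) *\<^sub>R (Z * X * D Y)"
    by (simp add: derivation_mult[OF D X] distrib_left mult.assoc)
  also have "Z * X = sgni (s * r + q * p) *\<^sub>R (X * Z)"
    by (rule hform_commute[OF Z X])
  finally show "Z * D (X * Y) = Z * D X * Y + sgni ((k + s) * r + (d + q) * p) *\<^sub>R (X * (Z * D Y))"
    by (simp add: mult.assoc algebra_simps sgni_add)
qed

lemma derivation_commutator:
  assumes D: "derivation k d D" and E: "derivation l e E"
  shows "derivation (k + l) (d + e) (\<lambda>X. D (E X) - sgni (k * l + d * e) *\<^sub>R E (D X))"
proof (rule derivationI)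
  note linear = derivation_linear[OF D] derivation_linear[OF E]
  show "linear (\<lambda>X. D (E X) - sgni (k * l + d * e) *\<^sub>R E (D X))"
    using linear by (intro linearI) (simp_all add: linear_add linear_scale algebra_simps)
  fix r p X assume X: "X \<in> hform r p"
  have "D (E X) \<in> hform (r + (k + l)) (p + (d + e))" "E (D X) \<in> hform (r + (k + l)) (p + (d + e))"
    using derivation_hform[OF D derivation_hform[OF E X]]
      derivation_hform[OF E derivation_hform[OF D X]]
    by (simp_all add: add_ac)
  then show "D (E X) - sgni (k * l + d * e) *\<^sub>R E (D X) \<in> hform (r + (k + l)) (p + (d + e))"
    by (intro hform_diff hform_scaleR)
  fix Y assume Y: "Y \<in> forms"
  have DE: "D (E (X * Y)) = D (E X) * Y + sgni (k * (r + l) + d * (p + e)) *\<^sub>R (E X * D Y)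
      + sgni (l * r + e * p) *\<^sub>R (D X * E Y + sgni (k * r + d * p) *\<^sub>R (X * D (E Y)))"
    using linear by (simp add: linear_add linear_scale derivation_mult[OF E X Y]
        derivation_mult[OF D derivation_hform[OF E X] Y]
        derivation_mult[OF D X derivation_forms[OF E Y]])
  have ED: "E (D (X * Y)) = E (D X) * Y + sgni (l * (r + k) + e * (p + d)) *\<^sub>R (D X * E Y)
      + sgni (k * r + d * p) *\<^sub>R (E X * D Y + sgni (l * r + e * p) *\<^sub>R (X * E (D Y)))"
    using linear by (simp add: linear_add linear_scale derivation_mult[OF D X Y]
        derivation_mult[OF E derivation_hform[OF D X] Y]
        derivation_mult[OF E X derivation_forms[OF D Y]])
  show "D (E (X * Y)) - sgni (k * l + d * e) *\<^sub>R E (D (X * Y))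
    = (D (E X) - sgni (k * l + d * e) *\<^sub>R E (D X)) * Y
      + sgni ((k + l) * r + (d + e) * p) *\<^sub>R (X * (D (E Y) - sgni (k * l + d * e) *\<^sub>R E (D Y)))"
    unfolding DE ED by (simp add: algebra_simps sgni_add)
qed

end

locale derivation_on_generators = supercommutative_algebra G for G :: "int \<Rightarrow> 'a::real_algebra_1 set" +
  fixes k d :: int and D :: "int \<Rightarrow> int \<Rightarrow> 'a \<times> 'a tens \<Rightarrow> 'a superform"
  assumes D_lincomb: "\<And>r p c x y. x \<in> hgen r p \<Longrightarrow> y \<in> hgen r p \<Longrightarrow>
      D r p (c *\<^sub>R x + y) = c *\<^sub>R D r p x + D r p y"
    and D_cong: "\<And>r p q x. even (p - q) \<Longrightarrow> x \<in> hgen r p \<Longrightarrow> D r p x = D r q x"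
    and D_hform: "\<And>r p x. x \<in> hgen r p \<Longrightarrow> D r p x \<in> hform (r + k) (p + d)"
    and D_gen_act: "\<And>p f r q x. f \<in> hfun p \<Longrightarrow> x \<in> hgen r q \<Longrightarrow>
      D r (p + q) (gen_act f x) = D 0 p (f, 0) * incl x + sgni (d * p) *\<^sub>R (incl (f, 0) * D r q x)"
begin

text \<open>The operator of \<open>x\<close> takes \<open>(X, D X)\<close> to \<open>(x * X, D (x * X))\<close>.\<close>

definition dual_action :: "int \<Rightarrow> int \<Rightarrow> 'a \<times> 'a tens \<Rightarrow>
    'a superform \<times> 'a superform \<Rightarrow> 'a superform \<times> 'a superform" where
  "dual_action r p x v = (incl x * fst v, D r p x * fst v
      + sgni (k * r + d * p) *\<^sub>R (incl x * snd v))"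

lemma dual_action_simps [simp]:
  "fst (dual_action r p x v) = incl x * fst v"
  "snd (dual_action r p x v) = D r p x * fst v + sgni (k * r + d * p) *\<^sub>R (incl x * snd v)"
  by (simp_all add: dual_action_def)

lemma dual_action_commute:
  assumes x: "x \<in> hgen r p" and y: "y \<in> hgen s q"
  shows "dual_action r p x (dual_action s q y v)
      = sgni (r * s + p * q) *\<^sub>R dual_action s q y (dual_action r p x v)"
proof -
  have "D r p x * incl y = (sgni (r * s + p * q) * sgni (k * s + d * q)) *\<^sub>R (incl y * D r p x)"
    using hform_commute[OF D_hform[OF x] incl_hform[OF y]] by (simp add: algebra_simps sgni_add)
  moreover have "incl x * D s q y
      = (sgni (r * s + p * q) * sgni (k * r + d * p)) *\<^sub>R (D s q y * incl x)"
    using hform_commute[OF incl_hform[OF x] D_hform[OF y]] by (simp add: algebra_simps sgni_add)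
  ultimately show ?thesis
    using incl_commute[OF x y]
    by (simp add: prod_eq_iff distrib_left scaleR_add_right flip: mult.assoc)
      (simp add: algebra_simps)
qed

sublocale generator_action G dual_action
proof
  show "dual_action r p x (v + w) = dual_action r p x v + dual_action r p x w"
    "dual_action r p x (c *\<^sub>R v) = c *\<^sub>R dual_action r p x v" for r p x v w c
    by (simp_all add: prod_eq_iff algebra_simps)
  show "dual_action r p (c *\<^sub>R x + y) v = c *\<^sub>R dual_action r p x v + dual_action r p y v"
    if "x \<in> hgen r p" "y \<in> hgen r p" for r p c x y v
    using that by (simp add: prod_eq_iff D_lincomb incl_lincomb snd_hgen_Omega1)
      (simp add: algebra_simps)
  show "dual_action r p x v = dual_action r q x v" if "even (p - q)" "x \<in> hgen r p" for r p q x v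
  proof -
    have "sgni (k * r + d * p) = sgni (k * r + d * q)"
      using that(1) by (intro sgni_cong) (simp flip: right_diff_distrib)
    then show ?thesis
      using D_cong[OF that] by (simp add: prod_eq_iff)
  qed
  show "dual_action r (p + q) (gen_act f x) v = dual_action 0 p (f, 0) (dual_action r q x v)"
    if "f \<in> hfun p" "x \<in> hgen r q" for p f r q x v
    using D_gen_act[OF that] incl_gen_act[OF that]
    by (simp add: prod_eq_iff algebra_simps sgni_add)
qed (rule dual_action_commute)

definition extension :: "'a superform \<Rightarrow> 'a superform" where
  "extension X = snd (action X (unit_form, 0))"

lemma linear_extension: "linear extension"
  unfolding extension_def using linear_compose[OF linear_action_left linear_snd] by (simp add: o_def)

lemma extension_incl: "x \<in> hgen r p \<Longrightarrow> extension (incl x) = D r p x"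
  using hform_forms[OF D_hform] by (simp add: extension_def action_incl)

lemma fst_action:
  assumes "X \<in> forms"
  shows "fst (action X v) = X * fst v"
  using assms
proof (induction rule: forms_generator_induct)
  case subspace
  show ?case
    using linear_compose[OF linear_action_left linear_fst, of v]
    by (intro subspace_linear_eq) (simp_all add: o_def linear_iff distrib_right)
next
  case (mult r p x X)
  then show ?case
    using incl_hform[THEN hform_forms, OF mult(1)]
    by (simp add: action_mult action_incl mult.assoc)
qed (simp add: action_incl)

lemma extension_generator_mult:
  assumes "x \<in> hgen r p" "X \<in> forms"
  shows "extension (incl x * X) = D r p x * X + sgni (k * r + d * p) *\<^sub>R (incl x * extension X)"
  using assms incl_hform[THEN hform_forms, OF assms(1)]
  by (simp add: extension_def action_mult action_incl fst_action)

lemma extension_hform: "X \<in> hform r p \<Longrightarrow> extension X \<in> hform (r + k) (p + d)"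
proof (induction rule: hform_induct)
  case (subspace r p)
  show ?case
    by (rule subspace_linear_mem[OF linear_extension subspace_hform])
next
  case (generator r p x)
  then show ?case
    by (simp add: extension_incl D_hform)
next
  case (mult r p s q x X)
  then show ?case
    using hform_mult[OF D_hform[OF mult(1)] mult(2)] hform_mult[OF incl_hform[OF mult(1)] mult(3)]
    by (simp add: extension_generator_mult hform_forms hform_add hform_scaleR algebra_simps)
qed

lemma extension_mult:
  assumes "X \<in> hform r p" and Y: "Y \<in> forms"
  shows "extension (X * Y) = extension X * Y + sgni (k * r + d * p) *\<^sub>R (X * extension Y)"
  using assms(1)
proof (induction rule: hform_induct)
  case (subspace r p)
  show ?case
    by (intro subspace_linear_eq linearI)
      (simp_all add: algebra_simps linear_add[OF linear_extension] linear_scale[OF linear_extension])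
next
  case (generator r p x)
  then show ?case
    by (simp add: extension_generator_mult extension_incl Y)
next
  case (mult r p s q x X)
  note X = hform_forms[OF mult(2)]
  show ?case
    using mult(3) by (simp add: mult.assoc extension_generator_mult[OF mult(1)] X Y forms_mult)
      (simp add: algebra_simps sgni_add)
qed

theorem derivation_extension: "derivation k d extension"
  by (intro derivationI linear_extension extension_hform extension_mult)

end

subsection \<open>Gerstenhaber brackets on classes of representatives\<close>

locale gerstenhaber_forms = supercommutative_algebra G for G :: "int \<Rightarrow> 'a::real_algebra_1 set" +
  fixes C :: "'a superform \<Rightarrow> 'a superform \<Rightarrow> 'a superform"
  assumes C_forms: "\<And>X Y. X \<in> forms \<Longrightarrow> Y \<in> forms \<Longrightarrow> C X Y \<in> forms"
    and C_lincomb_left: "\<And>c X X' Y. X \<in> forms \<Longrightarrow> X' \<in> forms \<Longrightarrow> Y \<in> forms \<Longrightarrow>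
      C (c *\<^sub>R X + X') Y = c *\<^sub>R C X Y + C X' Y"
    and C_lincomb_right: "\<And>c X Y Y'. X \<in> forms \<Longrightarrow> Y \<in> forms \<Longrightarrow> Y' \<in> forms \<Longrightarrow>
      C X (c *\<^sub>R Y + Y') = c *\<^sub>R C X Y + C X Y'"
    and C_hform: "\<And>r p s q X Y. X \<in> hform r p \<Longrightarrow> Y \<in> hform s q \<Longrightarrow> C X Y \<in> hform (r + s - 1) (p + q)"
    and C_antisym: "\<And>r p s q X Y. X \<in> hform r p \<Longrightarrow> Y \<in> hform s q \<Longrightarrow>
      C X Y = - (sgni ((r - 1) * (s - 1) + p * q) *\<^sub>R C Y X)"
    and C_jacobi: "\<And>r p s q t u X Y Z. X \<in> hform r p \<Longrightarrow> Y \<in> hform s q \<Longrightarrow> Z \<in> hform t u \<Longrightarrow>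
      C X (C Y Z) = C (C X Y) Z + sgni ((r - 1) * (s - 1) + p * q) *\<^sub>R C Y (C X Z)"
    and C_leibniz: "\<And>r p s q t u X Y Z. X \<in> hform r p \<Longrightarrow> Y \<in> hform s q \<Longrightarrow> Z \<in> hform t u \<Longrightarrow>
      C X (Y * Z) = C X Y * Z + sgni ((r - 1) * s + p * q) *\<^sub>R (Y * C X Z)"
begin

definition representative_bracket :: "'a form \<Rightarrow> 'a form \<Rightarrow> 'a form" where
  "representative_bracket x y = representative (C (class_of x) (class_of y))"

lemma representative_bracket_Om: "representative_bracket x y \<in> Om G"
  by (simp add: representative_bracket_def representative_Om)

lemma class_of_representative_bracket:
  "x \<in> Om G \<Longrightarrow> y \<in> Om G \<Longrightarrow> class_of (representative_bracket x y) = C (class_of x) (class_of y)"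
  by (simp add: representative_bracket_def class_of_representative C_forms class_of_forms)

lemma representative_bracket_Ohom:
  assumes "p < 2" "q < 2" and x: "x \<in> Ohom G r p" and y: "y \<in> Ohom G s q"
  shows "if r + s = 0 then oeq G (representative_bracket x y) 0
    else representative_bracket x y \<in> Ohom G (r + s - 1) ((p + q) mod 2)"
proof -
  have Om: "x \<in> Om G" "y \<in> Om G"
    using assms by (simp_all add: Ohom_iff)
  have "C (class_of x) (class_of y) \<in> hform (int r + int s - 1) (int p + int q)"
    using assms by (intro C_hform) (simp_all add: Ohom_iff)
  then have bracket: "class_of (representative_bracket x y)
      \<in> hform (int r + int s - 1) (int p + int q)"
    using Om by (simp add: class_of_representative_bracket)
  show ?thesis
  proof (cases "r + s")
    case 0
    then show ?thesis
      using bracket by (simp add: hform_neg_degree oeq_iff_class_of representative_bracket_Om Om_0)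
  next
    case (Suc n)
    then have "int r + int s - 1 = int n"
      by linarith
    moreover have "hform (int n) (int p + int q) = hform (int n) (int ((p + q) mod 2))"
      by (rule hform_cong) (simp add: of_nat_mod)
    ultimately show ?thesis
      using bracket by (simp add: Suc Ohom_iff representative_bracket_Om)
  qed
qed

theorem gerstenhaber_representative_bracket: "gerstenhaber G representative_bracket"
  unfolding gerstenhaber_def
proof (intro conjI allI ballI impI)
  note [simp] = representative_bracket_Om class_of_representative_bracket class_of_forms
    Om_add Om_scaleR Om_neg Om_0 oeq_iff_class_of wedge_Om class_of_wedge
  show "representative_bracket x y \<in> Om G" for x y
    by simp
  show "oeq G (representative_bracket x y) (representative_bracket x' y')"
    if "x \<in> Om G" "x' \<in> Om G" "y \<in> Om G" "y' \<in> Om G" "oeq G x x'" "oeq G y y'" for x x' y y'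
    using that by simp
  show "oeq G (representative_bracket (c *\<^sub>R x + x') y)
      (c *\<^sub>R representative_bracket x y + representative_bracket x' y)"
    if "x \<in> Om G" "x' \<in> Om G" "y \<in> Om G" for c x x' y
    using that by (simp add: C_lincomb_left)
  show "oeq G (representative_bracket x (c *\<^sub>R y + y'))
      (c *\<^sub>R representative_bracket x y + representative_bracket x y')"
    if "x \<in> Om G" "y \<in> Om G" "y' \<in> Om G" for c x y y'
    using that by (simp add: C_lincomb_right)
  fix r s p q x y assume p: "p < 2" and q: "q < 2" and xy: "x \<in> Ohom G r p" "y \<in> Ohom G s q"
  then have x: "x \<in> Om G" "class_of x \<in> hform (int r) (int p)"
    and y: "y \<in> Om G" "class_of y \<in> hform (int s) (int q)"
    by (simp_all add: Ohom_iff)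
  from xy show "if r + s = 0 then oeq G (representative_bracket x y) 0
    else representative_bracket x y \<in> Ohom G (r + s - 1) ((p + q) mod 2)"
    using p q by (intro representative_bracket_Ohom)
  show "oeq G (representative_bracket x y)
    (- (sgni ((int r - 1) * (int s - 1) + int (p * q)) *\<^sub>R representative_bracket y x))"
    using C_antisym[OF x(2) y(2)] x y by simp
  fix t u z assume "u < 2" "z \<in> Ohom G t u"
  then have z: "z \<in> Om G" "class_of z \<in> hform (int t) (int u)"
    by (simp_all add: Ohom_iff)
  show "oeq G (representative_bracket x (representative_bracket y z))
    (representative_bracket (representative_bracket x y) z
      + sgni ((int r - 1) * (int s - 1) + int (p * q)) *\<^sub>R
        representative_bracket y (representative_bracket x z))"
    using C_jacobi[OF x(2) y(2) z(2)] x y z by simp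
  show "oeq G (representative_bracket x (wedge y z))
    (wedge (representative_bracket x y) z
      + sgni ((int r - 1) * int s + int (p * q)) *\<^sub>R wedge y (representative_bracket x z))"
    using C_leibniz[OF x(2) y(2) z(2)] x y z by simp
qed

end

locale gerstenhaber_bracket = supercommutative_algebra G for G :: "int \<Rightarrow> 'a::real_algebra_1 set" +
  fixes br :: "'a form \<Rightarrow> 'a form \<Rightarrow> 'a form"
  assumes gerstenhaber: "gerstenhaber G br"
begin

lemma br_Om: "x \<in> Om G \<Longrightarrow> y \<in> Om G \<Longrightarrow> br x y \<in> Om G"
  using conjunct1[OF gerstenhaber[unfolded gerstenhaber_def]] by blast

lemma br_cong:
  "x \<in> Om G \<Longrightarrow> x' \<in> Om G \<Longrightarrow> y \<in> Om G \<Longrightarrow> y' \<in> Om G \<Longrightarrow> oeq G x x' \<Longrightarrow> oeq G y y' \<Longrightarrow>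
    oeq G (br x y) (br x' y')"
  using gerstenhaber unfolding gerstenhaber_def by (elim conjE) simp

lemma br_lincomb_left:
  "x \<in> Om G \<Longrightarrow> x' \<in> Om G \<Longrightarrow> y \<in> Om G \<Longrightarrow> oeq G (br (c *\<^sub>R x + x') y) (c *\<^sub>R br x y + br x' y)"
  using gerstenhaber unfolding gerstenhaber_def by (elim conjE) metis

lemma br_lincomb_right:
  "x \<in> Om G \<Longrightarrow> y \<in> Om G \<Longrightarrow> y' \<in> Om G \<Longrightarrow> oeq G (br x (c *\<^sub>R y + y')) (c *\<^sub>R br x y + br x y')"
  using gerstenhaber unfolding gerstenhaber_def by (elim conjE) metis

lemma br_Ohom:
  "p < 2 \<Longrightarrow> q < 2 \<Longrightarrow> x \<in> Ohom G r p \<Longrightarrow> y \<in> Ohom G s q \<Longrightarrow>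
    if r + s = 0 then oeq G (br x y) 0 else br x y \<in> Ohom G (r + s - 1) ((p + q) mod 2)"
  using gerstenhaber unfolding gerstenhaber_def by (elim conjE) metis

lemma br_antisym:
  "p < 2 \<Longrightarrow> q < 2 \<Longrightarrow> x \<in> Ohom G r p \<Longrightarrow> y \<in> Ohom G s q \<Longrightarrow>
    oeq G (br x y) (- (sgni ((int r - 1) * (int s - 1) + int (p * q)) *\<^sub>R br y x))"
  using gerstenhaber unfolding gerstenhaber_def by (elim conjE) simp

lemma br_jacobi:
  "p < 2 \<Longrightarrow> q < 2 \<Longrightarrow> u < 2 \<Longrightarrow> x \<in> Ohom G r p \<Longrightarrow> y \<in> Ohom G s q \<Longrightarrow> z \<in> Ohom G t u \<Longrightarrow>
    oeq G (br x (br y z)) (br (br x y) z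
        + sgni ((int r - 1) * (int s - 1) + int (p * q)) *\<^sub>R br y (br x z))"
  using gerstenhaber unfolding gerstenhaber_def by blast

lemma br_leibniz:
  "p < 2 \<Longrightarrow> q < 2 \<Longrightarrow> u < 2 \<Longrightarrow> x \<in> Ohom G r p \<Longrightarrow> y \<in> Ohom G s q \<Longrightarrow> z \<in> Ohom G t u \<Longrightarrow>
    oeq G (br x (wedge y z)) (wedge (br x y) z
        + sgni ((int r - 1) * int s + int (p * q)) *\<^sub>R wedge y (br x z))"
  using gerstenhaber unfolding gerstenhaber_def by (elim conjE) metis

definition class_bracket :: "'a superform \<Rightarrow> 'a superform \<Rightarrow> 'a superform" where
  "class_bracket X Y = class_of (br (representative X) (representative Y))"

lemmas representative_simps = representative_Om class_of_representative class_of_forms hform_forms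
  forms_add forms_scaleR Om_add Om_scaleR Om_neg Om_0 wedge_Om class_of_wedge oeq_iff_class_of br_Om

lemma class_of_br:
  assumes "x \<in> Om G" "y \<in> Om G"
  shows "class_of (br x y) = class_bracket (class_of x) (class_of y)"
proof -
  have "oeq G (br x y) (br (representative (class_of x)) (representative (class_of y)))"
    using assms by (intro br_cong) (simp_all add: representative_simps)
  then show ?thesis
    using assms by (simp add: class_bracket_def representative_simps)
qed

lemma class_bracket_forms: "class_bracket X Y \<in> forms"
  by (simp add: class_bracket_def representative_simps)

lemma class_bracket_lincomb_left:
  assumes "X \<in> forms" "X' \<in> forms" "Y \<in> forms"
  shows "class_bracket (c *\<^sub>R X + X') Y = c *\<^sub>R class_bracket X Y + class_bracket X' Y"
  using br_lincomb_left[of "representative X" "representative X'" "representative Y" c] assms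
  by (simp add: representative_simps class_of_br)

lemma class_bracket_lincomb_right:
  assumes "X \<in> forms" "Y \<in> forms" "Y' \<in> forms"
  shows "class_bracket X (c *\<^sub>R Y + Y') = c *\<^sub>R class_bracket X Y + class_bracket X Y'"
  using br_lincomb_right[of "representative X" "representative Y" "representative Y'" c] assms
  by (simp add: representative_simps class_of_br)

lemma class_bracket_0:
  assumes "X \<in> forms"
  shows "class_bracket 0 X = 0" "class_bracket X 0 = 0"
  using class_bracket_lincomb_left[of 0 0 X "-1"] class_bracket_lincomb_right[of X 0 0 "-1"] assms
  by simp_all

text \<open>Forms of negative degree vanish and are outside the scope of the axioms for \<open>br\<close>.\<close>

lemma hform_representative_cases [consumes 1, case_names zero degree]:
  assumes "X \<in> hform r p"
  obtains "X = 0" | d where "r = int d" "representative X \<in> Ohom G d (tag p)"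
proof (cases "r < 0")
  case False
  have "X \<in> hform (int (nat r)) (int (tag p))"
    using False assms hform_cong[of p "int (tag p)"] by (simp add: int_tag)
  then have "representative X \<in> Ohom G (nat r) (tag p)"
    by (simp add: Ohom_iff representative_Om class_of_representative hform_forms)
  then show ?thesis
    using that(2)[of "nat r"] False by simp
qed (use assms that(1) hform_neg_degree in auto)

lemma sgni_add_tag: "sgni (a + int (tag p * tag q)) = sgni (a + p * q)"
  by (rule sgni_cong) (simp add: int_tag even_mult_iff)

lemma class_bracket_hform:
  assumes X: "X \<in> hform r p" and Y: "Y \<in> hform s q"
  shows "class_bracket X Y \<in> hform (r + s - 1) (p + q)"
  using X
proof (cases rule: hform_representative_cases)
  case x: (degree d)
  show ?thesis
    using Y
  proof (cases rule: hform_representative_cases)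
    case y: (degree e)
    show ?thesis
    proof (cases "d + e")
      case 0
      then show ?thesis
        using br_Ohom[OF _ _ x(2) y(2)] by (simp add: class_bracket_def representative_simps)
    next
      case (Suc n)
      then have "r + s - 1 = int n"
        using x(1) y(1) by linarith
      moreover have "hform (int n) (int (tag (p + q))) = hform (int n) (p + q)"
        by (rule hform_cong) (simp add: int_tag)
      moreover have "br (representative X) (representative Y) \<in> Ohom G n (tag (p + q))"
        using br_Ohom[OF _ _ x(2) y(2)] unfolding Suc by (simp add: tag_add)
      ultimately show ?thesis
        by (simp add: class_bracket_def Ohom_iff)
    qed
  qed (simp add: class_bracket_0 hform_forms[OF X])
qed (simp add: class_bracket_0 hform_forms[OF Y])

lemma class_bracket_antisym:
  assumes X: "X \<in> hform r p" and Y: "Y \<in> hform s q"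
  shows "class_bracket X Y = - (sgni ((r - 1) * (s - 1) + p * q) *\<^sub>R class_bracket Y X)"
  using X
proof (cases rule: hform_representative_cases)
  case x: (degree d)
  show ?thesis
    using Y
  proof (cases rule: hform_representative_cases)
    case y: (degree e)
    show ?thesis
      using br_antisym[OF _ _ x(2) y(2)]
      by (simp add: class_bracket_def representative_simps x(1) y(1) sgni_add_tag del: of_nat_mult)
  qed (simp add: class_bracket_0 hform_forms[OF X])
qed (simp add: class_bracket_0 hform_forms[OF Y])

lemma class_bracket_jacobi:
  assumes X: "X \<in> hform r p" and Y: "Y \<in> hform s q" and Z: "Z \<in> hform t u"
  shows "class_bracket X (class_bracket Y Z) = class_bracket (class_bracket X Y) Z
    + sgni ((r - 1) * (s - 1) + p * q) *\<^sub>R class_bracket Y (class_bracket X Z)"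
proof -
  note forms = hform_forms[OF X] hform_forms[OF Y] hform_forms[OF Z]
  show ?thesis
    using X
  proof (cases rule: hform_representative_cases)
    case x: (degree d)
    show ?thesis
      using Y
    proof (cases rule: hform_representative_cases)
      case y: (degree e)
      show ?thesis
        using Z
      proof (cases rule: hform_representative_cases)
        case z: (degree f)
        show ?thesis
          using br_jacobi[OF _ _ _ x(2) y(2) z(2)]
          by (simp add: class_of_br representative_simps forms x(1) y(1) sgni_add_tag
            del: of_nat_mult)
      qed (simp add: class_bracket_0 class_bracket_forms forms)
    qed (simp add: class_bracket_0 class_bracket_forms forms)
  qed (simp add: class_bracket_0 class_bracket_forms forms)
qed

lemma class_bracket_leibniz:
  assumes X: "X \<in> hform r p" and Y: "Y \<in> hform s q" and Z: "Z \<in> hform t u"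
  shows "class_bracket X (Y * Z)
      = class_bracket X Y * Z + sgni ((r - 1) * s + p * q) *\<^sub>R (Y * class_bracket X Z)"
proof -
  note forms = hform_forms[OF X] hform_forms[OF Y] hform_forms[OF Z]
  show ?thesis
    using X
  proof (cases rule: hform_representative_cases)
    case x: (degree d)
    show ?thesis
      using Y
    proof (cases rule: hform_representative_cases)
      case y: (degree e)
      show ?thesis
        using Z
      proof (cases rule: hform_representative_cases)
        case z: (degree f)
        show ?thesis
          using br_leibniz[OF _ _ _ x(2) y(2) z(2)]
          by (simp add: class_of_br representative_simps forms x(1) y(1) sgni_add_tag
            del: of_nat_mult)
      qed (simp add: class_bracket_0 class_bracket_forms forms)
    qed (simp add: class_bracket_0 class_bracket_forms forms)
  qed (simp add: class_bracket_0 class_bracket_forms forms forms_mult)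
qed

sublocale gerstenhaber_forms G class_bracket
  by unfold_locales
    ((rule class_bracket_forms | rule class_bracket_lincomb_left | rule class_bracket_lincomb_right
      | rule class_bracket_hform | rule class_bracket_antisym | rule class_bracket_jacobi
      | rule class_bracket_leibniz); assumption)+

end

subsection \<open>The bracket generated by a bracket of generators\<close>

context supercommutative_algebra
begin

definition homogeneous_ext :: "(int \<Rightarrow> int \<Rightarrow> 'a superform \<Rightarrow> 'v::real_vector) \<Rightarrow> 'a superform \<Rightarrow> 'v" where
  "homogeneous_ext F X = linext (\<lambda>w. F (int (wdeg w)) (int (wpar w)) (class_of (wd w)))
      (representative X)"

lemma linear_homogeneous_ext: "linear (homogeneous_ext F)"
  unfolding homogeneous_ext_def[abs_def]
  by (rule linear_compose[OF linear_representative linear_linext, unfolded o_def])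

lemma homogeneous_ext_hform:
  assumes lincomb: "\<And>r p c X Y. X \<in> hform r p \<Longrightarrow> Y \<in> hform r p \<Longrightarrow>
      F r p (c *\<^sub>R X + Y) = c *\<^sub>R F r p X + F r p Y"
    and cong: "\<And>r p q X. even (p - q) \<Longrightarrow> X \<in> hform r p \<Longrightarrow> F r p X = F r q X"
    and "X \<in> hform r p"
  shows "homogeneous_ext F X = F r p X"
proof -
  let ?F = "linext (\<lambda>w. F (int (wdeg w)) (int (wpar w)) (class_of (wd w)))"
  have zero: "F r p 0 = 0" for r p
    using lincomb[of 0 r p 0 "-1"] by simp
  have homogeneous: "class_of x \<in> hform r p \<and> ?F x = F r p (class_of x)"
    if "x \<in> span (wd ` hom_words r p)" for x r p
    using that
  proof (induction rule: span_induct_alt)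
    case (step c y x)
    then obtain w where w: "y = wd w" "w \<in> hom_words r p"
      by blast
    then have "wdeg w = r" "even (int (wpar w) - p)"
      by (auto simp: hom_words_def)
    then show ?case
      using step.IH w class_of_wd_hform[OF w(2)] cong[of "int (wpar w)" p "class_of (wd w)" r]
        hform_cong[of "int (wpar w)" p r]
      by (simp add: lincomb hform_add hform_scaleR)
  qed (simp add: zero)
  have "?F x = 0" if "x \<in> Relators G" for x
  proof -
    obtain r p where "x \<in> span (wd ` hom_words r p)"
      using \<open>x \<in> Relators G\<close> by (rule Relators_homogeneous)
    moreover have "class_of x = 0"
      using that class_of_relation[of x] by (simp add: relations_def span_base)
    ultimately show ?thesis
      using homogeneous[of x r p] zero[of r p] by simp
  qed
  then have relations: "?F x = 0" if "x \<in> relations G" for x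
    using that linear_eq_on[OF linear_linext linear_zero] unfolding relations_def by blast
  obtain x where x: "X = class_of x" "x \<in> span (wd ` hom_words r p)"
    using assms(3) by (auto simp: hform_def)
  then have "representative X - x \<in> relations G"
    using span_hom_words_Om by (auto intro: representative_class_of)
  from relations[OF this] have "homogeneous_ext F X = ?F x"
    by (simp add: homogeneous_ext_def)
  then show ?thesis
    using homogeneous[OF x(2)] x(1) by simp
qed

end

locale generator_bracket = supercommutative_algebra G for G :: "int \<Rightarrow> 'a::real_algebra_1 set" +
  fixes gen_bracket :: "int \<Rightarrow> int \<Rightarrow> 'a \<times> 'a tens \<Rightarrow> 'a \<times> 'a tens \<Rightarrow> 'a \<times> 'a tens"
  assumes gen_bracket_hgen: "\<And>r p s q x y. x \<in> hgen r p \<Longrightarrow> y \<in> hgen s q \<Longrightarrow>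
      gen_bracket p q x y \<in> hgen (r + s - 1) (p + q)"
    and gen_bracket_lincomb: "\<And>r p s q c x y y'. x \<in> hgen r p \<Longrightarrow> y \<in> hgen s q \<Longrightarrow> y' \<in> hgen s q \<Longrightarrow>
      gen_bracket p q x (c *\<^sub>R y + y') = c *\<^sub>R gen_bracket p q x y + gen_bracket p q x y'"
    and gen_bracket_cong: "\<And>p p' q q' x y. even (p - p') \<Longrightarrow> even (q - q') \<Longrightarrow>
        gen_bracket p q x y = gen_bracket p' q' x y"
    and gen_bracket_antisym: "\<And>r p s q x y. x \<in> hgen r p \<Longrightarrow> y \<in> hgen s q \<Longrightarrow>
      gen_bracket p q x y = - (sgni ((r - 1) * (s - 1) + p * q) *\<^sub>R gen_bracket q p y x)"
    and gen_bracket_gen_act: "\<And>r p q f s u x y. x \<in> hgen r p \<Longrightarrow> f \<in> hfun q \<Longrightarrow> y \<in> hgen s u \<Longrightarrow>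
      incl (gen_bracket p (q + u) x (gen_act f y)) = incl (gen_bracket p q x (f, 0)) * incl y
        + sgni (p * q) *\<^sub>R (incl (f, 0) * incl (gen_bracket p u x y))"
    and gen_bracket_jacobi: "\<And>r p s q t u x y z. x \<in> hgen r p \<Longrightarrow> y \<in> hgen s q \<Longrightarrow> z \<in> hgen t u \<Longrightarrow>
      gen_bracket p (q + u) x (gen_bracket q u y z) = gen_bracket (p + q) u (gen_bracket p q x y) z
        + sgni ((r - 1) * (s - 1) + p * q) *\<^sub>R gen_bracket q (p + u) y (gen_bracket p u x z)"
begin

definition ad :: "int \<Rightarrow> int \<Rightarrow> 'a \<times> 'a tens \<Rightarrow> 'a superform \<Rightarrow> 'a superform" where
  "ad r p x = derivation_on_generators.extension G (r - 1) p (\<lambda>s q y. incl (gen_bracket p q x y))"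

lemma ad:
  assumes x: "x \<in> hgen r p"
  shows ad_derivation: "derivation (r - 1) p (ad r p x)"
    and ad_incl: "y \<in> hgen s q \<Longrightarrow> ad r p x (incl y) = incl (gen_bracket p q x y)"
proof -
  interpret derivation_on_generators G "r - 1" p "\<lambda>s q y. incl (gen_bracket p q x y)"
  proof
    show "incl (gen_bracket p q x (c *\<^sub>R y + z))
        = c *\<^sub>R incl (gen_bracket p q x y) + incl (gen_bracket p q x z)"
      if "y \<in> hgen s q" "z \<in> hgen s q" for s q c y z
      using that x by (simp add: gen_bracket_lincomb[OF x] incl_lincomb
        snd_hgen_Omega1[OF gen_bracket_hgen[OF x]])
    show "incl (gen_bracket p q x y) = incl (gen_bracket p q' x y)" if "even (q - q')" for q q' y
      using gen_bracket_cong[of p p q q' x y] that by simp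
    show "incl (gen_bracket p q x y) \<in> hform (s + (r - 1)) (q + p)" if "y \<in> hgen s q" for s q y
      using incl_hform[OF gen_bracket_hgen[OF x that]] by (simp add: algebra_simps)
    show "incl (gen_bracket p (q + u) x (gen_act f y)) = incl (gen_bracket p q x (f, 0)) * incl y
        + sgni (p * q) *\<^sub>R (incl (f, 0) * incl (gen_bracket p u x y))"
          if "f \<in> hfun q" "y \<in> hgen s u" for q f s u y
      using x that by (rule gen_bracket_gen_act)
  qed
  show "derivation (r - 1) p (ad r p x)"
    unfolding ad_def by (rule derivation_extension)
  show "ad r p x (incl y) = incl (gen_bracket p q x y)" if "y \<in> hgen s q"
    unfolding ad_def using that by (rule extension_incl)
qed

lemma ad_incl_antisym:
  assumes "x \<in> hgen r p" "y \<in> hgen s q"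
  shows "ad r p x (incl y) = - (sgni ((r - 1) * (s - 1) + p * q) *\<^sub>R ad s q y (incl x))"
  using gen_bracket_antisym[OF assms] snd_hgen_Omega1[OF gen_bracket_hgen[OF assms(2,1)]]
  by (simp add: ad_incl[OF assms] ad_incl[OF assms(2,1)] incl_minus incl_scaleR Omega1_scaleR)

lemma ad_cong:
  assumes "even (p - q)" and x: "x \<in> hgen r p" and "Z \<in> forms"
  shows "ad r p x Z = ad r q x Z"
proof (rule derivation_eqI[OF ad_derivation[OF x] _ _ assms(3)])
  have x': "x \<in> hgen r q"
    using hgen_cong[OF assms(1)] x by simp
  show "derivation (r - 1) p (ad r q x)"
    using assms(1) by (intro derivation_cong[OF ad_derivation[OF x']]) simp_all
  show "ad r p x (incl y) = ad r q x (incl y)" if "y \<in> hgen s u" for s u y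
    using gen_bracket_cong[OF assms(1), of u u x y]
    by (simp add: ad_incl[OF x that] ad_incl[OF x' that])
qed

lemma ad_lincomb:
  assumes x: "x \<in> hgen r p" and y: "y \<in> hgen r p" and "Z \<in> forms"
  shows "ad r p (c *\<^sub>R x + y) Z = c *\<^sub>R ad r p x Z + ad r p y Z"
proof (rule derivation_eqI[OF _ _ _ assms(3)])
  have xy: "c *\<^sub>R x + y \<in> hgen r p"
    using x y by (intro hgen_add hgen_scaleR)
  then show "derivation (r - 1) p (ad r p (c *\<^sub>R x + y))"
    by (rule ad_derivation)
  show "derivation (r - 1) p (\<lambda>Z. c *\<^sub>R ad r p x Z + ad r p y Z)"
    by (intro derivation_lincomb ad_derivation x y)
  fix s q z assume z: "z \<in> hgen s q"
  show "ad r p (c *\<^sub>R x + y) (incl z) = c *\<^sub>R ad r p x (incl z) + ad r p y (incl z)"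
    unfolding ad_incl_antisym[OF xy z] ad_incl_antisym[OF x z] ad_incl_antisym[OF y z]
    unfolding incl_lincomb[OF snd_hgen_Omega1[OF x] snd_hgen_Omega1[OF y]]
    using linear_add[OF derivation_linear[OF ad_derivation[OF z]]]
      linear_scale[OF derivation_linear[OF ad_derivation[OF z]]]
    by (simp add: algebra_simps)
qed

lemma ad_gen_act:
  assumes f: "f \<in> hfun p" and x: "x \<in> hgen r q" and "Z \<in> forms"
  shows "ad r (p + q) (gen_act f x) Z
      = incl (f, 0) * ad r q x Z + sgni (p * q) *\<^sub>R (incl x * ad 0 p (f, 0) Z)"
proof (rule derivation_eqI[OF _ _ _ assms(3)])
  have f': "(f, 0) \<in> hgen 0 p" and fx: "gen_act f x \<in> hgen r (p + q)"
    using f x by (simp_all add: gen_act_hgen)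
  show "derivation (r - 1) (p + q) (ad r (p + q) (gen_act f x))"
    using fx by (rule ad_derivation)
  have "derivation (r - 1) (p + q) (\<lambda>Z. incl (f, 0) * ad r q x Z)"
    using derivation_left_mult[OF ad_derivation[OF x] incl_hform[OF f']] by (simp add: add.commute)
  moreover have "derivation (r - 1) (p + q) (\<lambda>Z. incl x * ad 0 p (f, 0) Z)"
    using derivation_left_mult[OF ad_derivation[OF f'] incl_hform[OF x]] by (simp add: algebra_simps)
  ultimately show "derivation (r - 1) (p + q) (\<lambda>Z. incl (f, 0) * ad r q x Z
      + sgni (p * q) *\<^sub>R (incl x * ad 0 p (f, 0) Z))"
    using derivation_lincomb[of "r - 1" "p + q" _ _ "sgni (p * q)"] by (simp add: add.commute)
  fix s u y assume y: "y \<in> hgen s u"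
  have "ad r (p + q) (gen_act f x) (incl y)
      = - (sgni ((r - 1) * (s - 1) + (p + q) * u) *\<^sub>R ad s u y (incl (gen_act f x)))"
    by (rule ad_incl_antisym[OF fx y])
  also have "ad s u y (incl (gen_act f x))
      = ad s u y (incl (f, 0)) * incl x + sgni (u * p) *\<^sub>R (incl (f, 0) * ad s u y (incl x))"
    using gen_bracket_gen_act[OF y f x]
    by (simp add: ad_incl[OF y fx] ad_incl[OF y f'] ad_incl[OF y x])
  also have "ad s u y (incl x) = - (sgni ((s - 1) * (r - 1) + u * q) *\<^sub>R ad r q x (incl y))"
    by (rule ad_incl_antisym[OF y x])
  also have "ad s u y (incl (f, 0)) = - (sgni ((s - 1) * (0 - 1) + u * p) *\<^sub>R ad 0 p (f, 0) (incl y))"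
    by (rule ad_incl_antisym[OF y f'])
  finally show "ad r (p + q) (gen_act f x) (incl y)
    = incl (f, 0) * ad r q x (incl y) + sgni (p * q) *\<^sub>R (incl x * ad 0 p (f, 0) (incl y))"
    using hform_commute[OF derivation_hform[OF ad_derivation[OF f'] incl_hform[OF y]]
      incl_hform[OF x]]
    by (simp add: algebra_simps sgni_add sgni_diff)
qed

text \<open>The values on generators are prescribed by antisymmetry.\<close>

definition form_ad :: "int \<Rightarrow> int \<Rightarrow> 'a superform \<Rightarrow> 'a superform \<Rightarrow> 'a superform" where
  "form_ad r p X = derivation_on_generators.extension G (r - 1) p
    (\<lambda>s q y. - (sgni ((r - 1) * (s - 1) + p * q) *\<^sub>R ad s q y X))"

lemma form_ad:
  assumes X: "X \<in> hform r p"
  shows form_ad_derivation: "derivation (r - 1) p (form_ad r p X)"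
    and form_ad_incl: "y \<in> hgen s q \<Longrightarrow>
        form_ad r p X (incl y) = - (sgni ((r - 1) * (s - 1) + p * q) *\<^sub>R ad s q y X)"
proof -
  let ?D = "\<lambda>s q y. - (sgni ((r - 1) * (s - 1) + p * q) *\<^sub>R ad s q y X)"
  interpret derivation_on_generators G "r - 1" p ?D
  proof
    show "?D s q (c *\<^sub>R y + z) = c *\<^sub>R ?D s q y + ?D s q z"
      if "y \<in> hgen s q" "z \<in> hgen s q" for s q c y z
      using ad_lincomb[OF that hform_forms[OF X], of c] by (simp add: algebra_simps)
    show "?D s q y = ?D s q' y" if "even (q - q')" "y \<in> hgen s q" for s q q' y
    proof -
      have "sgni ((r - 1) * (s - 1) + p * q) = sgni ((r - 1) * (s - 1) + p * q')"
        using that(1) by (intro sgni_cong) (simp flip: right_diff_distrib)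
      then show ?thesis
        using ad_cong[OF that hform_forms[OF X]] by simp
    qed
    show "?D s q y \<in> hform (s + (r - 1)) (q + p)" if "y \<in> hgen s q" for s q y
      using derivation_hform[OF ad_derivation[OF that] X]
      by (intro hform_neg hform_scaleR) (simp add: algebra_simps)
    show "?D s (q + u) (gen_act f y)
        = ?D 0 q (f, 0) * incl y + sgni (p * q) *\<^sub>R (incl (f, 0) * ?D s u y)"
      if "f \<in> hfun q" and y: "y \<in> hgen s u" for q f s u y
    proof -
      have "(f, 0) \<in> hgen 0 q"
        using that by simp
      from hform_commute[OF derivation_hform[OF ad_derivation[OF this] X] incl_hform[OF y]]
      show ?thesis
        using ad_gen_act[OF that hform_forms[OF X]] by (simp add: algebra_simps sgni_add sgni_diff)
    qed
  qed
  show "derivation (r - 1) p (form_ad r p X)"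
    unfolding form_ad_def by (rule derivation_extension)
  show "form_ad r p X (incl y) = ?D s q y" if "y \<in> hgen s q"
    unfolding form_ad_def using that by (rule extension_incl)
qed

lemma form_ad_lincomb:
  assumes X: "X \<in> hform r p" and X': "X' \<in> hform r p" and "Y \<in> forms"
  shows "form_ad r p (c *\<^sub>R X + X') Y = c *\<^sub>R form_ad r p X Y + form_ad r p X' Y"
proof (rule derivation_eqI[OF _ _ _ assms(3)])
  have lincomb: "c *\<^sub>R X + X' \<in> hform r p"
    using X X' by (intro hform_add hform_scaleR)
  then show "derivation (r - 1) p (form_ad r p (c *\<^sub>R X + X'))"
    by (rule form_ad_derivation)
  show "derivation (r - 1) p (\<lambda>Y. c *\<^sub>R form_ad r p X Y + form_ad r p X' Y)"
    by (intro derivation_lincomb form_ad_derivation X X')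
  fix s q y assume y: "y \<in> hgen s q"
  show "form_ad r p (c *\<^sub>R X + X') (incl y) = c *\<^sub>R form_ad r p X (incl y) + form_ad r p X' (incl y)"
    unfolding form_ad_incl[OF lincomb y] form_ad_incl[OF X y] form_ad_incl[OF X' y]
    using derivation_linear[OF ad_derivation[OF y]]
    by (simp add: linear_add linear_scale algebra_simps)
qed

lemma form_ad_cong:
  assumes "even (p - q)" and X: "X \<in> hform r p" and "Y \<in> forms"
  shows "form_ad r p X Y = form_ad r q X Y"
proof (rule derivation_eqI[OF form_ad_derivation[OF X] _ _ assms(3)])
  have X': "X \<in> hform r q"
    using hform_cong[OF assms(1)] X by simp
  show "derivation (r - 1) p (form_ad r q X)"
    using assms(1) by (intro derivation_cong[OF form_ad_derivation[OF X']]) simp_all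
  fix s u y assume y: "y \<in> hgen s u"
  have "sgni ((r - 1) * (s - 1) + p * u) = sgni ((r - 1) * (s - 1) + q * u)"
    using assms(1) by (intro sgni_cong) (simp flip: left_diff_distrib)
  then show "form_ad r p X (incl y) = form_ad r q X (incl y)"
    by (simp add: form_ad_incl[OF X y] form_ad_incl[OF X' y])
qed

definition bracket :: "'a superform \<Rightarrow> 'a superform \<Rightarrow> 'a superform" where
  "bracket X Y = homogeneous_ext (\<lambda>r p X. form_ad r p X (class_of (representative Y))) X"

lemma linear_bracket_left: "linear (\<lambda>X. bracket X Y)"
  unfolding bracket_def by (rule linear_homogeneous_ext)

lemmas bracket_linear_left [simp] = linear_add[OF linear_bracket_left]
  linear_scale[OF linear_bracket_left]
  linear_neg[OF linear_bracket_left] linear_0[OF linear_bracket_left]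

lemma bracket_eq_form_ad:
  assumes "X \<in> hform r p"
  shows "bracket X Y = form_ad r p X (class_of (representative Y))"
  unfolding bracket_def using assms class_of_forms[OF representative_Om]
  by (intro homogeneous_ext_hform form_ad_lincomb form_ad_cong)

lemma bracket_derivation:
  assumes X: "X \<in> hform r p"
  shows "derivation (r - 1) p (bracket X)"
proof (rule derivationI)
  note D = form_ad_derivation[OF X]
  have proj: "class_of (representative Y) \<in> forms" for Y
    by (rule class_of_forms[OF representative_Om])
  show "linear (bracket X)"
    using derivation_linear[OF D] linear_representative
    by (intro linearI) (simp_all add: bracket_eq_form_ad[OF X] linear_add linear_scale)
  fix s q Y assume Y: "Y \<in> hform s q"
  then show "bracket X Y \<in> hform (s + (r - 1)) (q + p)"
    using derivation_hform[OF D Y]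
    by (simp add: bracket_eq_form_ad[OF X] class_of_representative hform_forms)
  fix Z assume "Z \<in> forms"
  then show "bracket X (Y * Z) = bracket X Y * Z + sgni ((r - 1) * s + p * q) *\<^sub>R (Y * bracket X Z)"
    using derivation_mult[OF D Y] Y
    by (simp add: bracket_eq_form_ad[OF X] class_of_representative hform_forms forms_mult)
qed

lemma bracket_hform: "X \<in> hform r p \<Longrightarrow> Y \<in> hform s q \<Longrightarrow> bracket X Y \<in> hform (r + s - 1) (p + q)"
  using derivation_hform[OF bracket_derivation] by (simp add: algebra_simps)

lemma linear_bracket_right:
  assumes "X \<in> forms"
  shows "linear (bracket X)"
  using assms
proof (induction rule: forms_induct)
  case subspace
  show ?case
    by (auto intro!: subspaceI linearI simp: linear_iff algebra_simps)
next
  case (homogeneous r p X)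
  then show ?case
    by (rule derivation_linear[OF bracket_derivation])
qed

lemma bracket_forms:
  assumes "X \<in> forms" "Y \<in> forms"
  shows "bracket X Y \<in> forms"
  using assms(1)
proof (induction rule: forms_induct)
  case subspace
  show ?case
    by (rule subspace_linear_mem[OF linear_bracket_left subspace_forms])
next
  case (homogeneous r p X)
  then show ?case
    using assms(2) by (rule derivation_forms[OF bracket_derivation])
qed

lemma bracket_incl_right:
  assumes X: "X \<in> hform r p" and y: "y \<in> hgen s q"
  shows "bracket X (incl y) = - (sgni ((r - 1) * (s - 1) + p * q) *\<^sub>R ad s q y X)"
  using form_ad_incl[OF X y] hform_forms[OF incl_hform[OF y]]
  by (simp add: bracket_eq_form_ad[OF X] class_of_representative)

lemma bracket_incl_left:
  assumes x: "x \<in> hgen r p" and "Y \<in> forms"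
  shows "bracket (incl x) Y = ad r p x Y"
proof (rule derivation_eqI[OF bracket_derivation[OF incl_hform[OF x]] ad_derivation[OF x] _ assms(2)])
  show "bracket (incl x) (incl y) = ad r p x (incl y)" if y: "y \<in> hgen s q" for s q y
    unfolding bracket_incl_right[OF incl_hform[OF x] y] by (rule ad_incl_antisym[OF x y, symmetric])
qed

lemma bracket_incl: "x \<in> hgen r p \<Longrightarrow> y \<in> hgen s q \<Longrightarrow>
    bracket (incl x) (incl y) = incl (gen_bracket p q x y)"
  using bracket_incl_left[of x r p "incl y"] hform_forms[OF incl_hform] by (simp add: ad_incl)

lemma bracket_antisym_incl:
  assumes X: "X \<in> hform r p" and y: "y \<in> hgen s q"
  shows "bracket X (incl y) = - (sgni ((r - 1) * (s - 1) + p * q) *\<^sub>R bracket (incl y) X)"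
  using bracket_incl_right[OF X y] bracket_incl_left[OF y hform_forms[OF X]] by simp

lemma bracket_mult_left:
  assumes x: "x \<in> hgen r p" and X: "X \<in> hform s q" and "Y \<in> forms"
  shows "bracket (incl x * X) Y
      = incl x * bracket X Y + sgni (r * s + p * q) *\<^sub>R (X * bracket (incl x) Y)"
proof (rule derivation_eqI[OF _ _ _ assms(3)])
  note x' = incl_hform[OF x]
  show "derivation (r + s - 1) (p + q) (bracket (incl x * X))"
    by (rule bracket_derivation[OF hform_mult[OF x' X]])
  have "derivation (r + s - 1) (p + q) (\<lambda>Y. incl x * bracket X Y)"
    "derivation (r + s - 1) (p + q) (\<lambda>Y. X * bracket (incl x) Y)"
    using derivation_left_mult[OF bracket_derivation[OF X] x']
      derivation_left_mult[OF bracket_derivation[OF x'] X]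
    by (simp_all add: algebra_simps)
  from derivation_lincomb[OF this(2,1)]
  show "derivation (r + s - 1) (p + q) (\<lambda>Y. incl x * bracket X Y
      + sgni (r * s + p * q) *\<^sub>R (X * bracket (incl x) Y))"
    by (simp add: add.commute)
  fix t u y assume y: "y \<in> hgen t u"
  have "bracket (incl y) (incl x * X) = bracket (incl y) (incl x) * X
      + sgni ((t - 1) * r + u * p) *\<^sub>R (incl x * bracket (incl y) X)"
    by (rule derivation_mult[OF bracket_derivation[OF incl_hform[OF y]] x' hform_forms[OF X]])
  moreover have "bracket (incl y) (incl x) * X
      = sgni ((t + r - 1) * s + (u + p) * q) *\<^sub>R (X * bracket (incl y) (incl x))"
    by (rule hform_commute[OF bracket_hform[OF incl_hform[OF y] x'] X])
  ultimately show "bracket (incl x * X) (incl y)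
    = incl x * bracket X (incl y) + sgni (r * s + p * q) *\<^sub>R (X * bracket (incl x) (incl y))"
    by (simp add: bracket_antisym_incl[OF hform_mult[OF x' X] y] bracket_antisym_incl[OF X y]
        bracket_antisym_incl[OF x' y] algebra_simps sgni_add sgni_diff)
qed

lemma bracket_antisym:
  assumes "X \<in> hform r p" and Y: "Y \<in> hform s q"
  shows "bracket X Y = - (sgni ((r - 1) * (s - 1) + p * q) *\<^sub>R bracket Y X)"
  using assms(1)
proof (induction rule: hform_induct)
  case (subspace r p)
  show ?case
    using linear_bracket_right[OF hform_forms[OF Y]]
    by (intro subspace_linear_eq linearI) (simp_all add: linear_add linear_scale algebra_simps)
next
  case (generator r p x)
  then show ?case
    using bracket_antisym_incl[OF Y generator] by (simp add: algebra_simps sgni_add sgni_diff)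
next
  case (mult r p t u x X)
  note x = incl_hform[OF mult(1)]
  have "bracket (incl x) Y = - (sgni ((r - 1) * (s - 1) + p * q) *\<^sub>R bracket Y (incl x))"
    using bracket_antisym_incl[OF Y mult(1)] by (simp add: algebra_simps sgni_add sgni_diff)
  moreover have "X * bracket Y (incl x)
      = sgni (t * (s + r - 1) + u * (q + p)) *\<^sub>R (bracket Y (incl x) * X)"
    by (rule hform_commute[OF mult(2) bracket_hform[OF Y x]])
  ultimately show ?case
    by (simp add: bracket_mult_left[OF mult(1,2) hform_forms[OF Y]] mult(3)
        derivation_mult[OF bracket_derivation[OF Y] x hform_forms[OF mult(2)]] algebra_simps sgni_add
        sgni_diff)
qed

definition jacobi_identity :: "
    int \<Rightarrow> int \<Rightarrow> 'a superform \<Rightarrow> int \<Rightarrow> int \<Rightarrow> 'a superform \<Rightarrow> 'a superform \<Rightarrow> bool" where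
  "jacobi_identity r p X s q Y Z \<longleftrightarrow> bracket (bracket X Y) Z
    = bracket X (bracket Y Z) - sgni ((r - 1) * (s - 1) + p * q) *\<^sub>R bracket Y (bracket X Z)"

lemma jacobi_identity_generators:
  assumes X: "X \<in> hform r p" and Y: "Y \<in> hform s q"
    and "\<And>t u z. z \<in> hgen t u \<Longrightarrow> jacobi_identity r p X s q Y (incl z)" and "Z \<in> forms"
  shows "jacobi_identity r p X s q Y Z"
  unfolding jacobi_identity_def
proof (rule derivation_eqI[OF _ derivation_commutator _ assms(4)])
  show "derivation (r - 1 + (s - 1)) (p + q) (bracket (bracket X Y))"
    using bracket_derivation[OF bracket_hform[OF X Y]] by (simp add: algebra_simps)
qed (use assms(3) in \<open>simp_all add: jacobi_identity_def bracket_derivation[OF X]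
    bracket_derivation[OF Y]\<close>)

lemma jacobi_identity_swap_left:
  assumes X: "X \<in> hform r p" and Y: "Y \<in> hform s q" and "jacobi_identity r p X s q Y Z"
  shows "jacobi_identity s q Y r p X Z"
  using assms(3)
  by (simp add: jacobi_identity_def bracket_antisym[OF Y X] algebra_simps sgni_add sgni_diff)

lemma jacobi_identity_swap_right:
  assumes X: "X \<in> hform r p" and Y: "Y \<in> hform s q" and Z: "Z \<in> hform t u"
    and "jacobi_identity r p X s q Y Z"
  shows "jacobi_identity r p X t u Z Y"
  using assms(4)[unfolded jacobi_identity_def] linear_bracket_right[OF hform_forms[OF X]]
  by (simp add: jacobi_identity_def bracket_antisym[OF Z Y] bracket_antisym[OF bracket_hform[OF X Z] Y]
      bracket_antisym[OF Z bracket_hform[OF X Y]] linear_neg linear_scale algebra_simps sgni_add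
      sgni_diff)

lemma jacobi_identity_incl:
  assumes x: "x \<in> hgen r p" and y: "y \<in> hgen s q" and z: "z \<in> hgen t u"
  shows "jacobi_identity r p (incl x) s q (incl y) (incl z)"
proof -
  note xy = gen_bracket_hgen[OF x y] and yz = gen_bracket_hgen[OF y z]
    and xz = gen_bracket_hgen[OF x z]
  let ?right = "gen_bracket q (p + u) y (gen_bracket p u x z)"
    and ?left = "gen_bracket (p + q) u (gen_bracket p q x y) z"
  have "incl (?left + sgni ((r - 1) * (s - 1) + p * q) *\<^sub>R ?right)
    = incl ?left + sgni ((r - 1) * (s - 1) + p * q) *\<^sub>R incl ?right"
    using snd_hgen_Omega1[OF gen_bracket_hgen[OF xy z]] snd_hgen_Omega1[OF gen_bracket_hgen[OF y xz]]
    by (simp add: incl_add incl_scaleR Omega1_scaleR)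
  then show ?thesis
    using gen_bracket_jacobi[OF assms]
    by (simp add: jacobi_identity_def bracket_incl[OF x y] bracket_incl[OF y z] bracket_incl[OF x z]
        bracket_incl[OF xy z] bracket_incl[OF x yz] bracket_incl[OF y xz])
qed

lemma bracket_jacobi:
  assumes X: "X \<in> hform r p" and Y: "Y \<in> hform s q" and Z: "Z \<in> hform t u"
  shows "jacobi_identity r p X s q Y Z"
proof -
  have two_generators: "jacobi_identity r p (incl x) s q (incl y) Z"
    if "x \<in> hgen r p" "y \<in> hgen s q" "Z \<in> hform t u" for x y Z r p s q t u
    by (rule jacobi_identity_generators[OF incl_hform[OF that(1)] incl_hform[OF that(2)]
          jacobi_identity_incl[OF that(1,2)] hform_forms[OF that(3)]])
  have one_generator: "jacobi_identity r p (incl x) s q Y Z"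
    if x: "x \<in> hgen r p" and Y: "Y \<in> hform s q" and Z: "Z \<in> hform t u" for x Y Z r p s q t u
  proof (rule jacobi_identity_swap_right[OF incl_hform[OF x] Z Y])
    have "jacobi_identity r p (incl x) t u Z (incl y)" if "y \<in> hgen s q" for y s q
      by (rule jacobi_identity_swap_right[OF incl_hform[OF x] incl_hform[OF that] Z
            two_generators[OF x that Z]])
    then show "jacobi_identity r p (incl x) t u Z Y"
      by (rule jacobi_identity_generators[OF incl_hform[OF x] Z _ hform_forms[OF Y]])
  qed
  have "jacobi_identity r p X s q Y (incl z)" if z: "z \<in> hgen t u" for z t u
    by (rule jacobi_identity_swap_right[OF X incl_hform[OF z] Y
          jacobi_identity_swap_left[OF incl_hform[OF z] X one_generator[OF z X Y]]])
  then show ?thesis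
    by (rule jacobi_identity_generators[OF X Y _ hform_forms[OF Z]])
qed

sublocale gerstenhaber_forms G bracket
proof
  fix r p s q t u X Y Z
  assume X: "X \<in> hform r p" and Y: "Y \<in> hform s q" and Z: "Z \<in> hform t u"
  show "bracket X (bracket Y Z)
      = bracket (bracket X Y) Z + sgni ((r - 1) * (s - 1) + p * q) *\<^sub>R bracket Y (bracket X Z)"
    using bracket_jacobi[OF X Y Z] by (simp add: jacobi_identity_def)
  show "bracket X (Y * Z) = bracket X Y * Z + sgni ((r - 1) * s + p * q) *\<^sub>R (Y * bracket X Z)"
    by (rule derivation_mult[OF bracket_derivation[OF X] Y hform_forms[OF Z]])
qed (simp_all add: bracket_forms bracket_hform bracket_antisym[symmetric]
  linear_add[OF linear_bracket_right] linear_scale[OF linear_bracket_right])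

end

subsection \<open>Lie superalgebroids\<close>

locale algebroid = supercommutative_algebra G for G :: "int \<Rightarrow> 'a::real_algebra_1 set" +
  fixes brk :: "'a tens \<Rightarrow> 'a tens \<Rightarrow> 'a tens" and \<rho> :: "'a tens \<Rightarrow> 'a \<Rightarrow> 'a"
  assumes rho_lincomb: "\<And>c \<alpha> \<beta> f. \<alpha> \<in> Omega1 \<Longrightarrow> \<beta> \<in> Omega1 \<Longrightarrow> \<rho> (c *\<^sub>R \<alpha> + \<beta>) f = c *\<^sub>R \<rho> \<alpha> f + \<rho> \<beta> f"
    and linear_rho: "\<And>\<alpha>. \<alpha> \<in> Omega1 \<Longrightarrow> linear (\<rho> \<alpha>)"
    and rho_hfun: "\<And>p \<alpha> q f. \<alpha> \<in> hform1 p \<Longrightarrow> f \<in> hfun q \<Longrightarrow> \<rho> \<alpha> f \<in> hfun (p + q)"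
    and rho_mult: "\<And>p \<alpha> q f g. \<alpha> \<in> hform1 p \<Longrightarrow> f \<in> hfun q \<Longrightarrow>
      \<rho> \<alpha> (f * g) = \<rho> \<alpha> f * g + sgni (p * q) *\<^sub>R (f * \<rho> \<alpha> g)"
    and rho_lact: "\<And>f \<alpha> g. \<alpha> \<in> Omega1 \<Longrightarrow> \<rho> (lact f \<alpha>) g = f * \<rho> \<alpha> g"
    and brk_Omega1: "\<And>\<alpha> \<beta>. \<alpha> \<in> Omega1 \<Longrightarrow> \<beta> \<in> Omega1 \<Longrightarrow> brk \<alpha> \<beta> \<in> Omega1"
    and brk_lincomb_left: "\<And>c \<alpha> \<alpha>' \<beta>. \<alpha> \<in> Omega1 \<Longrightarrow> \<alpha>' \<in> Omega1 \<Longrightarrow> \<beta> \<in> Omega1 \<Longrightarrow>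
      brk (c *\<^sub>R \<alpha> + \<alpha>') \<beta> = c *\<^sub>R brk \<alpha> \<beta> + brk \<alpha>' \<beta>"
    and brk_lincomb_right: "\<And>c \<alpha> \<beta> \<beta>'. \<alpha> \<in> Omega1 \<Longrightarrow> \<beta> \<in> Omega1 \<Longrightarrow> \<beta>' \<in> Omega1 \<Longrightarrow>
      brk \<alpha> (c *\<^sub>R \<beta> + \<beta>') = c *\<^sub>R brk \<alpha> \<beta> + brk \<alpha> \<beta>'"
    and brk_hform1: "\<And>p \<alpha> q \<beta>. \<alpha> \<in> hform1 p \<Longrightarrow> \<beta> \<in> hform1 q \<Longrightarrow> brk \<alpha> \<beta> \<in> hform1 (p + q)"
    and brk_antisym: "\<And>p \<alpha> q \<beta>. \<alpha> \<in> hform1 p \<Longrightarrow> \<beta> \<in> hform1 q \<Longrightarrow>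
      brk \<alpha> \<beta> = - (sgni (p * q) *\<^sub>R brk \<beta> \<alpha>)"
    and brk_jacobi: "\<And>p \<alpha> q \<beta> u \<gamma>. \<alpha> \<in> hform1 p \<Longrightarrow> \<beta> \<in> hform1 q \<Longrightarrow> \<gamma> \<in> hform1 u \<Longrightarrow>
      brk \<alpha> (brk \<beta> \<gamma>) = brk (brk \<alpha> \<beta>) \<gamma> + sgni (p * q) *\<^sub>R brk \<beta> (brk \<alpha> \<gamma>)"
    and brk_leibniz: "\<And>p \<alpha> q f \<beta>. \<alpha> \<in> hform1 p \<Longrightarrow> f \<in> hfun q \<Longrightarrow> \<beta> \<in> Omega1 \<Longrightarrow>
      brk \<alpha> (lact f \<beta>) = lact (\<rho> \<alpha> f) \<beta> + sgni (p * q) *\<^sub>R lact f (brk \<alpha> \<beta>)"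

context supercommutative_algebra
begin

lemma superderiv_iff:
  assumes "p < 2"
  shows "superderiv G p D \<longleftrightarrow> linear D \<and> (\<forall>q f. f \<in> hfun q \<longrightarrow> D f \<in> hfun (int p + q)) \<and>
    (\<forall>q f g. f \<in> hfun q \<longrightarrow> D (f * g) = D f * g + sgni (int p * q) *\<^sub>R (f * D g))"
proof -
  have "(\<forall>q f. q < 2 \<longrightarrow> f \<in> Apar G q \<longrightarrow> Q q f) \<longleftrightarrow> (\<forall>q f. f \<in> hfun q \<longrightarrow> Q (tag q) f)" for Q
    by (metis hfun_def tag_less_two tag_of_nat)
  moreover have "hfun (int p + q) = Apar G ((p + tag q) mod 2)" for q
    using tag_add[of "int p" q] assms by (simp add: hfun_def tag_of_nat)
  moreover have "(-1) ^ (p * tag q) = sgni (int p * q)" for q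
    using minus_one_power_tag[of "int p" q] assms by (simp add: tag_of_nat)
  ultimately show ?thesis
    by (simp add: superderiv_def)
qed

lemma lie_superalgebroid_imp_algebroid:
  assumes "lie_superalgebroid G brk \<rho>"
  shows "algebroid G brk \<rho>"
proof (intro algebroid.intro[OF supercommutative_algebra_axioms] algebroid_axioms.intro)
  note axioms = assms[unfolded lie_superalgebroid_def]
  show "\<rho> (c *\<^sub>R \<alpha> + \<beta>) f = c *\<^sub>R \<rho> \<alpha> f + \<rho> \<beta> f" if "\<alpha> \<in> Omega1" "\<beta> \<in> Omega1" for c \<alpha> \<beta> f
    using axioms that by (elim conjE) metis
  show "linear (\<rho> \<alpha>)" if "\<alpha> \<in> Omega1" for \<alpha>
  proof -
    have "\<rho> \<alpha> \<in> DerA G"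
      using conjunct1[OF axioms] that by simp
    then show ?thesis
      by (auto simp: DerA_def superderiv_def intro: linear_compose_add)
  qed
  have derivation: "superderiv G (tag p) (\<rho> \<alpha>)" if "\<alpha> \<in> hform1 p" for p \<alpha>
    using axioms that tag_less_two unfolding hform1_def by (elim conjE) meson
  show "\<rho> \<alpha> f \<in> hfun (p + q)" if "\<alpha> \<in> hform1 p" "f \<in> hfun q" for p \<alpha> q f
    using derivation[OF that(1)] that(2) hfun_cong[of "int (tag p) + q" "p + q"]
    by (simp add: superderiv_iff int_tag) metis
  show "\<rho> \<alpha> (f * g) = \<rho> \<alpha> f * g + sgni (p * q) *\<^sub>R (f * \<rho> \<alpha> g)"
    if "\<alpha> \<in> hform1 p" "f \<in> hfun q" for p \<alpha> q f g
    using derivation[OF that(1)] that(2) sgni_cong[of "int (tag p) * q" "p * q"]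
    by (simp add: superderiv_iff int_tag)
  show "\<rho> (lact f \<alpha>) g = f * \<rho> \<alpha> g" if "\<alpha> \<in> Omega1" for f \<alpha> g
    using axioms that by (elim conjE) metis
  show "brk \<alpha> \<beta> \<in> Omega1" if "\<alpha> \<in> Omega1" "\<beta> \<in> Omega1" for \<alpha> \<beta>
    using axioms that by (elim conjE) metis
  show "brk (c *\<^sub>R \<alpha> + \<alpha>') \<beta> = c *\<^sub>R brk \<alpha> \<beta> + brk \<alpha>' \<beta>"
    if "\<alpha> \<in> Omega1" "\<alpha>' \<in> Omega1" "\<beta> \<in> Omega1" for c \<alpha> \<alpha>' \<beta>
    using axioms that by (elim conjE) meson
  show "brk \<alpha> (c *\<^sub>R \<beta> + \<beta>') = c *\<^sub>R brk \<alpha> \<beta> + brk \<alpha> \<beta>'"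
    if "\<alpha> \<in> Omega1" "\<beta> \<in> Omega1" "\<beta>' \<in> Omega1" for c \<alpha> \<beta> \<beta>'
    using axioms that by (elim conjE) meson
  show "brk \<alpha> \<beta> \<in> hform1 (p + q)" if "\<alpha> \<in> hform1 p" "\<beta> \<in> hform1 q" for p \<alpha> q \<beta>
    using axioms that tag_less_two unfolding hform1_def tag_add[symmetric] by (elim conjE) meson
  show "brk \<alpha> \<beta> = - (sgni (p * q) *\<^sub>R brk \<beta> \<alpha>)" if "\<alpha> \<in> hform1 p" "\<beta> \<in> hform1 q" for p \<alpha> q \<beta>
    using axioms that tag_less_two unfolding hform1_def minus_one_power_tag[symmetric]
    by (elim conjE) meson
  show "brk \<alpha> (brk \<beta> \<gamma>) = brk (brk \<alpha> \<beta>) \<gamma> + sgni (p * q) *\<^sub>R brk \<beta> (brk \<alpha> \<gamma>)"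
    if "\<alpha> \<in> hform1 p" "\<beta> \<in> hform1 q" "\<gamma> \<in> hform1 u" for p \<alpha> q \<beta> u \<gamma>
    using axioms that tag_less_two unfolding hform1_def minus_one_power_tag[symmetric]
    by (elim conjE) meson
  show "brk \<alpha> (lact f \<beta>) = lact (\<rho> \<alpha> f) \<beta> + sgni (p * q) *\<^sub>R lact f (brk \<alpha> \<beta>)"
    if "\<alpha> \<in> hform1 p" "f \<in> hfun q" "\<beta> \<in> Omega1" for p \<alpha> q f \<beta>
    using axioms that tag_less_two unfolding hform1_def hfun_def minus_one_power_tag[symmetric]
    by (elim conjE) meson
qed

end

context algebroid
begin

lemma rho_add: "\<alpha> \<in> Omega1 \<Longrightarrow> \<beta> \<in> Omega1 \<Longrightarrow> \<rho> (\<alpha> + \<beta>) f = \<rho> \<alpha> f + \<rho> \<beta> f"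
  using rho_lincomb[of \<alpha> \<beta> 1] by simp

lemma rho_DerA:
  assumes "\<alpha> \<in> Omega1"
  shows "\<rho> \<alpha> \<in> DerA G"
proof -
  have "superderiv G p (\<rho> (tcomp G p \<alpha>))" if "p < 2" for p
    using that tcomp_hform1[OF that assms] linear_rho[OF hform1_Omega1] rho_hfun rho_mult
    by (simp add: superderiv_iff)
  moreover have "\<rho> \<alpha> f = \<rho> (tcomp G 0 \<alpha>) f + \<rho> (tcomp G 1 \<alpha>) f" for f
    using rho_add[OF hform1_Omega1[OF tcomp_hform1] hform1_Omega1[OF tcomp_hform1], of 0 \<alpha> 1 \<alpha>]
      tcomp_add assms
    by simp
  ultimately show ?thesis
    unfolding DerA_def mem_Collect_eq
    by (intro exI[of _ "\<rho> (tcomp G 0 \<alpha>)"] exI[of _ "\<rho> (tcomp G 1 \<alpha>)"]) (simp add: fun_eq_iff)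
qed

lemma lie_superalgebroid: "lie_superalgebroid G brk \<rho>"
proof -
  have derivation: "superderiv G p (\<rho> \<alpha>)" if "p < 2" "\<alpha> \<in> O1par G p" for p \<alpha>
    using that linear_rho[OF hform1_Omega1] rho_hfun rho_mult
    by (simp add: superderiv_iff flip: hform1_of_nat)
  have rho_lincomb': "\<rho> (c *\<^sub>R \<alpha> + \<beta>) = (\<lambda>f. c *\<^sub>R \<rho> \<alpha> f + \<rho> \<beta> f)"
    and rho_lact': "\<rho> (lact g \<alpha>) = (\<lambda>f. g * \<rho> \<alpha> f)" if "\<alpha> \<in> Omega1" "\<beta> \<in> Omega1" for c g \<alpha> \<beta>
    using that by (simp_all add: fun_eq_iff rho_lincomb rho_lact)
  have even: "brk \<alpha> \<beta> \<in> O1par G ((p + q) mod 2)"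
    and antisym: "brk \<alpha> \<beta> = - (sgni (int (p * q)) *\<^sub>R brk \<beta> \<alpha>)"
    if "p < 2" "q < 2" "\<alpha> \<in> O1par G p" "\<beta> \<in> O1par G q" for p q \<alpha> \<beta>
    using brk_hform1[of \<alpha> "int p" \<beta> "int q"] brk_antisym[of \<alpha> "int p" \<beta> "int q"]
      tag_add[of "int p" "int q"] that
    by (simp_all add: hform1_def tag_of_nat)
  have jacobi: "brk \<alpha> (brk \<beta> \<gamma>) = brk (brk \<alpha> \<beta>) \<gamma> + sgni (int (p * q)) *\<^sub>R brk \<beta> (brk \<alpha> \<gamma>)"
    if "p < 2" "q < 2" "u < 2" "\<alpha> \<in> O1par G p" "\<beta> \<in> O1par G q" "\<gamma> \<in> O1par G u" for p q u \<alpha> \<beta> \<gamma>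
    using brk_jacobi[of \<alpha> "int p" \<beta> "int q" \<gamma> "int u"] that by (simp add: hform1_of_nat)
  have leibniz: "brk \<alpha> (lact f \<beta>) = lact (\<rho> \<alpha> f) \<beta> + sgni (int (p * q)) *\<^sub>R lact f (brk \<alpha> \<beta>)"
    if "p < 2" "q < 2" "\<alpha> \<in> O1par G p" "f \<in> Apar G q" "\<beta> \<in> Omega1" for p q \<alpha> f \<beta>
    using brk_leibniz[of \<alpha> "int p" f "int q" \<beta>] that by (simp add: hform1_of_nat hfun_of_nat)
  show ?thesis
    unfolding lie_superalgebroid_def minus_one_power_eq_sgni
    by (intro conjI allI impI ballI;
        (rule rho_DerA rho_lincomb' derivation rho_lact' brk_Omega1 brk_lincomb_left brk_lincomb_right
          even antisym jacobi leibniz; assumption))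
qed

lemma rho_0 [simp]: "\<rho> 0 f = 0"
  using rho_lincomb[of 0 0 "-1" f] by simp

lemma brk_0 [simp]: "\<alpha> \<in> Omega1 \<Longrightarrow> brk 0 \<alpha> = 0" "\<alpha> \<in> Omega1 \<Longrightarrow> brk \<alpha> 0 = 0"
  using brk_lincomb_left[of 0 0 \<alpha> "-1"] brk_lincomb_right[of \<alpha> 0 0 "-1"] by simp_all

lemma brk_add_right: "\<alpha> \<in> Omega1 \<Longrightarrow> \<beta> \<in> Omega1 \<Longrightarrow> \<beta>' \<in> Omega1 \<Longrightarrow> brk \<alpha> (\<beta> + \<beta>') = brk \<alpha> \<beta> + brk \<alpha> \<beta>'"
  using brk_lincomb_right[of \<alpha> \<beta> \<beta>' 1] by simp

lemma brk_scaleR_right: "\<alpha> \<in> Omega1 \<Longrightarrow> \<beta> \<in> Omega1 \<Longrightarrow> brk \<alpha> (c *\<^sub>R \<beta>) = c *\<^sub>R brk \<alpha> \<beta>"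
  using brk_lincomb_right[of \<alpha> \<beta> 0 c] by simp

lemma brk_brk_lact:
  assumes \<alpha>: "\<alpha> \<in> hform1 p" and \<beta>: "\<beta> \<in> hform1 q" and f: "f \<in> hfun u" and \<gamma>: "\<gamma> \<in> Omega1"
  shows "brk \<alpha> (brk \<beta> (lact f \<gamma>))
      = lact (\<rho> \<alpha> (\<rho> \<beta> f)) \<gamma> + sgni (p * (q + u)) *\<^sub>R lact (\<rho> \<beta> f) (brk \<alpha> \<gamma>)
    + sgni (q * u) *\<^sub>R (lact (\<rho> \<alpha> f) (brk \<beta> \<gamma>) + sgni (p * u) *\<^sub>R lact f (brk \<alpha> (brk \<beta> \<gamma>)))"
proof -
  note Omega1 = hform1_Omega1[OF \<alpha>] hform1_Omega1[OF \<beta>] \<gamma>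
  have "brk \<alpha> (brk \<beta> (lact f \<gamma>)) = brk \<alpha> (lact (\<rho> \<beta> f) \<gamma>) + sgni (q * u) *\<^sub>R brk \<alpha> (lact f (brk \<beta> \<gamma>))"
    using Omega1 by (simp add: brk_leibniz[OF \<beta> f] brk_add_right brk_scaleR_right lact_Omega1
      brk_Omega1 Omega1_scaleR)
  then show ?thesis
    using Omega1 by (simp add: brk_leibniz[OF \<alpha> rho_hfun[OF \<beta> f]] brk_leibniz[OF \<alpha> f] brk_Omega1)
qed

text \<open>The Jacobi identity for \<open>\<alpha>\<close>, \<open>\<beta>\<close> and \<open>f \<gamma>\<close> gives the claim multiplied by an arbitrary \<open>\<gamma>\<close>.\<close>

lemma rho_brk_hfun:
  assumes \<alpha>: "\<alpha> \<in> hform1 p" and \<beta>: "\<beta> \<in> hform1 q" and f: "f \<in> hfun u"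
  shows "\<rho> \<alpha> (\<rho> \<beta> f) = \<rho> (brk \<alpha> \<beta>) f + sgni (p * q) *\<^sub>R \<rho> \<beta> (\<rho> \<alpha> f)"
proof (cases "\<exists>b :: 'a. b \<notin> span {1}")
  case True
  let ?h = "\<rho> \<alpha> (\<rho> \<beta> f) - (\<rho> (brk \<alpha> \<beta>) f + sgni (p * q) *\<^sub>R \<rho> \<beta> (\<rho> \<alpha> f))"
  have "lact ?h \<gamma> = 0" if "\<gamma> \<in> Omega1" for \<gamma>
    using that
  proof (induction rule: form1_induct)
    case (homogeneous t \<gamma>)
    note \<gamma> = hform1_Omega1[OF homogeneous]
    have "brk \<alpha> (brk \<beta> (lact f \<gamma>))
        = brk (brk \<alpha> \<beta>) (lact f \<gamma>) + sgni (p * q) *\<^sub>R brk \<beta> (brk \<alpha> (lact f \<gamma>))"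
      by (rule brk_jacobi[OF \<alpha> \<beta> lact_hform1[OF f homogeneous]])
    then show ?case
      unfolding brk_brk_lact[OF \<alpha> \<beta> f \<gamma>] brk_brk_lact[OF \<beta> \<alpha> f \<gamma>]
        brk_leibniz[OF brk_hform1[OF \<alpha> \<beta>] f \<gamma>]
      by (simp add: brk_jacobi[OF \<alpha> \<beta> homogeneous] algebra_simps sgni_add
          lact_add_left lact_scaleR_left lact_diff_left Omega1_AtA[OF \<gamma>])
  qed simp
  with True have "?h = 0"
    using lact_eq_0_Omega1 by blast
  then show ?thesis
    by simp
next
  case False
  have "\<rho> \<gamma> g = 0" if "\<gamma> \<in> hform1 r" for \<gamma> g r
  proof -
    have "\<rho> \<gamma> 1 = 0"
      using rho_mult[OF that one_hfun, of 1] by simp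
    moreover obtain c where "g = c *\<^sub>R 1"
      using False by (auto simp: span_singleton)
    ultimately show ?thesis
      using linear_scale[OF linear_rho[OF hform1_Omega1[OF that]]] by simp
  qed
  then show ?thesis
    using \<alpha> \<beta> brk_hform1[OF \<alpha> \<beta>] by simp
qed

lemma rho_brk:
  assumes \<alpha>: "\<alpha> \<in> hform1 p" and \<beta>: "\<beta> \<in> hform1 q"
  shows "\<rho> \<alpha> (\<rho> \<beta> f) = \<rho> (brk \<alpha> \<beta>) f + sgni (p * q) *\<^sub>R \<rho> \<beta> (\<rho> \<alpha> f)"
proof (induction f rule: fun_induct)
  case (add f g)
  then show ?case
    using linear_rho hform1_Omega1[OF \<alpha>] hform1_Omega1[OF \<beta>] brk_Omega1
    by (simp add: linear_add algebra_simps)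
qed (rule rho_brk_hfun[OF \<alpha> \<beta>])

definition gen_bracket :: "int \<Rightarrow> int \<Rightarrow> 'a \<times> 'a tens \<Rightarrow> 'a \<times> 'a tens \<Rightarrow> 'a \<times> 'a tens" where
  "gen_bracket p q x y =
    (\<rho> (snd x) (fst y) - sgni (p * q) *\<^sub>R \<rho> (snd y) (fst x), brk (snd x) (snd y))"

lemma gen_bracket_simps:
  "gen_bracket p q (f, 0) (g, 0) = 0"
  "\<alpha> \<in> Omega1 \<Longrightarrow> gen_bracket p q (0, \<alpha>) (g, 0) = (\<rho> \<alpha> g, 0)"
  "\<beta> \<in> Omega1 \<Longrightarrow> gen_bracket p q (f, 0) (0, \<beta>) = (- (sgni (p * q) *\<^sub>R \<rho> \<beta> f), 0)"
  "\<alpha> \<in> Omega1 \<Longrightarrow> \<beta> \<in> Omega1 \<Longrightarrow> gen_bracket p q (0, \<alpha>) (0, \<beta>) = (0, brk \<alpha> \<beta>)"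
  by (simp_all add: gen_bracket_def linear_0[OF linear_rho] zero_prod_def)

lemma gen_bracket_0 [simp]: "snd x \<in> Omega1 \<Longrightarrow> gen_bracket p q x 0 = 0"
  "snd x \<in> Omega1 \<Longrightarrow> gen_bracket p q 0 x = 0"
  by (simp_all add: gen_bracket_def linear_0[OF linear_rho] zero_prod_def)

lemma gen_bracket_function: "x \<in> hgen r p \<Longrightarrow> gen_bracket p q x (f, 0) = (\<rho> (snd x) f, 0)"
  using snd_hgen_Omega1[of x r p] by (simp add: gen_bracket_def)

lemma gen_bracket_gen_act_eq:
  assumes x: "x \<in> hgen r p" and f: "f \<in> hfun q" and y: "y \<in> hgen s u"
  shows "gen_bracket p (q + u) x (gen_act f y)
      = gen_act (\<rho> (snd x) f) y + sgni (p * q) *\<^sub>R gen_act f (gen_bracket p u x y)"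
  using rho_mult[OF snd_hgen[OF x] f] rho_lact[OF snd_hgen_Omega1[OF y]]
    brk_leibniz[OF snd_hgen[OF x] f snd_hgen_Omega1[OF y]]
  by (simp add: gen_bracket_def gen_act_def prod_eq_iff algebra_simps sgni_add)

text \<open>For one function among the arguments this is \<open>rho_brk\<close>; for more, both sides vanish.\<close>

lemma gen_bracket_super_jacobi:
  assumes x: "x \<in> hgen r p" and y: "y \<in> hgen s q" and z: "z \<in> hgen t u"
  shows "gen_bracket p (q + u) x (gen_bracket q u y z) = gen_bracket (p + q) u (gen_bracket p q x y) z
      + sgni ((r - 1) * (s - 1) + p * q) *\<^sub>R gen_bracket q (p + u) y (gen_bracket p u x z)"
proof -
  note hform1 = snd_hgen[OF x] snd_hgen[OF y] snd_hgen[OF z]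
  show ?thesis
    using assms rho_brk[OF hform1(1,2), of "fst z"] rho_brk[OF hform1(1,3), of "fst y"]
      rho_brk[OF hform1(2,3), of "fst x"] brk_jacobi[OF hform1] hform1[THEN hform1_Omega1, THEN linear_rho]
    by (elim hgen_cases; simp add: gen_bracket_simps hform1_Omega1 brk_Omega1 linear_neg
        linear_scale algebra_simps sgni_add)
qed

sublocale generator_bracket G gen_bracket
proof
  fix r p s q x y assume x: "x \<in> hgen r p" and y: "y \<in> hgen s q"
  note x' = fst_hgen[OF x] snd_hgen[OF x] snd_hgen_Omega1[OF x]
    and y' = fst_hgen[OF y] snd_hgen[OF y] snd_hgen_Omega1[OF y]
  show hgen: "gen_bracket p q x y \<in> hgen (r + s - 1) (p + q)"
    using x y rho_hfun[OF y'(2) x'(1)]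
    by (elim hgen_cases; simp add: gen_bracket_simps hform1_Omega1 rho_hfun brk_hform1
      add.commute[of q] hfun_scaleR subspace_neg[OF subspace_hfun])
  show "gen_bracket p q x y = - (sgni ((r - 1) * (s - 1) + p * q) *\<^sub>R gen_bracket q p y x)"
    using x y brk_antisym[OF x'(2) y'(2)]
    by (elim hgen_cases; simp add: gen_bracket_simps hform1_Omega1 mult.commute[of q])
  show "gen_bracket p q x (c *\<^sub>R y + z) = c *\<^sub>R gen_bracket p q x y + gen_bracket p q x z"
    if z: "z \<in> hgen s q" for c z
    using x'(3) y'(3) snd_hgen_Omega1[OF z] linear_rho[OF x'(3)]
    by (simp add: gen_bracket_def linear_add linear_scale rho_lincomb brk_lincomb_right)
      (simp add: algebra_simps)
  show "incl (gen_bracket p (u + q) x (gen_act f y)) = incl (gen_bracket p u x (f, 0)) * incl y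
      + sgni (p * u) *\<^sub>R (incl (f, 0) * incl (gen_bracket p q x y))" if f: "f \<in> hfun u" for f u
    using hgen gen_act_hgen[OF f hgen] gen_act_hgen[OF rho_hfun[OF x'(2) f] y]
    by (simp add: gen_bracket_gen_act_eq[OF x f y] gen_bracket_function[OF x] incl_add incl_scaleR
      snd_hgen_Omega1 Omega1_scaleR incl_gen_act[OF f hgen] incl_gen_act[OF rho_hfun[OF x'(2) f] y])
  show "gen_bracket p (q + u) x (gen_bracket q u y z) = gen_bracket (p + q) u (gen_bracket p q x y) z
      + sgni ((r - 1) * (s - 1) + p * q) *\<^sub>R gen_bracket q (p + u) y (gen_bracket p u x z)"
    if "z \<in> hgen t u" for t u z
    using x y that by (rule gen_bracket_super_jacobi)
next
  show "gen_bracket p q x y = gen_bracket p' q' x y"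
    if "even (p - p')" "even (q - q')" for p p' q q' x y
  proof -
    have "sgni (p * q) = sgni (p' * q')"
      using that by (intro sgni_cong) (simp add: even_mult_iff)
    then show ?thesis
      by (simp add: gen_bracket_def)
  qed
qed

end

context supercommutative_algebra
begin

lemma class_of_embA: "class_of (embA G f) = incl (f, 0)"
  by (simp add: incl_eq embA_def class_of_wd_0 tcomp_of_hform1[of 0 0])

lemma class_of_emb1: "class_of (emb1 G \<alpha>) = incl (0, \<alpha>)"
  by (simp add: incl_eq emb1_def class_of_wd_0 acomp_of_hfun[of 0 0])

lemma embA_Om: "embA G f \<in> Om G"
  unfolding embA_def by (intro Om_add wd_Om) (simp_all add: fun_parity.component_mem)

lemma emb1_Om: "\<alpha> \<in> Omega1 \<Longrightarrow> emb1 G \<alpha> \<in> Om G"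
  unfolding emb1_def using tcomp_hform1[of 0 \<alpha>] tcomp_hform1[of 1 \<alpha>]
  by (intro Om_add wd_Om) (simp_all add: hform1_def)

lemma incl_function_add: "incl (f + g, 0) = incl (f, 0) + incl (g, 0)"
  using incl_add[of "(f, 0)" "(g, 0)"] by simp

lemma incl_form_add: "\<alpha> \<in> Omega1 \<Longrightarrow> \<beta> \<in> Omega1 \<Longrightarrow> incl (0, \<alpha> + \<beta>) = incl (0, \<alpha>) + incl (0, \<beta>)"
  using incl_add[of "(0, \<alpha>)" "(0, \<beta>)"] by simp

end

context algebroid
begin

lemma bracket_functions: "bracket (incl (f, 0)) (incl (g, 0)) = 0"
proof (induction f rule: fun_induct)
  case (homogeneous p f)
  note f = hform_forms[OF incl_hform[of "(f, 0)" 0 p]]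
  show ?case
  proof (induction g rule: fun_induct)
    case (homogeneous q g)
    with \<open>f \<in> hfun p\<close> show ?case
      using bracket_incl[of "(f, 0)" 0 p "(g, 0)" 0 q] by (simp add: gen_bracket_simps)
  qed (use f \<open>f \<in> hfun p\<close> in \<open>simp add: incl_function_add linear_add[OF linear_bracket_right]\<close>)
qed (simp add: incl_function_add)

lemma bracket_form_function:
  assumes "\<alpha> \<in> Omega1"
  shows "bracket (incl (0, \<alpha>)) (incl (f, 0)) = incl (\<rho> \<alpha> f, 0)"
  using assms
proof (induction rule: form1_induct)
  case (homogeneous p \<alpha>)
  then have \<alpha>: "\<alpha> \<in> Omega1" "(0, \<alpha>) \<in> hgen 1 p" "incl (0, \<alpha>) \<in> forms"
    by (simp_all add: hform1_Omega1 incl_forms)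
  show ?case
  proof (induction f rule: fun_induct)
    case (homogeneous q f)
    then show ?case
      using bracket_incl[OF \<alpha>(2), of "(f, 0)" 0 q] \<alpha>(1) by (simp add: gen_bracket_simps)
  qed (use \<alpha> in \<open>simp add: incl_function_add linear_add[OF linear_bracket_right]
    linear_add[OF linear_rho]\<close>)
qed (simp add: incl_form_add incl_function_add rho_add)

lemma bracket_form_form:
  assumes "\<alpha> \<in> Omega1" "\<beta> \<in> Omega1"
  shows "bracket (incl (0, \<alpha>)) (incl (0, \<beta>)) = incl (0, brk \<alpha> \<beta>)"
  using assms(1)
proof (induction rule: form1_induct)
  case (homogeneous p \<alpha>)
  then have \<alpha>: "\<alpha> \<in> Omega1" "(0, \<alpha>) \<in> hgen 1 p" "incl (0, \<alpha>) \<in> forms"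
    by (simp_all add: hform1_Omega1 incl_forms)
  from assms(2) show ?case
  proof (induction rule: form1_induct)
    case (homogeneous q \<beta>)
    then show ?case
      using bracket_incl[OF \<alpha>(2), of "(0, \<beta>)" 1 q] \<alpha>(1) hform1_Omega1 by (simp add: gen_bracket_simps)
  qed (use \<alpha> in \<open>simp add: incl_form_add linear_add[OF linear_bracket_right] brk_add_right
    brk_Omega1\<close>)
next
  case (add \<alpha> \<alpha>')
  then show ?case
    using assms(2) brk_lincomb_left[of \<alpha> \<alpha>' \<beta> 1] by (simp add: incl_form_add brk_Omega1)
qed

theorem gerstenhaber_exists:
  "\<exists>br. gerstenhaber G br \<and> (\<forall>f g. oeq G (br (embA G f) (embA G g)) 0) \<and>
    (\<forall>\<alpha>\<in>Omega1. \<forall>f. oeq G (br (emb1 G \<alpha>) (embA G f)) (embA G (\<rho> \<alpha> f))) \<and>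
    (\<forall>\<alpha>\<in>Omega1. \<forall>\<beta>\<in>Omega1. oeq G (br (emb1 G \<alpha>) (emb1 G \<beta>)) (emb1 G (brk \<alpha> \<beta>)))"
  using gerstenhaber_representative_bracket
  by (intro exI[of _ representative_bracket])
    (simp add: oeq_iff_class_of representative_bracket_Om class_of_representative_bracket embA_Om
      emb1_Om Om_0 class_of_embA class_of_emb1 bracket_functions bracket_form_function
      bracket_form_form brk_Omega1)

end

subsection \<open>Forms of degree at most one\<close>

context supercommutative_algebra
begin

definition low_degree_word :: "'a word \<Rightarrow> 'a \<times> 'a tens" where
  "low_degree_word w = (case w of (p, f, as) \<Rightarrow>
    (case as of [] \<Rightarrow> (f, 0) | [(q, \<alpha>)] \<Rightarrow> (0, lact f \<alpha>) | _ \<Rightarrow> 0))"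

definition low_degree :: "'a superform \<Rightarrow> 'a \<times> 'a tens" where
  "low_degree X = linext low_degree_word (representative X)"

lemma low_degree_word_simps [simp]:
  "low_degree_word (p, f, []) = (f, 0)"
  "low_degree_word (p, f, [(q, \<alpha>)]) = (0, lact f \<alpha>)"
  "low_degree_word (p, f, a # b # as) = 0"
  by (simp_all add: low_degree_word_def split: prod.splits)

lemma linear_low_degree: "linear low_degree"
  unfolding low_degree_def[abs_def]
  by (rule linear_compose[OF linear_representative linear_linext, unfolded o_def])

lemma low_degree_Relators:
  assumes "x \<in> Relators G"
  shows "linext low_degree_word x = 0"
  using assms
proof (cases rule: Relators_cases)
  case (add_function p f g as)
  then show ?thesis
    by (cases as rule: remdups_adj.cases)
      (auto simp: lact_add_left O1par_def Omega1_AtA zero_prod_def)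
next
  case (scale_function p c f as)
  then show ?thesis
    by (cases as rule: remdups_adj.cases)
      (auto simp: lact_scaleR_left O1par_def Omega1_AtA zero_prod_def)
next
  case (add_factor p f us q \<alpha> \<beta> vs)
  then show ?thesis
    by (cases us; cases vs; cases "tl us") (auto simp: zero_prod_def)
next
  case (move_scalar p f us q' g q \<alpha> vs)
  then show ?thesis
    by (cases us; cases vs; cases "tl us") (auto simp: zero_prod_def lact_mult)
next
  case (swap p f us q1 \<alpha>1 q2 \<alpha>2 vs)
  then show ?thesis
    by (cases us; cases "tl us") auto
qed

lemma low_degree_class_of:
  assumes "x \<in> Om G"
  shows "low_degree (class_of x) = linext low_degree_word x"
proof -
  have "linext low_degree_word y = 0" if "y \<in> relations G" for y
    using that linear_eq_on[OF linear_linext linear_zero] low_degree_Relators unfolding relations_def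
    by blast
  from this[OF representative_class_of[OF assms]] show ?thesis
    by (simp add: low_degree_def)
qed

lemma incl_low_degree_word:
  assumes w: "(d, f, as) \<in> hom_words r p" and "r \<le> 1"
  shows "low_degree_word (d, f, as) \<in> hgen r p"
    "incl (low_degree_word (d, f, as)) = class_of (wd (d, f, as))"
proof -
  have d: "tag (int d) = d" and f: "f \<in> hfun (int d)" and r: "r = int (length as)"
    using w by (auto simp: hom_words_iff hfun_of_nat tag_of_nat)
  consider (empty) "as = []" | (singleton) q \<alpha> where "as = [(q, \<alpha>)]"
    using assms by (cases as rule: remdups_adj.cases) (auto simp: hom_words_iff)
  then have "low_degree_word (d, f, as) \<in> hgen r p \<and>
      incl (low_degree_word (d, f, as)) = class_of (wd (d, f, as))"
  proof cases
    case empty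
    then show ?thesis
      using w f d hfun_cong[of "int d" p] incl_function[OF f] by (simp add: hom_words_iff)
  next
    case (singleton q \<alpha>)
    then have \<alpha>: "valid_factors G [(q, \<alpha>)]" "\<alpha> \<in> hform1 (int q)" "tag (int q) = q"
      using w by (auto simp: hom_words_iff hform1_of_nat tag_of_nat)
    have "incl (0, lact f \<alpha>) = incl (f, 0) * incl (0, \<alpha>)"
      using incl_gen_act[OF f, of "(0, \<alpha>)" 1 "int q"] \<alpha>(2) by simp
    also have "\<dots> = class_of (wd (d, f, [(q, \<alpha>)]))"
      using incl_function_mult[OF f \<alpha>(1)] incl_form[OF \<alpha>(2)] d \<alpha>(3) by simp
    finally show ?thesis
      using w singleton lact_hform1[OF f \<alpha>(2)] hform1_cong[of "int d + int q" p] by (simp add: hom_words_iff)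
  qed
  then show "low_degree_word (d, f, as) \<in> hgen r p"
    "incl (low_degree_word (d, f, as)) = class_of (wd (d, f, as))"
    by blast+
qed

lemma low_degree_hform:
  assumes "X \<in> hform r p" "r \<le> 1"
  shows "low_degree X \<in> hgen r p" "incl (low_degree X) = X"
proof -
  have "low_degree X \<in> hgen r p \<and> incl (low_degree X) = X"
    using assms(1) unfolding hform_eq_span
  proof (induction rule: span_induct_alt)
    case base
    show ?case
      by (simp add: linear_0[OF linear_low_degree])
  next
    case (step c Y X)
    then obtain d f as where Y: "Y = class_of (wd (d, f, as))" and w: "(d, f, as) \<in> hom_words r p"
      by auto
    have "low_degree Y = low_degree_word (d, f, as)"
      unfolding Y using w by (subst low_degree_class_of[OF wd_Om]) (simp_all add: hom_words_iff)
    then have "low_degree Y \<in> hgen r p" "incl (low_degree Y) = Y"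
      using incl_low_degree_word[OF w assms(2)] Y by simp_all
    then show ?case
      using step.IH
        incl_lincomb[OF snd_hgen_Omega1 snd_hgen_Omega1, of "low_degree Y" r p "low_degree X" r p c]
      by (simp add: linear_add[OF linear_low_degree] linear_scale[OF linear_low_degree] hgen_add
        hgen_scaleR)
  qed
  then show "low_degree X \<in> hgen r p" "incl (low_degree X) = X"
    by blast+
qed

lemma low_degree_incl:
  assumes "snd x \<in> Omega1"
  shows "low_degree (incl x) = x"
proof -
  have function_part: "low_degree (incl (f, 0)) = (f, 0)" for f
  proof (induction f rule: fun_induct)
    case (homogeneous p f)
    then show ?case
      using low_degree_class_of[OF wd_Om, of "(tag p, f, [])"]
      by (simp add: incl_function) (simp add: hfun_def)
  qed (simp add: incl_function_add linear_add[OF linear_low_degree])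
  have form_part: "low_degree (incl (0, \<alpha>)) = (0, \<alpha>)" if "\<alpha> \<in> Omega1" for \<alpha>
    using that
  proof (induction rule: form1_induct)
    case (homogeneous p \<alpha>)
    then show ?case
      using low_degree_class_of[OF wd_Om, of "(0, 1, [(tag p, \<alpha>)])"] hform1_Omega1
      by (simp add: incl_form lact_one Omega1_AtA) (simp add: hform1_def)
  qed (simp add: incl_form_add linear_add[OF linear_low_degree])
  have "incl x = incl (fst x, 0) + incl (0, snd x)"
    using incl_add[of "(fst x, 0)" "(0, snd x)"] assms by simp
  then show ?thesis
    using assms by (simp add: linear_add[OF linear_low_degree] function_part form_part)
qed

lemma incl_eq_iff: "snd x \<in> Omega1 \<Longrightarrow> snd y \<in> Omega1 \<Longrightarrow> incl x = incl y \<longleftrightarrow> x = y"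
  using low_degree_incl by metis

lemma incl_mult:
  assumes "snd x \<in> Omega1"
  shows "incl (gen_act f x) = incl (f, 0) * incl x"
proof (induction f rule: fun_induct)
  case (add f g)
  have "snd (gen_act f x) \<in> Omega1" "snd (gen_act g x) \<in> Omega1"
    "gen_act (f + g) x = gen_act f x + gen_act g x"
    using assms by (simp_all add: gen_act_def prod_eq_iff distrib_right lact_add_left lact_Omega1
      Omega1_AtA)
  then show ?case
    using add by (simp add: incl_add incl_function_add distrib_right)
next
  case (homogeneous p f)
  have function_part: "incl (gen_act f (g, 0)) = incl (f, 0) * incl (g, 0)" for g
  proof (induction g rule: fun_induct)
    case (add g h)
    then show ?case
      by (simp add: distrib_left incl_function_add)
  next
    case (homogeneous q g)
    then show ?case
      using incl_gen_act[OF \<open>f \<in> hfun p\<close>, of "(g, 0)" 0 q] by simp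
  qed
  have "incl (gen_act f (0, \<alpha>)) = incl (f, 0) * incl (0, \<alpha>)" if "\<alpha> \<in> Omega1" for \<alpha>
    using that
  proof (induction rule: form1_induct)
    case (add \<alpha> \<beta>)
    then show ?case
      by (simp add: distrib_left incl_form_add lact_Omega1)
  next
    case (homogeneous q \<alpha>)
    then show ?case
      using incl_gen_act[OF \<open>f \<in> hfun p\<close>, of "(0, \<alpha>)" 1 q] by simp
  qed
  then show ?case
    using function_part incl_add[of "(fst x, 0)" "(0, snd x)"]
      incl_add[of "(f * fst x, 0)" "(0, lact f (snd x))"] assms
    by (simp add: gen_act_def lact_Omega1 distrib_left)
qed

lemma incl_function_mult_function: "incl (f * g, 0) = incl (f, 0) * incl (g, 0)"
  and incl_lact: "\<alpha> \<in> Omega1 \<Longrightarrow> incl (0, lact f \<alpha>) = incl (f, 0) * incl (0, \<alpha>)"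
  using incl_mult[of "(g, 0)" f] incl_mult[of "(0, \<alpha>)" f] by simp_all

end

context gerstenhaber_forms
begin

definition anchor :: "'a tens \<Rightarrow> 'a \<Rightarrow> 'a" where
  "anchor \<alpha> f = fst (low_degree (C (incl (0, \<alpha>)) (incl (f, 0))))"

definition form_bracket :: "'a tens \<Rightarrow> 'a tens \<Rightarrow> 'a tens" where
  "form_bracket \<alpha> \<beta> = snd (low_degree (C (incl (0, \<alpha>)) (incl (0, \<beta>))))"

lemma C_add_left: "X \<in> forms \<Longrightarrow> X' \<in> forms \<Longrightarrow> Y \<in> forms \<Longrightarrow> C (X + X') Y = C X Y + C X' Y"
  using C_lincomb_left[of X X' Y 1] by simp

lemma C_add_right: "X \<in> forms \<Longrightarrow> Y \<in> forms \<Longrightarrow> Y' \<in> forms \<Longrightarrow> C X (Y + Y') = C X Y + C X Y'"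
  using C_lincomb_right[of X Y Y' 1] by simp

lemma C_mult_left:
  assumes X: "X \<in> hform r p" and Y: "Y \<in> hform s q" and Z: "Z \<in> hform t u"
  shows "C (X * Y) Z = X * C Y Z + sgni (r * s + p * q) *\<^sub>R (Y * C X Z)"
proof -
  have "C Z X * Y = sgni ((t + r - 1) * s + (u + p) * q) *\<^sub>R (Y * C Z X)"
    by (rule hform_commute[OF C_hform[OF Z X] Y])
  then show ?thesis
    by (simp add: C_antisym[OF hform_mult[OF X Y] Z] C_leibniz[OF Z X Y] C_antisym[OF Y Z]
      C_antisym[OF X Z] algebra_simps sgni_add sgni_diff)
qed

lemma C_incl:
  assumes x: "x \<in> hgen r p" and y: "y \<in> hgen s q" and "r + s \<le> 2"
  shows "low_degree (C (incl x) (incl y)) \<in> hgen (r + s - 1) (p + q)"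
    "C (incl x) (incl y) = incl (low_degree (C (incl x) (incl y)))"
  using low_degree_hform[OF C_hform[OF incl_hform[OF x] incl_hform[OF y]]] assms(3) by simp_all

lemma C_functions:
  assumes "f \<in> hfun p" "g \<in> hfun q"
  shows "C (incl (f, 0)) (incl (g, 0)) = 0"
  using C_hform[of "incl (f, 0)" 0 p "incl (g, 0)" 0 q] incl_hform[of "(f, 0)" 0 p]
    incl_hform[of "(g, 0)" 0 q] assms
  by (simp add: hform_neg_degree)

lemma anchor:
  assumes "\<alpha> \<in> hform1 p" "f \<in> hfun q"
  shows anchor_hfun: "anchor \<alpha> f \<in> hfun (p + q)"
    and incl_anchor_hform1: "C (incl (0, \<alpha>)) (incl (f, 0)) = incl (anchor \<alpha> f, 0)"
proof -
  have "low_degree (C (incl (0, \<alpha>)) (incl (f, 0))) \<in> hgen 0 (p + q)"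
    "C (incl (0, \<alpha>)) (incl (f, 0)) = incl (low_degree (C (incl (0, \<alpha>)) (incl (f, 0))))"
    using C_incl[of "(0, \<alpha>)" 1 p "(f, 0)" 0 q] assms by simp_all
  then show "anchor \<alpha> f \<in> hfun (p + q)" "C (incl (0, \<alpha>)) (incl (f, 0)) = incl (anchor \<alpha> f, 0)"
    by (auto simp: anchor_def elim!: hgen_cases)
qed

lemma form_bracket:
  assumes "\<alpha> \<in> hform1 p" "\<beta> \<in> hform1 q"
  shows form_bracket_hform1: "form_bracket \<alpha> \<beta> \<in> hform1 (p + q)"
    and incl_form_bracket_hform1: "C (incl (0, \<alpha>)) (incl (0, \<beta>)) = incl (0, form_bracket \<alpha> \<beta>)"
proof -
  have "low_degree (C (incl (0, \<alpha>)) (incl (0, \<beta>))) \<in> hgen 1 (p + q)"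
    "C (incl (0, \<alpha>)) (incl (0, \<beta>)) = incl (low_degree (C (incl (0, \<alpha>)) (incl (0, \<beta>))))"
    using C_incl[of "(0, \<alpha>)" 1 p "(0, \<beta>)" 1 q] assms by simp_all
  then show "form_bracket \<alpha> \<beta> \<in> hform1 (p + q)"
    "C (incl (0, \<alpha>)) (incl (0, \<beta>)) = incl (0, form_bracket \<alpha> \<beta>)"
    by (auto simp: form_bracket_def elim!: hgen_cases)
qed

lemma anchor_lincomb:
  "\<alpha> \<in> Omega1 \<Longrightarrow> \<beta> \<in> Omega1 \<Longrightarrow> anchor (c *\<^sub>R \<alpha> + \<beta>) f = c *\<^sub>R anchor \<alpha> f + anchor \<beta> f"
  using incl_lincomb[of "(0, \<alpha>)" "(0, \<beta>)" c]
  by (simp add: anchor_def C_lincomb_left incl_forms linear_add[OF linear_low_degree]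
    linear_scale[OF linear_low_degree])

lemma form_bracket_lincomb:
  assumes "\<alpha> \<in> Omega1" "\<alpha>' \<in> Omega1" "\<beta> \<in> Omega1"
  shows "form_bracket (c *\<^sub>R \<alpha> + \<alpha>') \<beta> = c *\<^sub>R form_bracket \<alpha> \<beta> + form_bracket \<alpha>' \<beta>"
    and "form_bracket \<beta> (c *\<^sub>R \<alpha> + \<alpha>') = c *\<^sub>R form_bracket \<beta> \<alpha> + form_bracket \<beta> \<alpha>'"
  using incl_lincomb[of "(0, \<alpha>)" "(0, \<alpha>')" c] assms
  by (simp_all add: form_bracket_def C_lincomb_left C_lincomb_right incl_forms
      linear_add[OF linear_low_degree] linear_scale[OF linear_low_degree])

lemmas anchor_add_left = anchor_lincomb[of _ _ 1, simplified]
  and form_bracket_add = form_bracket_lincomb[of _ _ _ 1, simplified]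

lemma linear_anchor:
  assumes "\<alpha> \<in> Omega1"
  shows "linear (anchor \<alpha>)"
proof (rule linearI)
  show "anchor \<alpha> (f + g) = anchor \<alpha> f + anchor \<alpha> g" for f g
    using assms by (simp add: anchor_def incl_function_add C_add_right incl_forms
      linear_add[OF linear_low_degree])
  show "anchor \<alpha> (c *\<^sub>R f) = c *\<^sub>R anchor \<alpha> f" for c f
    using assms C_lincomb_right[of "incl (0, \<alpha>)" "incl (f, 0)" 0 c]
      C_lincomb_right[of "incl (0, \<alpha>)" 0 0 "-1"] incl_scaleR[of "(f, 0)" c]
    by (simp add: anchor_def incl_forms linear_scale[OF linear_low_degree])
qed

lemma incl_anchor:
  assumes "\<alpha> \<in> Omega1"
  shows "C (incl (0, \<alpha>)) (incl (f, 0)) = incl (anchor \<alpha> f, 0)"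
  using assms
proof (induction rule: form1_induct)
  case (homogeneous p \<alpha>)
  then have \<alpha>: "\<alpha> \<in> Omega1" "incl (0, \<alpha>) \<in> forms"
    by (simp_all add: hform1_Omega1 incl_forms)
  show ?case
  proof (induction f rule: fun_induct)
    case (homogeneous q f)
    with \<open>\<alpha> \<in> hform1 p\<close> show ?case
      by (rule incl_anchor_hform1)
  qed (use \<alpha> in \<open>simp add: incl_function_add C_add_right incl_forms linear_add[OF linear_anchor]\<close>)
qed (simp add: incl_form_add incl_function_add C_add_left incl_forms anchor_add_left)

lemma form_bracket_inhomogeneous:
  assumes "\<alpha> \<in> Omega1" "\<beta> \<in> Omega1"
  shows form_bracket_Omega1: "form_bracket \<alpha> \<beta> \<in> Omega1"
    and incl_form_bracket: "C (incl (0, \<alpha>)) (incl (0, \<beta>)) = incl (0, form_bracket \<alpha> \<beta>)"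
proof -
  have "form_bracket \<alpha> \<beta> \<in> Omega1 \<and> C (incl (0, \<alpha>)) (incl (0, \<beta>)) = incl (0, form_bracket \<alpha> \<beta>)"
    using assms(1)
  proof (induction rule: form1_induct)
    case (homogeneous p \<alpha>)
    then have \<alpha>: "\<alpha> \<in> Omega1" "incl (0, \<alpha>) \<in> forms"
      by (simp_all add: hform1_Omega1 incl_forms)
    from assms(2) show ?case
    proof (induction rule: form1_induct)
      case (homogeneous q \<beta>)
      then show ?case
        using \<open>\<alpha> \<in> hform1 p\<close> form_bracket_hform1 incl_form_bracket_hform1 hform1_Omega1 by metis
    qed (use \<alpha> in \<open>simp add: incl_form_add C_add_right incl_forms form_bracket_add Omega1_add\<close>)
  qed (use assms(2) in \<open>simp add: incl_form_add C_add_left incl_forms form_bracket_add Omega1_add\<close>)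
  then show "form_bracket \<alpha> \<beta> \<in> Omega1" "C (incl (0, \<alpha>)) (incl (0, \<beta>)) = incl (0, form_bracket \<alpha> \<beta>)"
    by blast+
qed

lemma anchor_mult:
  assumes \<alpha>: "\<alpha> \<in> hform1 p" and f: "f \<in> hfun q"
  shows "anchor \<alpha> (f * g) = anchor \<alpha> f * g + sgni (p * q) *\<^sub>R (f * anchor \<alpha> g)"
proof (induction g rule: fun_induct)
  case (add g h)
  then show ?case
    using linear_anchor[OF hform1_Omega1[OF \<alpha>]] by (simp add: linear_add algebra_simps)
next
  case (homogeneous u g)
  have "C (incl (0, \<alpha>)) (incl (f, 0) * incl (g, 0)) = C (incl (0, \<alpha>)) (incl (f, 0)) * incl (g, 0)
      + sgni (p * q) *\<^sub>R (incl (f, 0) * C (incl (0, \<alpha>)) (incl (g, 0)))"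
    using C_leibniz[of "incl (0, \<alpha>)" 1 p "incl (f, 0)" 0 q "incl (g, 0)" 0 u] \<alpha> f homogeneous
    by (simp add: incl_hform)
  then have "incl (anchor \<alpha> (f * g), 0)
      = incl (sgni (p * q) *\<^sub>R (f * anchor \<alpha> g) + anchor \<alpha> f * g, 0)"
    using incl_lincomb[of "(f * anchor \<alpha> g, 0)" "(anchor \<alpha> f * g, 0)" "sgni (p * q)"]
    by (simp add: incl_function_mult_function add.commute incl_anchor[OF hform1_Omega1[OF \<alpha>]]
        flip: incl_function_mult_function)
  then show ?case
    by (simp add: incl_eq_iff add.commute)
qed

lemma anchor_lact:
  assumes "\<alpha> \<in> Omega1"
  shows "anchor (lact f \<alpha>) g = f * anchor \<alpha> g"
  using assms
proof (induction rule: form1_induct)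
  case (add \<alpha> \<beta>)
  then show ?case
    by (simp add: anchor_add_left lact_Omega1 distrib_left)
next
  case (homogeneous q \<alpha>)
  note \<alpha> = homogeneous hform1_Omega1[OF homogeneous]
  show ?case
  proof (induction f rule: fun_induct)
    case (add f f')
    then show ?case
      using \<alpha>(2) by (simp add: anchor_add_left lact_add_left Omega1_AtA lact_Omega1 distrib_right)
  next
    case f: (homogeneous p f)
    show ?case
    proof (induction g rule: fun_induct)
      case (add g h)
      then show ?case
        using linear_anchor[OF \<alpha>(2)] linear_anchor[OF lact_Omega1[OF \<alpha>(2)]]
        by (simp add: linear_add distrib_left)
    next
      case (homogeneous u g)
      then have "C (incl (f, 0) * incl (0, \<alpha>)) (incl (g, 0))
          = incl (f, 0) * C (incl (0, \<alpha>)) (incl (g, 0))"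
        using C_mult_left[of "incl (f, 0)" 0 p "incl (0, \<alpha>)" 1 q "incl (g, 0)" 0 u]
          C_functions[OF f] f \<alpha>(1)
        by (simp add: incl_hform)
      then have "incl (anchor (lact f \<alpha>) g, 0) = incl (f * anchor \<alpha> g, 0)"
        using \<alpha>(2) by (simp add: incl_anchor lact_Omega1 incl_function_mult_function flip: incl_lact)
      then show ?case
        by (simp add: incl_eq_iff)
    qed
  qed
qed

lemma form_bracket_leibniz:
  assumes \<alpha>: "\<alpha> \<in> hform1 p" and f: "f \<in> hfun q" and "\<beta> \<in> Omega1"
  shows "form_bracket \<alpha> (lact f \<beta>) = lact (anchor \<alpha> f) \<beta> + sgni (p * q) *\<^sub>R lact f (form_bracket \<alpha> \<beta>)"
  using assms(3)
proof (induction rule: form1_induct)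
  case (add \<beta> \<gamma>)
  then show ?case
    using hform1_Omega1[OF \<alpha>] by (simp add: form_bracket_add lact_Omega1 scaleR_add_right add_ac)
next
  case (homogeneous u \<beta>)
  note Omega1 = hform1_Omega1[OF \<alpha>] hform1_Omega1[OF homogeneous]
  have "C (incl (0, \<alpha>)) (incl (f, 0) * incl (0, \<beta>)) = C (incl (0, \<alpha>)) (incl (f, 0)) * incl (0, \<beta>)
      + sgni (p * q) *\<^sub>R (incl (f, 0) * C (incl (0, \<alpha>)) (incl (0, \<beta>)))"
    using C_leibniz[of "incl (0, \<alpha>)" 1 p "incl (f, 0)" 0 q "incl (0, \<beta>)" 1 u] \<alpha> f homogeneous
    by (simp add: incl_hform)
  then have "incl (0, form_bracket \<alpha> (lact f \<beta>))
      = incl (0, sgni (p * q) *\<^sub>R lact f (form_bracket \<alpha> \<beta>) + lact (anchor \<alpha> f) \<beta>)"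
    using incl_lincomb[of "(0, lact f (form_bracket \<alpha> \<beta>))" "(0, lact (anchor \<alpha> f) \<beta>)"
      "sgni (p * q)"] Omega1
    by (simp add: incl_lact form_bracket_Omega1 lact_Omega1 add.commute incl_anchor incl_form_bracket
        flip: incl_lact)
  then show ?case
    using Omega1 by (simp add: incl_eq_iff form_bracket_Omega1 lact_Omega1 Omega1_add Omega1_scaleR
      add.commute)
qed

lemma form_bracket_antisym:
  assumes \<alpha>: "\<alpha> \<in> hform1 p" and \<beta>: "\<beta> \<in> hform1 q"
  shows "form_bracket \<alpha> \<beta> = - (sgni (p * q) *\<^sub>R form_bracket \<beta> \<alpha>)"
proof -
  note Omega1 = hform1_Omega1[OF \<alpha>] hform1_Omega1[OF \<beta>]
  have "incl (0, form_bracket \<alpha> \<beta>) = - (sgni (p * q) *\<^sub>R incl (0, form_bracket \<beta> \<alpha>))"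
    using C_antisym[of "incl (0, \<alpha>)" 1 p "incl (0, \<beta>)" 1 q] \<alpha> \<beta> Omega1
    by (simp add: incl_hform incl_form_bracket)
  also have "\<dots> = incl (0, - (sgni (p * q) *\<^sub>R form_bracket \<beta> \<alpha>))"
    using incl_scaleR[of "(0, form_bracket \<beta> \<alpha>)" "- sgni (p * q)"] Omega1
    by (simp add: form_bracket_Omega1)
  finally show ?thesis
    using Omega1 Omega1_scaleR[of "form_bracket \<beta> \<alpha>" "- sgni (p * q)"]
    by (simp add: incl_eq_iff form_bracket_Omega1)
qed

lemma form_bracket_jacobi:
  assumes \<alpha>: "\<alpha> \<in> hform1 p" and \<beta>: "\<beta> \<in> hform1 q" and \<gamma>: "\<gamma> \<in> hform1 u"
  shows "form_bracket \<alpha> (form_bracket \<beta> \<gamma>)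
    = form_bracket (form_bracket \<alpha> \<beta>) \<gamma> + sgni (p * q) *\<^sub>R form_bracket \<beta> (form_bracket \<alpha> \<gamma>)"
proof -
  note Omega1 = hform1_Omega1[OF \<alpha>] hform1_Omega1[OF \<beta>] hform1_Omega1[OF \<gamma>]
  let ?left = "form_bracket (form_bracket \<alpha> \<beta>) \<gamma>" and ?right = "form_bracket \<beta> (form_bracket \<alpha> \<gamma>)"
  have "incl (0, form_bracket \<alpha> (form_bracket \<beta> \<gamma>))
      = incl (0, ?left) + sgni (p * q) *\<^sub>R incl (0, ?right)"
    using C_jacobi[of "incl (0, \<alpha>)" 1 p "incl (0, \<beta>)" 1 q "incl (0, \<gamma>)" 1 u] \<alpha> \<beta> \<gamma> Omega1
    by (simp add: incl_hform incl_form_bracket form_bracket_Omega1)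
  also have "\<dots> = incl (0, sgni (p * q) *\<^sub>R ?right + ?left)"
    using incl_lincomb[of "(0, ?right)" "(0, ?left)" "sgni (p * q)"] Omega1
    by (simp add: form_bracket_Omega1 add.commute)
  finally show ?thesis
    using Omega1 by (simp add: incl_eq_iff form_bracket_Omega1 Omega1_add Omega1_scaleR add.commute)
qed

theorem algebroid_form_bracket: "algebroid G form_bracket anchor"
  by (intro algebroid.intro[OF supercommutative_algebra_axioms] algebroid_axioms.intro;
      (rule anchor_lincomb linear_anchor anchor_hfun anchor_mult anchor_lact form_bracket_Omega1
        form_bracket_lincomb form_bracket_hform1 form_bracket_antisym
        form_bracket_jacobi form_bracket_leibniz; assumption))

end

context gerstenhaber_bracket
begin

theorem lie_superalgebroid_exists:
  "\<exists>brk \<rho>. lie_superalgebroid G brk \<rho> \<and>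
    (\<forall>\<alpha>\<in>Omega1. \<forall>\<beta>\<in>Omega1. oeq G (emb1 G (brk \<alpha> \<beta>)) (br (emb1 G \<alpha>) (emb1 G \<beta>))) \<and>
    (\<forall>\<alpha>\<in>Omega1. \<forall>f. oeq G (embA G (\<rho> \<alpha> f)) (br (emb1 G \<alpha>) (embA G f)))"
  using algebroid.lie_superalgebroid[OF algebroid_form_bracket]
  by (intro exI[of _ form_bracket] exI[of _ anchor])
    (simp add: oeq_iff_class_of embA_Om emb1_Om br_Om class_of_br class_of_embA class_of_emb1
      form_bracket_Omega1 incl_anchor incl_form_bracket)

end

theorem mainTheorem5:
  fixes G :: "int \<Rightarrow> 'a::real_algebra_1 set"
  assumes "graded_supercomm_algebra G"
  shows
    "(\<forall>br. gerstenhaber G br \<longrightarrow>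
        (\<exists>brk \<rho>. lie_superalgebroid G brk \<rho> \<and>
           (\<forall>\<alpha> \<in> Omega1. \<forall>\<beta> \<in> Omega1. oeq G (emb1 G (brk \<alpha> \<beta>)) (br (emb1 G \<alpha>) (emb1 G \<beta>))) \<and>
           (\<forall>\<alpha> \<in> Omega1. \<forall>f. oeq G (embA G (\<rho> \<alpha> f)) (br (emb1 G \<alpha>) (embA G f)))))
     \<and>
     (\<forall>brk \<rho>. lie_superalgebroid G brk \<rho> \<longrightarrow>
        (\<exists>br. gerstenhaber G br \<and>
           (\<forall>f g. oeq G (br (embA G f) (embA G g)) 0) \<and>
           (\<forall>\<alpha> \<in> Omega1. \<forall>f. oeq G (br (emb1 G \<alpha>) (embA G f)) (embA G (\<rho> \<alpha> f))) \<and>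
           (\<forall>\<alpha> \<in> Omega1. \<forall>\<beta> \<in> Omega1. oeq G (br (emb1 G \<alpha>) (emb1 G \<beta>)) (emb1 G (brk \<alpha> \<beta>)))))
     \<and>
     ((\<exists>br. gerstenhaber G br) \<longleftrightarrow> (\<exists>brk \<rho>. lie_superalgebroid G brk \<rho>))"
  (is "?to_algebroid \<and> ?to_gerstenhaber \<and> _")
proof -
  interpret supercommutative_algebra G
    by (rule supercommutative_algebra.intro[OF assms])
  have ?to_algebroid
    by (intro allI impI gerstenhaber_bracket.lie_superalgebroid_exists gerstenhaber_bracket.intro
        supercommutative_algebra_axioms gerstenhaber_bracket_axioms.intro)
  moreover have ?to_gerstenhaber
    by (intro allI impI algebroid.gerstenhaber_exists lie_superalgebroid_imp_algebroid)
  ultimately show ?thesis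
    by blast
qed

end
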